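(* Let $g$ be an admissible gap penalty (as specified in the context) with $\lim_{k\to\infty}g(k)/\log k=\infty$, let $\psi(\theta)=\lim_{\kappa\to\infty}\psi_\kappa(\theta)/\kappa$ for $\theta>0$, and assume that $\psi(\theta)=0$ has a unique positive root $\widetilde{\theta}$. If the derivative $\psi'(\widetilde{\theta})$ is well defined, then $$\frac{|\mathbf{z}_*|}{\log n}\to\frac{2}{\widetilde{\theta}\,\psi'(\widetilde{\theta})}\quad\text{almost surely as } n\to\infty,$$ where $\mathbf{z}_*$ is the optimal local alignment of $(\mathbf{x}_n,\mathbf{y}_n)$ and $|\mathbf{z}_*|$ is its number of matches.
   Context: Setting. $\mathcal{A}$ is a finite alphabet, $K:\mathcal{A}\times\mathcal{A}\to\mathbf{R}$ is a symmetric score matrix, $K(a,b)=K(b,a)$. The letters $x_1,x_2,\dots$ and $y_1,y_2,\dots$ are all independent and identically distributed with law $\mu$ on $\mathcal{A}$, $\mu(a)>0$ for all $a\in\mathcal{A}$. It is assumed that $E[K(x_1,y_1)]<0$ and $K_{\max}:=\max_{a,b\in\mathcal{A}}K(a,b)>0$. Write $\mathbf{x}_m=x_1\cdots x_m$, $\mathbf{y}_n=y_1\cdots y_n$. Gap penalty. $g:\{0,1,\dots\}\to[0,\infty)$ is nondecreasing with $g(0)=0$ and concave, i.e. $g(k+1)-g(k)\le g(k)-g(k-1)$ for all $k\ge1$. Alignments and scores. $\mathcal{Z}$ is the class of all nonempty candidate alignments $\mathbf{z}=\{(i(t),j(t)):1\le t\le u\}$, $u\ge1$, where $i(1)<\cdots<i(u)$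 and $j(1)<\cdots<j(u)$ are positive integers; $|\mathbf{z}|=u$ is the number of matches. If $i(u)\le m$ and $j(u)\le n$, $$S_{\mathbf{z}}(\mathbf{x}_m,\mathbf{y}_n)=\sum_{t=1}^{u}K(x_{i(t)},y_{j(t)})-\sum_{t=1}^{u-1}\bigl[g(i(t+1)-i(t)-1)+g(j(t+1)-j(t)-1)\bigr],$$ $$R_{\mathbf{z}}(\mathbf{x}_m,\mathbf{y}_n)=S_{\mathbf{z}}(\mathbf{x}_m,\mathbf{y}_n)-g(i(1)-1)-g(j(1)-1)-g(m-i(u))-g(n-j(u)),$$ and both are $-\infty$ if $i(u)>m$ or $j(u)>n$. The local alignment score is $H(\mathbf{x}_m,\mathbf{y}_n)=\sup_{\mathbf{z}\in\mathcal{Z}}S_{\mathbf{z}}(\mathbf{x}_m,\mathbf{y}_n)$. Optimal local alignment. Fix an ordering of the candidate alignments in $\mathcal{Z}$. For given $\mathbf{x}_n,\mathbf{y}_n$, $\mathbf{z}_*$ is the smallest alignment $\mathbf{z}\in\mathcal{Z}$ with respect to this ordering satisfying $S_{\mathbf{z}}(\mathbf{x}_n,\mathbf{y}_n)=H(\mathbf{x}_n,\mathbf{y}_n)$. The functions $\psi_\kappa$ and $\psi$. For a positive integer $\kappa$ let $\mathcal{Z}_\kappa=\{\mathbf{z}\in\mathcal{Z}:(1,1)\in\mathbf{z},\ |\mathbf{z}|=\kappa\}$, and for $m,n\ge\kappa$ let $G_\kappa(\mathbf{x}_m,\mathbf{y}_n)=\max_{\zeta\in\mathcal{Z}_\kappa}R_\zeta(\mathbf{x}_m,\mathbf{y}_n)$.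 For $\theta>0$ let $$h_\kappa(\theta)=\sum_{m,n\ge\kappa}E\exp[\theta G_\kappa(\mathbf{x}_m,\mathbf{y}_n)],\qquad \psi_\kappa(\theta)=\log h_\kappa(\theta).$$ Under $\lim_{k\to\infty}g(k)/\log k=\infty$, the limit $\psi(\theta)=\lim_{\kappa\to\infty}\psi_\kappa(\theta)/\kappa$ exists and is finite for every $\theta>0$. *)

theory Defs
  imports "HOL-Probability.Probability"
begin

text \<open>
  An alignment \<open>{(i(t), j(t)) : 1 \<le> t \<le> u}\<close> is encoded as the list of its pairs in increasing
  order, so that \<open>i(t)\<close> and \<open>j(t)\<close> are the components of \<open>z ! (t - 1)\<close> and the number of matches is
  \<open>length z\<close>. The strict order makes this encoding one-to-one. Letters are indexed from 1, and
  the words \<open>x_1 ... x_m\<close> and \<open>y_1 ... y_n\<close> are given by infinite sequences \<open>x\<close>, \<open>y\<close> together with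
  the lengths \<open>m\<close>, \<open>n\<close>.
\<close>

type_synonym alignment = "(nat \<times> nat) list"

definition alignments :: "alignment set" where
  "alignments = {z. z \<noteq> [] \<and> sorted_wrt (\<lambda>p q. fst p < fst q \<and> snd p < snd q) z \<and>
                    (\<forall>p\<in>set z. 1 \<le> fst p \<and> 1 \<le> snd p)}"

definition admissible_gap_penalty :: "(nat \<Rightarrow> real) \<Rightarrow> bool" where
  "admissible_gap_penalty g \<longleftrightarrow>
     g 0 = 0 \<and> (\<forall>k. 0 \<le> g k) \<and> mono g \<and> (\<forall>k\<ge>1. g (k + 1) - g k \<le> g k - g (k - 1))"

definition align_score ::
  "('a \<Rightarrow> 'a \<Rightarrow> real) \<Rightarrow> (nat \<Rightarrow> real) \<Rightarrow> alignment \<Rightarrow> (nat \<Rightarrow> 'a) \<Rightarrow> (nat \<Rightarrow> 'a) \<Rightarrow> nat \<Rightarrow> nat \<Rightarrow> ereal" where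
  "align_score K g z x y m n =
     (if fst (last z) \<le> m \<and> snd (last z) \<le> n
      then ereal ((\<Sum>t<length z. K (x (fst (z ! t))) (y (snd (z ! t)))) -
                  (\<Sum>t<length z - 1. g (fst (z ! Suc t) - fst (z ! t) - 1) +
                                      g (snd (z ! Suc t) - snd (z ! t) - 1)))
      else -\<infinity>)"

definition global_score ::
  "('a \<Rightarrow> 'a \<Rightarrow> real) \<Rightarrow> (nat \<Rightarrow> real) \<Rightarrow> alignment \<Rightarrow> (nat \<Rightarrow> 'a) \<Rightarrow> (nat \<Rightarrow> 'a) \<Rightarrow> nat \<Rightarrow> nat \<Rightarrow> ereal" where
  "global_score K g z x y m n =
     (if fst (last z) \<le> m \<and> snd (last z) \<le> n
      then align_score K g z x y m n -
           ereal (g (fst (hd z) - 1) + g (snd (hd z) - 1) + g (m - fst (last z)) + g (n - snd (last z)))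
      else -\<infinity>)"

definition local_score ::
  "('a \<Rightarrow> 'a \<Rightarrow> real) \<Rightarrow> (nat \<Rightarrow> real) \<Rightarrow> (nat \<Rightarrow> 'a) \<Rightarrow> (nat \<Rightarrow> 'a) \<Rightarrow> nat \<Rightarrow> nat \<Rightarrow> ereal" where
  "local_score K g x y m n = (SUP z\<in>alignments. align_score K g z x y m n)"

definition optimal_alignments ::
  "('a \<Rightarrow> 'a \<Rightarrow> real) \<Rightarrow> (nat \<Rightarrow> real) \<Rightarrow> (nat \<Rightarrow> 'a) \<Rightarrow> (nat \<Rightarrow> 'a) \<Rightarrow> nat \<Rightarrow> alignment set" where
  "optimal_alignments K g x y n =
     {z \<in> alignments. align_score K g z x y n n = local_score K g x y n n}"

text \<open>
  For \<open>n \<ge> 1\<close> only the finitely many alignments contained in \<open>{1..n} \<times> {1..n}\<close> have a score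
  different from \<open>-\<infinity>\<close>, so the smallest optimal alignment exists for every linear order \<open>r\<close> on
  \<open>alignments\<close>; no well-ordering is needed.
\<close>

definition optimal_alignment ::
  "alignment rel \<Rightarrow> ('a \<Rightarrow> 'a \<Rightarrow> real) \<Rightarrow> (nat \<Rightarrow> real) \<Rightarrow> (nat \<Rightarrow> 'a) \<Rightarrow> (nat \<Rightarrow> 'a) \<Rightarrow> nat \<Rightarrow> alignment" where
  "optimal_alignment r K g x y n =
     (THE z. z \<in> optimal_alignments K g x y n \<and> (\<forall>w\<in>optimal_alignments K g x y n. (z, w) \<in> r))"

definition anchored_alignments :: "nat \<Rightarrow> alignment set" where
  "anchored_alignments \<kappa> = {z \<in> alignments. (1, 1) \<in> set z \<and> length z = \<kappa>}"

text \<open>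
  For \<open>m, n \<ge> \<kappa> \<ge> 1\<close> the supremum below is an attained, finite maximum, since only finitely many
  alignments contribute a value different from \<open>-\<infinity>\<close> and \<open>[(1,1), ..., (\<kappa>,\<kappa>)]\<close> is one of them.
\<close>

definition anchored_score ::
  "('a \<Rightarrow> 'a \<Rightarrow> real) \<Rightarrow> (nat \<Rightarrow> real) \<Rightarrow> nat \<Rightarrow> (nat \<Rightarrow> 'a) \<Rightarrow> (nat \<Rightarrow> 'a) \<Rightarrow> nat \<Rightarrow> nat \<Rightarrow> ereal" where
  "anchored_score K g \<kappa> x y m n = (SUP z\<in>anchored_alignments \<kappa>. global_score K g z x y m n)"

text \<open>
  The double series converges for \<open>\<kappa> \<ge> 1\<close>, \<open>\<theta> > 0\<close> when \<open>g k / ln k\<close> tends to infinity: subadditivity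
  of \<open>g\<close> bounds the anchored score by \<open>\<kappa> * K_max - g (m - \<kappa>) - g (n - \<kappa>)\<close>.
\<close>

definition h_kappa ::
  "'w measure \<Rightarrow> (nat \<Rightarrow> 'w \<Rightarrow> 'a) \<Rightarrow> (nat \<Rightarrow> 'w \<Rightarrow> 'a) \<Rightarrow> ('a \<Rightarrow> 'a \<Rightarrow> real) \<Rightarrow> (nat \<Rightarrow> real) \<Rightarrow>
   nat \<Rightarrow> real \<Rightarrow> real" where
  "h_kappa M X Y K g \<kappa> \<theta> =
     (\<Sum>\<^sub>\<infinity>(m, n)\<in>{\<kappa>..} \<times> {\<kappa>..}.
        (LINT \<omega>|M. exp (\<theta> * real_of_ereal (anchored_score K g \<kappa> (\<lambda>i. X i \<omega>) (\<lambda>i. Y i \<omega>) m n))))"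

definition psi_kappa ::
  "'w measure \<Rightarrow> (nat \<Rightarrow> 'w \<Rightarrow> 'a) \<Rightarrow> (nat \<Rightarrow> 'w \<Rightarrow> 'a) \<Rightarrow> ('a \<Rightarrow> 'a \<Rightarrow> real) \<Rightarrow> (nat \<Rightarrow> real) \<Rightarrow>
   nat \<Rightarrow> real \<Rightarrow> real" where
  "psi_kappa M X Y K g \<kappa> \<theta> = ln (h_kappa M X Y K g \<kappa> \<theta>)"

definition psi ::
  "'w measure \<Rightarrow> (nat \<Rightarrow> 'w \<Rightarrow> 'a) \<Rightarrow> (nat \<Rightarrow> 'w \<Rightarrow> 'a) \<Rightarrow> ('a \<Rightarrow> 'a \<Rightarrow> real) \<Rightarrow> (nat \<Rightarrow> real) \<Rightarrow>
   real \<Rightarrow> real" where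
  "psi M X Y K g \<theta> = lim (\<lambda>\<kappa>. psi_kappa M X Y K g \<kappa> \<theta> / real \<kappa>)"

end

theory Submission
  imports Defs "HOL-Real_Asymp.Real_Asymp"
begin

text \<open>
  Write \<open>a = 2 / (\<theta> D)\<close>. The theorem is a comparison of two exponential rates: the best score over
  all alignments is almost surely at least about \<open>(2 / \<theta>) ln n\<close>, whereas the best score over
  alignments with a number of matches outside \<open>(a \<plusminus> e) ln n\<close> is smaller by a constant factor. The
  optimal alignment must therefore have about \<open>a ln n\<close> matches.

  The function \<open>\<psi>\<close>. Anchored scores are additive under concatenation, because the final gap of the
  left piece is charged like the gap between the pieces. Cutting an alignment after a given number of
  matches thus makes \<open>h\<^sub>\<kappa>\<close> submultiplicative, and \<open>\<psi>(t)\<close> exists as the infimum of \<open>\<psi>\<^sub>\<kappa>(t) / \<kappa>\<close>. It is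
  convex and bounded by \<open>t K\<^sub>m\<^sub>a\<^sub>x\<close>, so that its right limit at \<open>0\<close> is at most \<open>0\<close>; together with the
  uniqueness of the root this forces \<open>D > 0\<close> (\<open>Psi_root_derivative_pos\<close>).

  Upper bound. A union bound over the first match shows that some alignment with \<open>\<kappa>\<close> matches scores
  at least \<open>s\<close> with probability at most \<open>n\<^sup>2 exp (- t s) h\<^sub>\<kappa>(t)\<close>, for every \<open>t > 0\<close>. For
  \<open>s = (2 / \<theta>) ln n\<close> and \<open>\<kappa> = b ln n\<close> the exponent of \<open>n\<close> is about \<open>2 - 2 t / \<theta> + b \<psi>(t)\<close>. It vanishes
  at \<open>t = \<theta>\<close> and has slope \<open>D (b - a)\<close> there, so it is negative for some \<open>t\<close> near \<open>\<theta>\<close> unless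
  \<open>b = a\<close> (\<open>upper_tail\<close>).

  Lower bound. For \<open>t\<close> slightly above \<open>\<theta>\<close> we have \<open>\<psi>(t) > 0\<close>, and then a single pair of word lengths,
  which may be taken equal, already gives \<open>E exp (t G\<^sub>\<kappa>) > 1\<close> (\<open>square_mgf_gt_1_exists\<close>). Regarding
  words of this length as letters and \<open>G\<^sub>\<kappa>\<close> as a score matrix reduces the claim to alignments without
  gaps, where a second moment computation over pairs of blocks that are typical for the tilted law
  applies (\<open>block_matching\<close>, \<open>lower_tail\<close>). The symmetry of the score matrix enters here: it makes the
  two marginals of the tilted law equal, which keeps the blocks of one word that take part in a
  high-scoring pair frequent enough to occur.

  Both estimates fail with probability at most a negative power of \<open>n\<close>. This is summable along
  powers of \<open>2\<close>, and monotonicity in \<open>n\<close> bridges the gaps between them.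
\<close>

section \<open>Scores of alignments\<close>

definition fits :: "nat \<Rightarrow> nat \<Rightarrow> alignment \<Rightarrow> bool" where
  "fits m n z \<longleftrightarrow> fst (last z) \<le> m \<and> snd (last z) \<le> n"

definition shift :: "nat \<Rightarrow> nat \<Rightarrow> alignment \<Rightarrow> alignment" where
  "shift a b = map (\<lambda>p. (a + fst p, b + snd p))"

text \<open>
  Recursion along the list instead of a sum over positions, so that shifting and concatenating
  alignments is a matter of list induction.
\<close>

fun raw_score ::
  "('a \<Rightarrow> 'a \<Rightarrow> real) \<Rightarrow> (nat \<Rightarrow> real) \<Rightarrow> (nat \<Rightarrow> 'a) \<Rightarrow> (nat \<Rightarrow> 'a) \<Rightarrow> alignment \<Rightarrow> real" where
  "raw_score K g x y [] = 0"
| "raw_score K g x y [p] = K (x (fst p)) (y (snd p))"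
| "raw_score K g x y (p # q # z) =
     K (x (fst p)) (y (snd p)) - g (fst q - fst p - 1) - g (snd q - snd p - 1)
     + raw_score K g x y (q # z)"

lemma align_score_eq_raw_score:
  assumes "z \<noteq> []" "fits m n z"
  shows "align_score K g z x y m n = ereal (raw_score K g x y z)"
proof -
  have "(\<Sum>t<length z. K (x (fst (z ! t))) (y (snd (z ! t)))) -
        (\<Sum>t<length z - 1. g (fst (z ! Suc t) - fst (z ! t) - 1) +
                            g (snd (z ! Suc t) - snd (z ! t) - 1)) = raw_score K g x y z"
    using assms(1)
  proof (induction z rule: induct_list012)
    case (3 p q z)
    then have IH: "(\<Sum>t<length (q # z). K (x (fst ((q # z) ! t))) (y (snd ((q # z) ! t)))) -
        (\<Sum>t<length (q # z) - 1. g (fst ((q # z) ! Suc t) - fst ((q # z) ! t) - 1) +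
            g (snd ((q # z) ! Suc t) - snd ((q # z) ! t) - 1)) = raw_score K g x y (q # z)"
      by blast
    have "(\<Sum>t<length (p # q # z). K (x (fst ((p # q # z) ! t))) (y (snd ((p # q # z) ! t)))) =
        K (x (fst p)) (y (snd p)) +
        (\<Sum>t<length (q # z). K (x (fst ((q # z) ! t))) (y (snd ((q # z) ! t))))"
      by (simp add: sum.lessThan_Suc_shift del: sum.lessThan_Suc)
    moreover have "(\<Sum>t<length (p # q # z) - 1. g (fst ((p # q # z) ! Suc t) - fst ((p # q # z) ! t) - 1) +
            g (snd ((p # q # z) ! Suc t) - snd ((p # q # z) ! t) - 1)) =
        g (fst q - fst p - 1) + g (snd q - snd p - 1) +
        (\<Sum>t<length (q # z) - 1. g (fst ((q # z) ! Suc t) - fst ((q # z) ! t) - 1) +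
            g (snd ((q # z) ! Suc t) - snd ((q # z) ! t) - 1))"
      by (simp add: sum.lessThan_Suc_shift del: sum.lessThan_Suc)
    ultimately show ?case using IH by simp
  qed auto
  then show ?thesis
    using assms unfolding align_score_def fits_def by simp
qed

lemma raw_score_shift:
  "raw_score K g x y (shift a b z) = raw_score K g (\<lambda>i. x (a + i)) (\<lambda>j. y (b + j)) z"
  unfolding shift_def by (induction z rule: induct_list012) auto

lemma raw_score_append:
  assumes "z \<noteq> []" "w \<noteq> []"
  shows "raw_score K g x y (z @ w) = raw_score K g x y z + raw_score K g x y w
     - g (fst (hd w) - fst (last z) - 1) - g (snd (hd w) - snd (last z) - 1)"
  using assms
proof (induction z rule: induct_list012)
  case (2 p)
  then show ?case by (cases w) auto
qed auto

lemma raw_score_cong: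
  assumes "\<And>p. p \<in> set z \<Longrightarrow> x (fst p) = x' (fst p) \<and> y (snd p) = y' (snd p)"
  shows "raw_score K g x y z = raw_score K g x' y' z"
  using assms by (induction z rule: induct_list012) auto

lemma raw_score_swap:
  assumes "\<And>a b. K a b = K b a"
  shows "raw_score K g y x (map prod.swap z) = raw_score K g x y z"
  by (induction z rule: induct_list012) (auto intro: assms)

lemma alignment_Cons:
  "p # q # z \<in> alignments \<Longrightarrow>
    q # z \<in> alignments \<and> fst p < fst q \<and> snd p < snd q"
  unfolding alignments_def by auto

lemma alignment_le_last:
  assumes "z \<in> alignments" "p \<in> set z"
  shows "fst p \<le> fst (last z) \<and> snd p \<le> snd (last z)"
proof -
  obtain i where i: "i < length z" "z ! i = p" using assms(2) by (meson in_set_conv_nth)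
  have s: "sorted_wrt (\<lambda>p q. fst p < fst q \<and> snd p < snd q) z" "z \<noteq> []"
    using assms(1) unfolding alignments_def by auto
  show ?thesis
  proof (cases "i = length z - 1")
    case True
    then show ?thesis using i s by (simp add: last_conv_nth)
  next
    case False
    then have "i < length z - 1" using i by simp
    then show ?thesis using sorted_wrt_nth_less[OF s(1), of i "length z - 1"] i s
      by (simp add: last_conv_nth)
  qed
qed

lemma raw_score_cong_fits:
  assumes "z \<in> alignments" "fits m n z"
    "\<And>i. 1 \<le> i \<Longrightarrow> i \<le> m \<Longrightarrow> x i = x' i" "\<And>j. 1 \<le> j \<Longrightarrow> j \<le> n \<Longrightarrow> y j = y' j"
  shows "raw_score K g x y z = raw_score K g x' y' z"
proof (rule raw_score_cong)
  fix p assume p: "p \<in> set z"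
  have "1 \<le> fst p \<and> 1 \<le> snd p" using assms(1) p unfolding alignments_def by auto
  then show "x (fst p) = x' (fst p) \<and> y (snd p) = y' (snd p)"
    using alignment_le_last[OF assms(1) p] assms(2-4) unfolding fits_def by auto
qed

lemma alignment_ge_hd:
  assumes "z \<in> alignments" "p \<in> set z"
  shows "p = hd z \<or> fst (hd z) < fst p \<and> snd (hd z) < snd p"
  using assms unfolding alignments_def by (cases z) auto

lemma alignment_appendD:
  assumes "z @ w \<in> alignments"
  shows "z \<noteq> [] \<Longrightarrow> z \<in> alignments" "w \<noteq> [] \<Longrightarrow> w \<in> alignments"
  using assms unfolding alignments_def by (auto simp: sorted_wrt_append)

lemma alignment_shift:
  assumes "z \<in> alignments"
  shows "shift a b z \<in> alignments"
  using assms unfolding alignments_def shift_def by (auto simp: sorted_wrt_map)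

lemma last_shift: "z \<noteq> [] \<Longrightarrow> last (shift a b z) = (a + fst (last z), b + snd (last z))"
  unfolding shift_def by (simp add: last_map)

lemma hd_shift: "z \<noteq> [] \<Longrightarrow> hd (shift a b z) = (a + fst (hd z), b + snd (hd z))"
  unfolding shift_def by (simp add: hd_map)

lemma length_shift [simp]: "length (shift a b z) = length z"
  unfolding shift_def by simp

lemma shift_eq_Nil [simp]: "shift a b z = [] \<longleftrightarrow> z = []"
  unfolding shift_def by simp

lemma unshift_alignment:
  assumes "z \<in> alignments" "a < fst (hd z)" "b < snd (hd z)"
  obtains w where "w \<in> alignments" "z = shift a b w"
proof (rule that)
  let ?w = "map (\<lambda>p. (fst p - a, snd p - b)) z"
  have *: "a < fst p \<and> b < snd p" if "p \<in> set z" for p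
    using alignment_ge_hd[OF assms(1) that] assms(2,3) by auto
  have s: "sorted_wrt (\<lambda>p q. fst p < fst q \<and> snd p < snd q) z" "z \<noteq> []"
    using assms(1) unfolding alignments_def by auto
  have "sorted_wrt (\<lambda>p q. fst p - a < fst q - a \<and> snd p - b < snd q - b) z"
    by (rule sorted_wrt_mono_rel[OF _ s(1)]) (use * in \<open>auto intro!: diff_less_mono less_imp_le\<close>)
  then show "?w \<in> alignments"
    using s * unfolding alignments_def by (auto simp: sorted_wrt_map Suc_le_eq)
  show "z = shift a b ?w"
    unfolding shift_def map_map by (rule sym, rule map_idI) (use * in \<open>fastforce simp: prod_eq_iff\<close>)
qed

lemma alignment_length_bound:
  assumes "z \<in> alignments"
  shows "fst (hd z) + length z \<le> fst (last z) + 1 \<and> snd (hd z) + length z \<le> snd (last z) + 1"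
  using assms
proof (induction z rule: induct_list012)
  case (3 p q z)
  then show ?case using alignment_Cons[OF 3(3)] by auto
qed (auto simp: alignments_def)

lemma alignment_hd_ge_1: "z \<in> alignments \<Longrightarrow> 1 \<le> fst (hd z) \<and> 1 \<le> snd (hd z)"
  unfolding alignments_def by auto

lemma fits_length: "z \<in> alignments \<Longrightarrow> fits m n z \<Longrightarrow> length z \<le> m \<and> length z \<le> n"
  using alignment_length_bound[of z] alignment_hd_ge_1[of z] unfolding fits_def by auto

lemma finite_fitting: "finite {z \<in> alignments. fits m n z}"
proof (rule finite_subset)
  show "{z \<in> alignments. fits m n z} \<subseteq> {z. set z \<subseteq> {..m} \<times> {..n} \<and> length z \<le> m}"
  proof
    fix z assume "z \<in> {z \<in> alignments. fits m n z}"
    then have z: "z \<in> alignments" "fits m n z" by auto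
    have "p \<in> {..m} \<times> {..n}" if "p \<in> set z" for p
      using alignment_le_last[OF z(1) that] z(2) unfolding fits_def by (auto simp: mem_Times_iff)
    then show "z \<in> {z. set z \<subseteq> {..m} \<times> {..n} \<and> length z \<le> m}"
      using fits_length[OF z] by auto
  qed
  show "finite {z. set z \<subseteq> {..m} \<times> {..n} \<and> length z \<le> m}"
    by (rule finite_lists_length_le) auto
qed

lemma anchored_iff:
  "z \<in> anchored_alignments \<kappa> \<longleftrightarrow> z \<in> alignments \<and> hd z = (1, 1) \<and> length z = \<kappa>"
proof -
  have "(1, 1) \<in> set z \<longleftrightarrow> hd z = (1, 1)" if z: "z \<in> alignments"
  proof
    assume "(1, 1) \<in> set z"
    then show "hd z = (1, 1)"
      using alignment_ge_hd[OF z, of "(1, 1)"] alignment_hd_ge_1[OF z] by auto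
  next
    assume "hd z = (1, 1)"
    then show "(1, 1) \<in> set z" using z unfolding alignments_def by (metis (mono_tags) hd_in_set mem_Collect_eq)
  qed
  then show ?thesis unfolding anchored_alignments_def by auto
qed

section \<open>Anchored scores\<close>

text \<open>
  The penalty of the initial gap vanishes for anchored alignments, so only the final one is
  subtracted. Charging the final gap is what makes anchored scores additive under concatenation:
  the final gap of the left piece becomes the gap between the two pieces.
\<close>

definition end_score ::
  "('a \<Rightarrow> 'a \<Rightarrow> real) \<Rightarrow> (nat \<Rightarrow> real) \<Rightarrow> (nat \<Rightarrow> 'a) \<Rightarrow> (nat \<Rightarrow> 'a) \<Rightarrow> nat \<Rightarrow> nat \<Rightarrow> alignment \<Rightarrow> real" where
  "end_score K g x y m n z =
     raw_score K g x y z - g (m - fst (last z)) - g (n - snd (last z))"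

definition anchored_fits :: "nat \<Rightarrow> nat \<Rightarrow> nat \<Rightarrow> alignment set" where
  "anchored_fits \<kappa> m n = {z \<in> anchored_alignments \<kappa>. fits m n z}"

definition Gmax ::
  "('a \<Rightarrow> 'a \<Rightarrow> real) \<Rightarrow> (nat \<Rightarrow> real) \<Rightarrow> nat \<Rightarrow> (nat \<Rightarrow> 'a) \<Rightarrow> (nat \<Rightarrow> 'a) \<Rightarrow> nat \<Rightarrow> nat \<Rightarrow> real" where
  "Gmax K g \<kappa> x y m n = Max (end_score K g x y m n ` anchored_fits \<kappa> m n)"

lemma finite_anchored_fits: "finite (anchored_fits \<kappa> m n)"
  by (rule finite_subset[OF _ finite_fitting[of m n]])
     (auto simp: anchored_fits_def anchored_alignments_def)

lemma diagonal_anchored_fits: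
  assumes "1 \<le> \<kappa>" "\<kappa> \<le> m" "\<kappa> \<le> n"
  shows "map (\<lambda>i. (i, i)) [1..<Suc \<kappa>] \<in> anchored_fits \<kappa> m n"
proof -
  have "hd (map (\<lambda>i. (i, i)) [1..<Suc \<kappa>]) = (1, 1)"
    using assms by (simp add: hd_map hd_upt del: upt_Suc)
  moreover have "last (map (\<lambda>i. (i, i)) [1..<Suc \<kappa>]) = (\<kappa>, \<kappa>)"
    using assms by (simp add: last_map)
  moreover have "sorted_wrt (\<lambda>p q. fst p < fst q \<and> snd p < snd q) (map (\<lambda>i. (i, i)) [1..<Suc \<kappa>])"
    by (simp add: sorted_wrt_map del: upt_Suc)
  ultimately show ?thesis
    using assms unfolding anchored_fits_def anchored_iff fits_def alignments_def
    by (auto simp: sorted_wrt_map)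
qed

lemma anchored_fits_nonempty:
  "1 \<le> \<kappa> \<Longrightarrow> \<kappa> \<le> m \<Longrightarrow> \<kappa> \<le> n \<Longrightarrow> anchored_fits \<kappa> m n \<noteq> {}"
  using diagonal_anchored_fits by blast

lemma end_score_le_Gmax: "z \<in> anchored_fits \<kappa> m n \<Longrightarrow> end_score K g x y m n z \<le> Gmax K g \<kappa> x y m n"
  unfolding Gmax_def using finite_anchored_fits by (intro Max_ge) auto

lemma Gmax_attained:
  assumes "1 \<le> \<kappa>" "\<kappa> \<le> m" "\<kappa> \<le> n"
  obtains z where "z \<in> anchored_fits \<kappa> m n" "Gmax K g \<kappa> x y m n = end_score K g x y m n z"
proof -
  have "Gmax K g \<kappa> x y m n \<in> end_score K g x y m n ` anchored_fits \<kappa> m n"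
    unfolding Gmax_def using finite_anchored_fits anchored_fits_nonempty[OF assms]
    by (intro Max_in) auto
  then show ?thesis using that by blast
qed

lemma real_of_anchored_score:
  assumes "g 0 = 0" "1 \<le> \<kappa>" "\<kappa> \<le> m" "\<kappa> \<le> n"
  shows "real_of_ereal (anchored_score K g \<kappa> x y m n) = Gmax K g \<kappa> x y m n"
proof -
  have gs: "global_score K g z x y m n = ereal (end_score K g x y m n z)"
    if "z \<in> anchored_fits \<kappa> m n" for z
  proof -
    have z: "z \<in> alignments" "hd z = (1, 1)" "fits m n z"
      using that unfolding anchored_fits_def anchored_iff by auto
    moreover have "z \<noteq> []" using z(1) unfolding alignments_def by auto
    ultimately show ?thesis using assms(1) align_score_eq_raw_score[of z m n K g x y]
      unfolding global_score_def end_score_def fits_def by simp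
  qed
  have gi: "global_score K g z x y m n = - \<infinity>"
    if "z \<in> anchored_alignments \<kappa> - anchored_fits \<kappa> m n" for z
    using that unfolding anchored_fits_def global_score_def fits_def by auto
  have "anchored_score K g \<kappa> x y m n = ereal (Gmax K g \<kappa> x y m n)"
  proof (rule antisym)
    show "anchored_score K g \<kappa> x y m n \<le> ereal (Gmax K g \<kappa> x y m n)"
      unfolding anchored_score_def
    proof (rule SUP_least)
      fix z assume "z \<in> anchored_alignments \<kappa>"
      then show "global_score K g z x y m n \<le> ereal (Gmax K g \<kappa> x y m n)"
        using gs[of z] gi[of z] end_score_le_Gmax[of z \<kappa> m n K g x y] by (cases "z \<in> anchored_fits \<kappa> m n") auto
    qed
    obtain z where z: "z \<in> anchored_fits \<kappa> m n" "Gmax K g \<kappa> x y m n = end_score K g x y m n z"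
      using Gmax_attained[OF assms(2-4)] .
    show "ereal (Gmax K g \<kappa> x y m n) \<le> anchored_score K g \<kappa> x y m n"
      unfolding anchored_score_def z(2) gs[OF z(1), symmetric]
      using z(1) by (intro SUP_upper) (auto simp: anchored_fits_def)
  qed
  then show ?thesis by simp
qed

lemma Gmax_cong:
  assumes "\<And>i. 1 \<le> i \<Longrightarrow> i \<le> m \<Longrightarrow> x i = x' i" "\<And>j. 1 \<le> j \<Longrightarrow> j \<le> n \<Longrightarrow> y j = y' j"
  shows "Gmax K g \<kappa> x y m n = Gmax K g \<kappa> x' y' m n"
proof -
  have "end_score K g x y m n z = end_score K g x' y' m n z" if "z \<in> anchored_fits \<kappa> m n" for z
  proof -
    have z: "z \<in> alignments" "fits m n z" using that unfolding anchored_fits_def anchored_alignments_def by auto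
    have "raw_score K g x y z = raw_score K g x' y' z"
      by (rule raw_score_cong_fits[OF z assms])
    then show ?thesis unfolding end_score_def by simp
  qed
  then show ?thesis unfolding Gmax_def by (metis (no_types, lifting) image_cong)
qed

lemma Gmax_swap_le:
  assumes "\<And>a b. K a b = K b a" "1 \<le> \<kappa>" "\<kappa> \<le> m" "\<kappa> \<le> n"
  shows "Gmax K g \<kappa> x y m n \<le> Gmax K g \<kappa> y x n m"
proof -
  obtain z where z: "z \<in> anchored_fits \<kappa> m n" "Gmax K g \<kappa> x y m n = end_score K g x y m n z"
    using Gmax_attained[OF assms(2-4)] .
  have za: "z \<in> alignments" "z \<noteq> []" "hd z = (1, 1)" using z(1) unfolding anchored_fits_def anchored_iff alignments_def by auto
  have "map prod.swap z \<in> anchored_fits \<kappa> n m"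
    using z(1) za unfolding anchored_fits_def anchored_iff alignments_def fits_def
    by (auto simp: sorted_wrt_map hd_map last_map conj_commute)
  moreover have "end_score K g y x n m (map prod.swap z) = end_score K g x y m n z"
    using za raw_score_swap[OF assms(1), where g = g and x = x and y = y and z = z] unfolding end_score_def by (simp add: last_map)
  ultimately show ?thesis using end_score_le_Gmax z(2) by metis
qed

lemma Gmax_swap:
  assumes "\<And>a b. K a b = K b a" "1 \<le> \<kappa>" "\<kappa> \<le> m" "\<kappa> \<le> n"
  shows "Gmax K g \<kappa> x y m n = Gmax K g \<kappa> y x n m"
  using Gmax_swap_le[of K \<kappa> m n g x y] Gmax_swap_le[of K \<kappa> n m g y x] assms by (intro antisym) auto

lemma end_score_append:
  assumes "z \<noteq> []" "w \<noteq> []" "hd w = (1, 1)" "fits m1 n1 z"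
  shows "end_score K g x y (m1 + m2) (n1 + n2) (z @ shift m1 n1 w) =
     end_score K g x y m1 n1 z + end_score K g (\<lambda>i. x (m1 + i)) (\<lambda>j. y (n1 + j)) m2 n2 w"
  using assms
  by (simp add: end_score_def raw_score_append raw_score_shift hd_shift last_shift fits_def)

lemma Gmax_superadditive:
  assumes "1 \<le> k1" "k1 \<le> m1" "k1 \<le> n1" "1 \<le> k2" "k2 \<le> m2" "k2 \<le> n2"
  shows "Gmax K g k1 x y m1 n1 + Gmax K g k2 (\<lambda>i. x (m1 + i)) (\<lambda>j. y (n1 + j)) m2 n2
    \<le> Gmax K g (k1 + k2) x y (m1 + m2) (n1 + n2)"
proof -
  obtain z where z: "z \<in> anchored_fits k1 m1 n1" "Gmax K g k1 x y m1 n1 = end_score K g x y m1 n1 z"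
    using Gmax_attained[OF assms(1-3)] .
  obtain w where w: "w \<in> anchored_fits k2 m2 n2"
    "Gmax K g k2 (\<lambda>i. x (m1 + i)) (\<lambda>j. y (n1 + j)) m2 n2 =
      end_score K g (\<lambda>i. x (m1 + i)) (\<lambda>j. y (n1 + j)) m2 n2 w"
    using Gmax_attained[OF assms(4-6)] .
  have za: "z \<in> alignments" "hd z = (1, 1)" "z \<noteq> []" "length z = k1" "fits m1 n1 z"
    using z(1) unfolding anchored_fits_def anchored_iff alignments_def by auto
  have wa: "w \<in> alignments" "hd w = (1, 1)" "w \<noteq> []" "length w = k2" "fits m2 n2 w"
    using w(1) unfolding anchored_fits_def anchored_iff alignments_def by auto
  have "sorted_wrt (\<lambda>p q. fst p < fst q \<and> snd p < snd q) (z @ shift m1 n1 w)"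
  proof -
    have "fst p < fst q \<and> snd p < snd q" if p: "p \<in> set z" and q: "q \<in> set (shift m1 n1 w)" for p q
    proof -
      obtain q' where q': "q' \<in> set w" "q = (m1 + fst q', n1 + snd q')"
        using q unfolding shift_def by auto
      have "1 \<le> fst q' \<and> 1 \<le> snd q'" using q'(1) wa(1) unfolding alignments_def by auto
      then show ?thesis
        using q'(2) alignment_le_last[OF za(1) p] za(5) unfolding fits_def by auto
    qed
    then show ?thesis using za(1) alignment_shift[OF wa(1), of m1 n1]
      unfolding alignments_def by (auto simp: sorted_wrt_append)
  qed
  then have "z @ shift m1 n1 w \<in> alignments"
    using za(1) alignment_shift[OF wa(1), of m1 n1] unfolding alignments_def by auto
  then have "z @ shift m1 n1 w \<in> anchored_fits (k1 + k2) (m1 + m2) (n1 + n2)"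
    using za wa unfolding anchored_fits_def anchored_iff fits_def by (auto simp: last_shift)
  from end_score_le_Gmax[OF this, of K g x y] show ?thesis
    using end_score_append[OF za(3) wa(3) wa(2) za(5)] z(2) w(2) by metis
qed

text \<open>
  Conversely an optimal anchored alignment can be cut after its \<open>k1\<close>-th match, just before the
  next matched letters.
\<close>

lemma Gmax_split:
  assumes "1 \<le> k1" "1 \<le> k2" "k1 + k2 \<le> m" "k1 + k2 \<le> n"
  obtains m1 n1 where "k1 \<le> m1" "m1 + k2 \<le> m" "k1 \<le> n1" "n1 + k2 \<le> n"
    "Gmax K g (k1 + k2) x y m n \<le>
       Gmax K g k1 x y m1 n1 + Gmax K g k2 (\<lambda>i. x (m1 + i)) (\<lambda>j. y (n1 + j)) (m - m1) (n - n1)"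
proof -
  obtain z where z: "z \<in> anchored_fits (k1 + k2) m n"
    "Gmax K g (k1 + k2) x y m n = end_score K g x y m n z"
    by (rule Gmax_attained[of "k1 + k2" m n K g x y]) (use assms in auto)
  have za: "z \<in> alignments" "hd z = (1, 1)" "length z = k1 + k2" "fits m n z"
    using z(1) unfolding anchored_fits_def anchored_iff by auto
  define u where "u = take k1 z"
  define v where "v = drop k1 z"
  have zuv: "z = u @ v" unfolding u_def v_def by simp
  have ne: "u \<noteq> []" "v \<noteq> []" and lu: "length u = k1" "length v = k2"
    using za(3) assms unfolding u_def v_def by auto
  have ua: "u \<in> alignments" and va: "v \<in> alignments"
    using alignment_appendD[of u v] za(1) ne zuv by auto
  define m1 where "m1 = fst (hd v) - 1"
  define n1 where "n1 = snd (hd v) - 1"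
  have hv: "fst (hd v) = m1 + 1" "snd (hd v) = n1 + 1"
    using alignment_hd_ge_1[OF va] unfolding m1_def n1_def by auto
  obtain w where w: "w \<in> alignments" "v = shift m1 n1 w"
    using unshift_alignment[OF va, of m1 n1] hv by auto
  have wne: "w \<noteq> []" using ne(2) w(2) by auto
  have hw: "hd w = (1, 1)" using hd_shift[OF wne, of m1 n1] w(2) hv by (auto simp: prod_eq_iff)
  have fl: "fst (last u) < fst (hd v) \<and> snd (last u) < snd (hd v)"
    using za(1) ne unfolding zuv alignments_def by (auto simp: sorted_wrt_append)
  then have uf: "fits m1 n1 u" using hv unfolding fits_def by auto
  have hu: "hd u = (1, 1)" using za(2) ne zuv by simp
  have lv: "fst (last v) = m1 + fst (last w)" "snd (last v) = n1 + snd (last w)"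
    using last_shift[OF wne, of m1 n1] w(2) by auto
  have vf: "m1 + fst (last w) \<le> m" "n1 + snd (last w) \<le> n"
    using za(4) lv ne unfolding fits_def zuv by auto
  have le1: "k1 \<le> m1" "k1 \<le> n1" using fits_length[OF ua uf] lu by auto
  have wf: "fits (m - m1) (n - n1) w" using vf unfolding fits_def by auto
  have lw: "length w = k2" using w(2) lu by auto
  have le2: "m1 + k2 \<le> m" "n1 + k2 \<le> n"
    using fits_length[OF w(1) wf] lw vf assms by auto
  have "end_score K g x y (m1 + (m - m1)) (n1 + (n - n1)) (u @ shift m1 n1 w) =
     end_score K g x y m1 n1 u + end_score K g (\<lambda>i. x (m1 + i)) (\<lambda>j. y (n1 + j)) (m - m1) (n - n1) w"
    by (rule end_score_append[OF ne(1) wne hw uf])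
  then have "Gmax K g (k1 + k2) x y m n =
     end_score K g x y m1 n1 u + end_score K g (\<lambda>i. x (m1 + i)) (\<lambda>j. y (n1 + j)) (m - m1) (n - n1) w"
    using z(2) zuv w(2) vf by simp
  also have "\<dots> \<le> Gmax K g k1 x y m1 n1 + Gmax K g k2 (\<lambda>i. x (m1 + i)) (\<lambda>j. y (n1 + j)) (m - m1) (n - n1)"
    using ua hu lu uf w(1) hw lw wf
    by (intro add_mono end_score_le_Gmax) (auto simp: anchored_fits_def anchored_iff)
  finally show ?thesis using that le1 le2 by blast
qed

text \<open>
  Moving the first match of a local alignment to \<open>(1, 1)\<close> and ending both words at the last match
  leaves an anchored alignment without end gaps, so that a union bound over positions reduces local
  to anchored scores.
\<close>

lemma raw_score_le_shifted_Gmax: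
  assumes "g 0 = 0" "z \<in> alignments" "fits M N z"
  obtains a b m n where "a + m \<le> M" "b + n \<le> N" "length z \<le> m" "length z \<le> n"
    "raw_score K g x y z \<le> Gmax K g (length z) (\<lambda>i. x (a + i)) (\<lambda>j. y (b + j)) m n"
proof -
  define a where "a = fst (hd z) - 1"
  define b where "b = snd (hd z) - 1"
  have hz: "fst (hd z) = a + 1" "snd (hd z) = b + 1"
    using alignment_hd_ge_1[OF assms(2)] unfolding a_def b_def by auto
  obtain w where w: "w \<in> alignments" "z = shift a b w"
    using unshift_alignment[OF assms(2), of a b] hz by auto
  have wne: "w \<noteq> []" using w(1) by (auto simp: alignments_def)
  have hw: "hd w = (1, 1)" using hd_shift[OF wne, of a b] w(2) hz by (auto simp: prod_eq_iff)
  define m where "m = fst (last w)"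
  define n where "n = snd (last w)"
  have lz: "a + m \<le> M" "b + n \<le> N"
    using assms(3) last_shift[OF wne, of a b] w(2) unfolding fits_def m_def n_def by auto
  have wf: "fits m n w" unfolding fits_def m_def n_def by simp
  have lw: "length w = length z" using w(2) by simp
  have "raw_score K g x y z = end_score K g (\<lambda>i. x (a + i)) (\<lambda>j. y (b + j)) m n w"
    unfolding w(2) raw_score_shift end_score_def m_def n_def using assms(1) by simp
  also have "\<dots> \<le> Gmax K g (length z) (\<lambda>i. x (a + i)) (\<lambda>j. y (b + j)) m n"
    using w(1) hw wf lw by (intro end_score_le_Gmax) (auto simp: anchored_fits_def anchored_iff)
  finally show ?thesis using that[OF lz] fits_length[OF w(1) wf] lw by auto
qed

section \<open>Gap penalties\<close>

text \<open>
  A concave penalty with \<open>g 0 = 0\<close> is subadditive, so several gaps cost at least as much as a single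
  gap of the same total length. This bounds the score by the number of matches and the total number
  of unmatched letters.
\<close>

lemma admissible_increment_antimono:
  assumes "admissible_gap_penalty g" "i \<le> j"
  shows "g (Suc j) - g j \<le> g (Suc i) - g i"
  using assms(2)
proof (induction j rule: dec_induct)
  case (step j)
  have "g (Suc j + 1) - g (Suc j) \<le> g (Suc j) - g (Suc j - 1)"
    using assms(1) unfolding admissible_gap_penalty_def by (metis le_add1 plus_1_eq_Suc)
  then show ?case using step by simp
qed simp

lemma admissible_subadditive:
  assumes "admissible_gap_penalty g"
  shows "g (a + b) \<le> g a + g b"
proof (induction b)
  case 0
  then show ?case using assms unfolding admissible_gap_penalty_def by simp
next
  case (Suc b)
  then show ?case using admissible_increment_antimono[OF assms, of b "a + b"] by simp
qed

lemma raw_score_upper: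
  fixes g :: "nat \<Rightarrow> real" and B :: real
  assumes "admissible_gap_penalty g" "\<And>a b. K a b \<le> B" "z \<in> alignments"
  shows "raw_score K g x y z \<le> length z * B - g (fst (last z) + 1 - fst (hd z) - length z)
     - g (snd (last z) + 1 - snd (hd z) - length z)"
  using assms(3)
proof (induction z rule: induct_list012)
  case (2 p)
  then show ?case using assms(1,2) unfolding admissible_gap_penalty_def by simp
next
  case (3 p q z)
  have q: "q # z \<in> alignments" "fst p < fst q" "snd p < snd q" using alignment_Cons[OF 3(3)] by auto
  note IH = 3(2)[OF q(1)]
  note lb = alignment_length_bound[OF q(1)]
  have s1: "g (fst (last (q # z)) + 1 - fst p - Suc (length (q # z))) \<le>
      g (fst (last (q # z)) + 1 - fst q - length (q # z)) + g (fst q - fst p - 1)"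
    using admissible_subadditive[OF assms(1), of "fst (last (q # z)) + 1 - fst q - length (q # z)" "fst q - fst p - 1"]
      lb q(2) by (simp add: algebra_simps del: last.simps)
  have s2: "g (snd (last (q # z)) + 1 - snd p - Suc (length (q # z))) \<le>
      g (snd (last (q # z)) + 1 - snd q - length (q # z)) + g (snd q - snd p - 1)"
    using admissible_subadditive[OF assms(1), of "snd (last (q # z)) + 1 - snd q - length (q # z)" "snd q - snd p - 1"]
      lb q(3) by (simp add: algebra_simps del: last.simps)
  have "raw_score K g x y (p # q # z) = K (x (fst p)) (y (snd p)) - g (fst q - fst p - 1) - g (snd q - snd p - 1)
     + raw_score K g x y (q # z)" by simp
  also have "\<dots> \<le> B - g (fst q - fst p - 1) - g (snd q - snd p - 1) + (length (q # z) * B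
     - g (fst (last (q # z)) + 1 - fst (hd (q # z)) - length (q # z))
     - g (snd (last (q # z)) + 1 - snd (hd (q # z)) - length (q # z)))"
    using IH assms(2)[of "x (fst p)" "y (snd p)"] by linarith
  also have "\<dots> \<le> B + length (q # z) * B - g (fst (last (q # z)) + 1 - fst p - Suc (length (q # z)))
     - g (snd (last (q # z)) + 1 - snd p - Suc (length (q # z)))"
    using s1 s2 unfolding list.sel(1) by linarith
  finally show ?case by (simp add: algebra_simps)
qed (auto simp: alignments_def)

lemma Gmax_upper:
  fixes g :: "nat \<Rightarrow> real" and B :: real
  assumes "admissible_gap_penalty g" "\<And>a b. K a b \<le> B" "1 \<le> \<kappa>" "\<kappa> \<le> m" "\<kappa> \<le> n"
  shows "Gmax K g \<kappa> x y m n \<le> \<kappa> * B - g (m - \<kappa>) - g (n - \<kappa>)"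
proof -
  obtain z where z: "z \<in> anchored_fits \<kappa> m n" "Gmax K g \<kappa> x y m n = end_score K g x y m n z"
    using Gmax_attained[OF assms(3-5)] .
  have za: "z \<in> alignments" "hd z = (1, 1)" "length z = \<kappa>" "fits m n z"
    using z(1) unfolding anchored_fits_def anchored_iff by auto
  have le: "\<kappa> \<le> fst (last z)" "\<kappa> \<le> snd (last z)" "fst (last z) \<le> m" "snd (last z) \<le> n"
    using alignment_length_bound[OF za(1)] za unfolding fits_def by auto
  have "g (m - \<kappa>) \<le> g (fst (last z) - \<kappa>) + g (m - fst (last z))"
    "g (n - \<kappa>) \<le> g (snd (last z) - \<kappa>) + g (n - snd (last z))"
    using admissible_subadditive[OF assms(1), of "fst (last z) - \<kappa>" "m - fst (last z)"]
      admissible_subadditive[OF assms(1), of "snd (last z) - \<kappa>" "n - snd (last z)"] le by auto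
  then show ?thesis
    using raw_score_upper[OF assms(1) _ za(1), of K B x y] assms(2) za(2,3) z(2) unfolding end_score_def by simp
qed

section \<open>Random words\<close>

abbreviation expect :: "'b pmf \<Rightarrow> ('b \<Rightarrow> real) \<Rightarrow> real" where
  "expect p f \<equiv> measure_pmf.expectation p f"

lemma finite_set_replicate_pmf: "finite (set_pmf p) \<Longrightarrow> finite (set_pmf (replicate_pmf n p))"
  unfolding set_replicate_pmf using finite_lists_length_eq[of "set_pmf p" n]
  by (auto simp: lists_eq_set)

lemma expect_pair:
  fixes p :: "'b pmf" and q :: "'c pmf"
  assumes "finite (set_pmf p)" "finite (set_pmf q)"
  shows "expect (pair_pmf p q) f = expect p (\<lambda>a. expect q (\<lambda>b. f (a, b)))"
proof -
  have "expect (pair_pmf p q) f =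
      (\<Sum>a\<in>set_pmf p. pmf p a *\<^sub>R expect (bind_pmf q (\<lambda>b. return_pmf (a, b))) f)"
    unfolding pair_pmf_def by (rule pmf_expectation_bind) (use assms in auto)
  also have "\<dots> = (\<Sum>a\<in>set_pmf p. pmf p a *\<^sub>R expect q (\<lambda>b. f (a, b)))"
  proof (rule sum.cong[OF refl])
    fix a :: 'b
    have "bind_pmf q (\<lambda>b. return_pmf (a, b)) = map_pmf (Pair a) q" by (simp add: map_pmf_def)
    then show "pmf p a *\<^sub>R expect (bind_pmf q (\<lambda>b. return_pmf (a, b))) f = pmf p a *\<^sub>R expect q (\<lambda>b. f (a, b))"
      by simp
  qed
  also have "\<dots> = expect p (\<lambda>a. expect q (\<lambda>b. f (a, b)))"
    by (rule integral_measure_pmf[symmetric]) (use assms in auto)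
  finally show ?thesis .
qed

lemma expect_mono:
  assumes "finite (set_pmf p)" "\<And>x. x \<in> set_pmf p \<Longrightarrow> f x \<le> h x"
  shows "expect p f \<le> expect p h"
  by (rule integral_mono_AE) (use assms in \<open>auto intro: integrable_measure_pmf_finite simp: AE_measure_pmf_iff\<close>)

lemma expect_cong:
  assumes "\<And>x. x \<in> set_pmf p \<Longrightarrow> f x = h x"
  shows "expect p f = expect p h"
  by (rule integral_cong_AE) (use assms in \<open>auto simp: AE_measure_pmf_iff\<close>)

lemma expect_pos:
  assumes "finite (set_pmf p)" "\<And>x. x \<in> set_pmf p \<Longrightarrow> 0 < F x"
  shows "0 < expect p F"
proof -
  obtain z where z: "z \<in> set_pmf p" by (meson set_pmf_not_empty ex_in_conv)
  have "expect p F = (\<Sum>x\<in>set_pmf p. pmf p x *\<^sub>R F x)"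
    by (rule integral_measure_pmf) (use assms in auto)
  also have "\<dots> > 0"
    by (rule sum_pos2[OF assms(1) z]) (use z assms in \<open>auto simp: pmf_positive_iff less_imp_le\<close>)
  finally show ?thesis .
qed

lemma expect_add:
  assumes "finite (set_pmf p)"
  shows "expect p (\<lambda>x. f x + h x) = expect p f + expect p h"
  by (rule Bochner_Integration.integral_add) (auto intro: integrable_measure_pmf_finite assms)

lemma expect_sum:
  assumes "finite (set_pmf p)"
  shows "expect p (\<lambda>x. \<Sum>i\<in>I. f i x) = (\<Sum>i\<in>I. expect p (f i))"
  by (rule Bochner_Integration.integral_sum) (auto intro: integrable_measure_pmf_finite assms)

lemma replicate_pmf_append:
  "replicate_pmf (m + n) p =
     map_pmf (\<lambda>(xs, ys). xs @ ys) (pair_pmf (replicate_pmf m p) (replicate_pmf n p))"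
  unfolding replicate_pmf_distrib pair_pmf_def map_pmf_def
  by (simp add: bind_assoc_pmf bind_return_pmf)

lemma length_replicate_pmf: "xs \<in> set_pmf (replicate_pmf n p) \<Longrightarrow> length xs = n"
  by (simp add: set_replicate_pmf)

lemma map_take_replicate_pmf:
  "map_pmf (take m) (replicate_pmf (m + n) p) = replicate_pmf m p"
proof -
  have "map_pmf (take m) (replicate_pmf (m + n) p) =
      map_pmf fst (pair_pmf (replicate_pmf m p) (replicate_pmf n p))"
    unfolding replicate_pmf_append map_pmf_comp
    by (rule map_pmf_cong[OF refl]) (auto simp: length_replicate_pmf)
  then show ?thesis by (simp add: map_fst_pair_pmf)
qed

lemma map_drop_replicate_pmf:
  "map_pmf (drop m) (replicate_pmf (m + n) p) = replicate_pmf n p"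
proof -
  have "map_pmf (drop m) (replicate_pmf (m + n) p) =
      map_pmf snd (pair_pmf (replicate_pmf m p) (replicate_pmf n p))"
    unfolding replicate_pmf_append map_pmf_comp
    by (rule map_pmf_cong[OF refl]) (auto simp: length_replicate_pmf)
  then show ?thesis by (simp add: map_snd_pair_pmf)
qed

lemma map_segment_replicate_pmf:
  assumes "i + m \<le> n"
  shows "map_pmf (\<lambda>xs. take m (drop i xs)) (replicate_pmf n p) = replicate_pmf m p"
proof -
  obtain r where r: "n = i + (m + r)" using assms by (metis add.assoc le_Suc_ex)
  have "map_pmf (\<lambda>xs. take m (drop i xs)) (replicate_pmf n p) =
      map_pmf (take m) (map_pmf (drop i) (replicate_pmf (i + (m + r)) p))"
    unfolding r map_pmf_comp ..
  then show ?thesis unfolding map_drop_replicate_pmf map_take_replicate_pmf .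
qed

lemma expect_pair_split:
  assumes "finite (set_pmf p)"
  shows "expect (pair_pmf (replicate_pmf (m1 + m2) p) (replicate_pmf (n1 + n2) p))
      (\<lambda>(xs, ys). f (take m1 xs) (take n1 ys) * h (drop m1 xs) (drop n1 ys)) =
    expect (pair_pmf (replicate_pmf m1 p) (replicate_pmf n1 p)) (\<lambda>(xs, ys). f xs ys) *
    expect (pair_pmf (replicate_pmf m2 p) (replicate_pmf n2 p)) (\<lambda>(xs, ys). h xs ys)"
proof -
  note fin = finite_set_replicate_pmf[OF assms]
  have *: "expect (replicate_pmf (m + n) p) F =
      expect (replicate_pmf m p) (\<lambda>a. expect (replicate_pmf n p) (\<lambda>b. F (a @ b)))" for m n F
    unfolding replicate_pmf_append integral_map_pmf by (subst expect_pair[OF fin fin]) simp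
  have "expect (pair_pmf (replicate_pmf (m1 + m2) p) (replicate_pmf (n1 + n2) p))
      (\<lambda>(xs, ys). f (take m1 xs) (take n1 ys) * h (drop m1 xs) (drop n1 ys)) =
    expect (replicate_pmf m1 p) (\<lambda>a. expect (replicate_pmf m2 p) (\<lambda>b.
      expect (replicate_pmf n1 p) (\<lambda>c. expect (replicate_pmf n2 p) (\<lambda>d.
         f (take m1 (a @ b)) (take n1 (c @ d)) * h (drop m1 (a @ b)) (drop n1 (c @ d))))))"
    unfolding expect_pair[OF fin fin] * by simp
  also have "\<dots> = expect (replicate_pmf m1 p) (\<lambda>a. expect (replicate_pmf m2 p) (\<lambda>b.
      expect (replicate_pmf n1 p) (\<lambda>c. expect (replicate_pmf n2 p) (\<lambda>d. f a c * h b d))))"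
    by (intro expect_cong) (simp add: length_replicate_pmf)
  also have "\<dots> = expect (replicate_pmf m1 p) (\<lambda>a. expect (replicate_pmf n1 p) (\<lambda>c. f a c)) *
      expect (replicate_pmf m2 p) (\<lambda>b. expect (replicate_pmf n2 p) (\<lambda>d. h b d))"
    by simp
  finally show ?thesis unfolding expect_pair[OF fin fin] by simp
qed

section \<open>The generating function of the anchored scores\<close>

text \<open>
  Positions in words count from \<open>1\<close>, as in alignments, whereas lists are indexed from \<open>0\<close>.
\<close>

definition letter :: "'a list \<Rightarrow> nat \<Rightarrow> 'a" where
  "letter xs i = xs ! (i - 1)"

lemma letter_take: "1 \<le> i \<Longrightarrow> i \<le> m \<Longrightarrow> letter (take m xs) i = letter xs i"
  unfolding letter_def by (rule nth_take) auto

lemma letter_drop: "1 \<le> i \<Longrightarrow> m \<le> length xs \<Longrightarrow> letter (drop m xs) i = letter xs (m + i)"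
  unfolding letter_def by simp

locale scoring_model =
  fixes \<mu> :: "'a::finite pmf" and K :: "'a \<Rightarrow> 'a \<Rightarrow> real" and g :: "nat \<Rightarrow> real"
  assumes K_sym: "K a b = K b a"
    and g_admissible: "admissible_gap_penalty g"
    and g_superlog: "filterlim (\<lambda>k. g k / ln (real k)) at_top sequentially"
begin

definition Kmax :: real where "Kmax = Max (range (\<lambda>(a, b). K a b))"

lemma K_le_Kmax: "K a b \<le> Kmax"
proof -
  have "finite (range (\<lambda>(a, b). K a b))" by (rule finite_imageI) simp
  then show ?thesis unfolding Kmax_def by (intro Max_ge) (auto intro!: image_eqI[of _ _ "(a, b)"])
qed

lemma g_0: "g 0 = 0" and g_nonneg: "0 \<le> g k"
  using g_admissible unfolding admissible_gap_penalty_def by auto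

text \<open>
  The following quantities depend only on the law of the letters: \<open>words m n\<close> is the joint law of
  \<open>x\<^sub>1 \<dots> x\<^sub>m\<close> and \<open>y\<^sub>1 \<dots> y\<^sub>n\<close>, and \<open>hk\<close> and \<open>Psi\<close> are \<open>h_kappa\<close> and \<open>psi\<close> expressed through it.
\<close>

definition words :: "nat \<Rightarrow> nat \<Rightarrow> ('a list \<times> 'a list) pmf" where
  "words m n = pair_pmf (replicate_pmf m \<mu>) (replicate_pmf n \<mu>)"

definition Gwords :: "nat \<Rightarrow> 'a list \<Rightarrow> 'a list \<Rightarrow> real" where
  "Gwords \<kappa> xs ys = Gmax K g \<kappa> (letter xs) (letter ys) (length xs) (length ys)"

definition mgf :: "nat \<Rightarrow> nat \<Rightarrow> nat \<Rightarrow> real \<Rightarrow> real" where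
  "mgf \<kappa> m n t = expect (words m n) (\<lambda>(xs, ys). exp (t * Gwords \<kappa> xs ys))"

definition hk :: "nat \<Rightarrow> real \<Rightarrow> real" where
  "hk \<kappa> t = (\<Sum>\<^sub>\<infinity>(m, n)\<in>{\<kappa>..} \<times> {\<kappa>..}. mgf \<kappa> m n t)"

definition Psi :: "real \<Rightarrow> real" where
  "Psi t = lim (\<lambda>\<kappa>. ln (hk \<kappa> t) / real \<kappa>)"

lemma finite_words [simp]: "finite (set_pmf (words m n))"
  unfolding words_def by (simp add: finite_set_replicate_pmf)

lemma length_words: "(xs, ys) \<in> set_pmf (words m n) \<Longrightarrow> length xs = m \<and> length ys = n"
  unfolding words_def by (auto simp: length_replicate_pmf)

lemma mgf_pos: "0 < mgf \<kappa> m n t"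
  unfolding mgf_def by (rule expect_pos) auto

lemma mgf_nonneg: "0 \<le> mgf \<kappa> m n t"
  using mgf_pos less_imp_le by blast

lemma Gwords_upper:
  assumes "1 \<le> \<kappa>" "\<kappa> \<le> length xs" "\<kappa> \<le> length ys"
  shows "Gwords \<kappa> xs ys \<le> \<kappa> * Kmax - g (length xs - \<kappa>) - g (length ys - \<kappa>)"
  unfolding Gwords_def using Gmax_upper[OF g_admissible _ assms, of K Kmax] K_le_Kmax by blast

lemma mgf_upper:
  assumes "0 \<le> t" "1 \<le> \<kappa>" "\<kappa> \<le> m" "\<kappa> \<le> n"
  shows "mgf \<kappa> m n t \<le> exp (t * \<kappa> * Kmax) * exp (- t * g (m - \<kappa>)) * exp (- t * g (n - \<kappa>))"
proof -
  have "mgf \<kappa> m n t \<le> expect (words m n) (\<lambda>_. exp (t * \<kappa> * Kmax) * exp (- t * g (m - \<kappa>)) * exp (- t * g (n - \<kappa>)))"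
    unfolding mgf_def
  proof (rule expect_mono, simp, safe)
    fix xs ys assume "(xs, ys) \<in> set_pmf (words m n)"
    then have l: "length xs = m" "length ys = n" using length_words by auto
    then have "t * Gwords \<kappa> xs ys \<le> t * (\<kappa> * Kmax - g (m - \<kappa>) - g (n - \<kappa>))"
      using Gwords_upper[of \<kappa> xs ys] assms by (intro mult_left_mono) auto
    then show "exp (t * Gwords \<kappa> xs ys) \<le> exp (t * \<kappa> * Kmax) * exp (- t * g (m - \<kappa>)) * exp (- t * g (n - \<kappa>))"
      unfolding exp_add[symmetric] by (simp add: algebra_simps)
  qed
  then show ?thesis by simp
qed

text \<open>
  Growth faster than any multiple of the logarithm gives \<open>exp (- t g(j)) \<le> j\<^sup>-\<^sup>2\<close> for large \<open>j\<close>.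
\<close>

lemma penalty_summable:
  assumes "0 < t"
  shows "summable (\<lambda>j. exp (- t * g j))"
proof (rule summable_comparison_test_ev)
  have "\<forall>\<^sub>F j in sequentially. 2 / t \<le> g j / ln (real j)"
    using g_superlog unfolding filterlim_at_top by blast
  then show "\<forall>\<^sub>F j in sequentially. norm (exp (- t * g j)) \<le> inverse (real j ^ 2)"
    using eventually_gt_at_top[of 1]
  proof eventually_elim
    case (elim j)
    have ln: "0 < ln (real j)" using elim(2) by simp
    then have "2 * ln (real j) \<le> t * g j" using elim(1) assms by (simp add: field_simps)
    then have "exp (- t * g j) \<le> exp (- (2 * ln (real j)))" by simp
    also have "\<dots> = inverse (real j ^ 2)"
      using elim(2) by (simp add: exp_minus exp_double)
    finally show ?case by simp
  qed
  show "summable (\<lambda>j. inverse (real j ^ 2))"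
    by (rule inverse_power_summable) simp
qed

definition penalty_sum :: "real \<Rightarrow> real" where
  "penalty_sum t = (\<Sum>j. exp (- t * g j))"

lemma penalty_sum_ge_1:
  assumes "0 < t"
  shows "1 \<le> penalty_sum t"
proof -
  have "(\<Sum>j<Suc 0. exp (- t * g j)) \<le> penalty_sum t"
    unfolding penalty_sum_def by (rule sum_le_suminf[OF penalty_summable[OF assms]]) auto
  then show ?thesis by (simp add: g_0)
qed

lemma penalty_product_sum_le:
  assumes "0 < t" "finite F" "F \<subseteq> {\<kappa>..} \<times> {\<kappa>..}"
  shows "(\<Sum>(m, n)\<in>F. exp (- t * g (m - \<kappa>)) * exp (- t * g (n - \<kappa>))) \<le> penalty_sum t ^ 2"
proof -
  define h where "h j = exp (- t * g j)" for j
  have inj: "inj_on (\<lambda>(m, n). (m - \<kappa>, n - \<kappa>)) F"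
  proof (rule inj_onI)
    fix p q assume "p \<in> F" "q \<in> F" and eq: "(\<lambda>(m, n). (m - \<kappa>, n - \<kappa>)) p = (\<lambda>(m, n). (m - \<kappa>, n - \<kappa>)) q"
    then have "p \<in> {\<kappa>..} \<times> {\<kappa>..}" "q \<in> {\<kappa>..} \<times> {\<kappa>..}" using assms(3) by auto
    then show "p = q" using eq by (auto simp: prod_eq_iff case_prod_unfold)
  qed
  obtain N where N: "(\<lambda>(m, n). (m - \<kappa>, n - \<kappa>)) ` F \<subseteq> {..<N} \<times> {..<N}"
  proof -
    define A where "A = (\<lambda>(m, n). (m - \<kappa>, n - \<kappa>)) ` F"
    have fA: "finite (fst ` A \<union> snd ` A)" using assms(2) unfolding A_def by simp
    obtain N where "\<forall>k\<in>fst ` A \<union> snd ` A. k < N"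
      using finite_nat_set_iff_bounded fA by blast
    then have "A \<subseteq> {..<N} \<times> {..<N}" by force
    then show ?thesis using that unfolding A_def by blast
  qed
  have "(\<Sum>(m, n)\<in>F. h (m - \<kappa>) * h (n - \<kappa>)) = (\<Sum>(a, b)\<in>(\<lambda>(m, n). (m - \<kappa>, n - \<kappa>)) ` F. h a * h b)"
    by (subst sum.reindex[OF inj]) (simp add: case_prod_unfold)
  also have "\<dots> \<le> (\<Sum>(a, b)\<in>{..<N} \<times> {..<N}. h a * h b)"
    by (rule sum_mono2[OF _ N]) (auto simp: h_def)
  also have "\<dots> = (\<Sum>a<N. h a) * (\<Sum>b<N. h b)"
    by (simp add: sum_product sum.cartesian_product)
  also have "\<dots> \<le> penalty_sum t * penalty_sum t"
    unfolding penalty_sum_def h_def using penalty_summable[OF assms(1)]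
    by (intro mult_mono sum_le_suminf sum_nonneg suminf_nonneg) auto
  finally show ?thesis unfolding h_def power2_eq_square .
qed

lemma mgf_finite_sum_le:
  assumes "0 < t" "1 \<le> \<kappa>" "finite F" "F \<subseteq> {\<kappa>..} \<times> {\<kappa>..}"
  shows "(\<Sum>(m, n)\<in>F. mgf \<kappa> m n t) \<le> exp (t * \<kappa> * Kmax) * penalty_sum t ^ 2"
proof -
  have "(\<Sum>(m, n)\<in>F. mgf \<kappa> m n t) \<le>
      (\<Sum>(m, n)\<in>F. exp (t * \<kappa> * Kmax) * (exp (- t * g (m - \<kappa>)) * exp (- t * g (n - \<kappa>))))"
    using assms by (intro sum_mono) (auto intro!: order.trans[OF mgf_upper])
  also have "\<dots> = exp (t * \<kappa> * Kmax) * (\<Sum>(m, n)\<in>F. exp (- t * g (m - \<kappa>)) * exp (- t * g (n - \<kappa>)))"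
    by (simp add: sum_distrib_left case_prod_unfold)
  also have "\<dots> \<le> exp (t * \<kappa> * Kmax) * penalty_sum t ^ 2"
    by (intro mult_left_mono penalty_product_sum_le assms) auto
  finally show ?thesis .
qed

lemma mgf_summable:
  assumes "0 < t" "1 \<le> \<kappa>"
  shows "(\<lambda>(m, n). mgf \<kappa> m n t) summable_on {\<kappa>..} \<times> {\<kappa>..}"
  by (rule nonneg_bdd_above_summable_on)
     (auto simp: mgf_nonneg intro!: bdd_aboveI2 mgf_finite_sum_le[OF assms])

lemma hk_le:
  assumes "0 < t" "1 \<le> \<kappa>"
    and "\<And>F. finite F \<Longrightarrow> F \<subseteq> {\<kappa>..} \<times> {\<kappa>..} \<Longrightarrow> (\<Sum>(m, n)\<in>F. mgf \<kappa> m n t) \<le> B"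
  shows "hk \<kappa> t \<le> B"
  unfolding hk_def by (rule infsum_le_finite_sums[OF mgf_summable[OF assms(1,2)] assms(3)])

lemma mgf_sum_le_hk:
  assumes "0 < t" "1 \<le> \<kappa>" "finite F" "F \<subseteq> {\<kappa>..} \<times> {\<kappa>..}"
  shows "(\<Sum>(m, n)\<in>F. mgf \<kappa> m n t) \<le> hk \<kappa> t"
  unfolding hk_def
  by (rule finite_sum_le_infsum[OF mgf_summable[OF assms(1,2)] assms(3,4)]) (auto simp: mgf_nonneg)

lemma mgf_le_hk:
  assumes "0 < t" "1 \<le> \<kappa>" "\<kappa> \<le> m" "\<kappa> \<le> n"
  shows "mgf \<kappa> m n t \<le> hk \<kappa> t"
  using mgf_sum_le_hk[OF assms(1,2), of "{(m, n)}"] assms by simp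

lemma hk_pos: "0 < t \<Longrightarrow> 1 \<le> \<kappa> \<Longrightarrow> 0 < hk \<kappa> t"
  using mgf_le_hk[of t \<kappa> \<kappa> \<kappa>] mgf_pos[of \<kappa> \<kappa> \<kappa> t] by simp

lemma hk_upper: "0 < t \<Longrightarrow> 1 \<le> \<kappa> \<Longrightarrow> hk \<kappa> t \<le> exp (t * \<kappa> * Kmax) * penalty_sum t ^ 2"
  by (rule hk_le) (auto intro: mgf_finite_sum_le)

lemma Gwords_superadditive:
  assumes "1 \<le> k1" "k1 \<le> m1" "k1 \<le> n1" "1 \<le> k2" "k2 \<le> m2" "k2 \<le> n2"
    "length xs = m1 + m2" "length ys = n1 + n2"
  shows "Gwords k1 (take m1 xs) (take n1 ys) + Gwords k2 (drop m1 xs) (drop n1 ys) \<le> Gwords (k1 + k2) xs ys"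
proof -
  have "Gmax K g k1 (letter (take m1 xs)) (letter (take n1 ys)) m1 n1 = Gmax K g k1 (letter xs) (letter ys) m1 n1"
    by (rule Gmax_cong) (auto simp: letter_take)
  moreover have "Gmax K g k2 (letter (drop m1 xs)) (letter (drop n1 ys)) m2 n2 =
      Gmax K g k2 (\<lambda>i. letter xs (m1 + i)) (\<lambda>j. letter ys (n1 + j)) m2 n2"
    by (rule Gmax_cong) (use assms in \<open>auto simp: letter_drop\<close>)
  ultimately show ?thesis
    using Gmax_superadditive[OF assms(1-6), of K g "letter xs" "letter ys"] assms unfolding Gwords_def by simp
qed

lemma mgf_supermultiplicative:
  assumes "0 \<le> t" "1 \<le> k1" "k1 \<le> m1" "k1 \<le> n1" "1 \<le> k2" "k2 \<le> m2" "k2 \<le> n2"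
  shows "mgf k1 m1 n1 t * mgf k2 m2 n2 t \<le> mgf (k1 + k2) (m1 + m2) (n1 + n2) t"
proof -
  have "mgf k1 m1 n1 t * mgf k2 m2 n2 t = expect (words (m1 + m2) (n1 + n2))
      (\<lambda>(xs, ys). exp (t * Gwords k1 (take m1 xs) (take n1 ys)) * exp (t * Gwords k2 (drop m1 xs) (drop n1 ys)))"
    unfolding mgf_def words_def by (rule expect_pair_split[symmetric]) simp
  also have "\<dots> \<le> mgf (k1 + k2) (m1 + m2) (n1 + n2) t"
    unfolding mgf_def
  proof (rule expect_mono, simp, safe)
    fix xs ys assume "(xs, ys) \<in> set_pmf (words (m1 + m2) (n1 + n2))"
    then have "length xs = m1 + m2" "length ys = n1 + n2" using length_words by auto
    from mult_left_mono[OF Gwords_superadditive[OF assms(2-7) this] assms(1)]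
    show "exp (t * Gwords k1 (take m1 xs) (take n1 ys)) * exp (t * Gwords k2 (drop m1 xs) (drop n1 ys))
       \<le> exp (t * Gwords (k1 + k2) xs ys)"
      unfolding exp_add[symmetric] by (simp add: algebra_simps)
  qed
  finally show ?thesis .
qed

lemma mgf_power:
  assumes "0 \<le> t" "1 \<le> \<kappa>"
  shows "mgf 1 1 1 t ^ \<kappa> \<le> mgf \<kappa> \<kappa> \<kappa> t"
  using assms(2)
proof (induction \<kappa> rule: dec_induct)
  case (step \<kappa>)
  have "mgf 1 1 1 t ^ Suc \<kappa> \<le> mgf \<kappa> \<kappa> \<kappa> t * mgf 1 1 1 t"
    using step mgf_pos[of 1 1 1 t] by (simp add: mult.commute mult_left_mono)
  also have "\<dots> \<le> mgf (\<kappa> + 1) (\<kappa> + 1) (\<kappa> + 1) t"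
    using mgf_supermultiplicative[OF assms(1), of \<kappa> \<kappa> \<kappa> 1 1 1] step by simp
  finally show ?case by simp
qed simp

lemma mgf_sym:
  assumes "1 \<le> \<kappa>" "\<kappa> \<le> m" "\<kappa> \<le> n"
  shows "mgf \<kappa> m n t = mgf \<kappa> n m t"
proof -
  have "mgf \<kappa> m n t = expect (words n m) (\<lambda>(ys, xs). exp (t * Gwords \<kappa> xs ys))"
    unfolding mgf_def words_def by (subst pair_commute_pmf) (simp add: case_prod_unfold)
  also have "\<dots> = mgf \<kappa> n m t"
    unfolding mgf_def
  proof (rule expect_cong)
    fix w assume w: "w \<in> set_pmf (words n m)"
    obtain ys xs where w': "w = (ys, xs)" by force
    then have "length xs = m" "length ys = n" using length_words w by auto
    then show "(\<lambda>(ys, xs). exp (t * Gwords \<kappa> xs ys)) w = (\<lambda>(xs, ys). exp (t * Gwords \<kappa> xs ys)) w"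
      using Gmax_swap[of K \<kappa> m n g "letter xs" "letter ys"] K_sym assms unfolding Gwords_def w' by simp
  qed
  finally show ?thesis .
qed

lemma Gwords_split:
  assumes "1 \<le> k1" "1 \<le> k2" "k1 + k2 \<le> length xs" "k1 + k2 \<le> length ys"
  obtains m1 n1 where "k1 \<le> m1" "m1 + k2 \<le> length xs" "k1 \<le> n1" "n1 + k2 \<le> length ys"
    "Gwords (k1 + k2) xs ys \<le> Gwords k1 (take m1 xs) (take n1 ys) + Gwords k2 (drop m1 xs) (drop n1 ys)"
proof -
  define m where "m = length xs"
  define n where "n = length ys"
  obtain m1 n1 where *: "k1 \<le> m1" "m1 + k2 \<le> m" "k1 \<le> n1" "n1 + k2 \<le> n"
    "Gmax K g (k1 + k2) (letter xs) (letter ys) m n \<le> Gmax K g k1 (letter xs) (letter ys) m1 n1 +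
      Gmax K g k2 (\<lambda>i. letter xs (m1 + i)) (\<lambda>j. letter ys (n1 + j)) (m - m1) (n - n1)"
    using Gmax_split[OF assms(1,2), of m n] assms(3,4) unfolding m_def n_def by blast
  have "Gmax K g k1 (letter (take m1 xs)) (letter (take n1 ys)) m1 n1 = Gmax K g k1 (letter xs) (letter ys) m1 n1"
    by (rule Gmax_cong) (auto simp: letter_take)
  moreover have "Gmax K g k2 (letter (drop m1 xs)) (letter (drop n1 ys)) (m - m1) (n - n1) =
      Gmax K g k2 (\<lambda>i. letter xs (m1 + i)) (\<lambda>j. letter ys (n1 + j)) (m - m1) (n - n1)"
    by (rule Gmax_cong) (use * in \<open>auto simp: letter_drop m_def n_def\<close>)
  ultimately have "Gwords (k1 + k2) xs ys \<le> Gwords k1 (take m1 xs) (take n1 ys) + Gwords k2 (drop m1 xs) (drop n1 ys)"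
    using * unfolding Gwords_def m_def n_def by simp
  then show ?thesis using that[of m1 n1] * unfolding m_def n_def by simp
qed

lemma mgf_split:
  assumes "0 \<le> t" "1 \<le> k1" "1 \<le> k2" "k1 + k2 \<le> m" "k1 + k2 \<le> n"
  shows "mgf (k1 + k2) m n t \<le>
    (\<Sum>(m1, n1)\<in>{k1..m - k2} \<times> {k1..n - k2}. mgf k1 m1 n1 t * mgf k2 (m - m1) (n - n1) t)"
proof -
  let ?I = "{k1..m - k2} \<times> {k1..n - k2}"
  let ?f = "\<lambda>(m1, n1) (xs, ys). exp (t * Gwords k1 (take m1 xs) (take n1 ys)) * exp (t * Gwords k2 (drop m1 xs) (drop n1 ys))"
  have "mgf (k1 + k2) m n t \<le> expect (words m n) (\<lambda>w. \<Sum>i\<in>?I. ?f i w)"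
    unfolding mgf_def
  proof (rule expect_mono, simp, safe)
    fix xs ys assume "(xs, ys) \<in> set_pmf (words m n)"
    then have l: "length xs = m" "length ys = n" using length_words by auto
    then obtain m1 n1 where *: "k1 \<le> m1" "m1 + k2 \<le> m" "k1 \<le> n1" "n1 + k2 \<le> n"
      "Gwords (k1 + k2) xs ys \<le> Gwords k1 (take m1 xs) (take n1 ys) + Gwords k2 (drop m1 xs) (drop n1 ys)"
      using Gwords_split[OF assms(2,3), of xs ys] assms(4,5) by metis
    have "exp (t * Gwords (k1 + k2) xs ys) \<le> ?f (m1, n1) (xs, ys)"
      using mult_left_mono[OF *(5) assms(1)] by (simp add: exp_add[symmetric] algebra_simps)
    also have "\<dots> \<le> (\<Sum>i\<in>?I. ?f i (xs, ys))"
      by (rule member_le_sum) (use * in auto)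
    finally show "exp (t * Gwords (k1 + k2) xs ys) \<le> (\<Sum>i\<in>?I. ?f i (xs, ys))" .
  qed
  also have "\<dots> = (\<Sum>i\<in>?I. expect (words m n) (?f i))"
    by (rule expect_sum) simp
  also have "\<dots> = (\<Sum>(m1, n1)\<in>?I. mgf k1 m1 n1 t * mgf k2 (m - m1) (n - n1) t)"
  proof (rule sum.cong[OF refl])
    fix i assume i: "i \<in> ?I"
    obtain m1 n1 where i': "i = (m1, n1)" by force
    from i have mn: "m = m1 + (m - m1)" "n = n1 + (n - n1)" using assms i' by auto
    have "expect (words (m1 + (m - m1)) (n1 + (n - n1))) (?f (m1, n1)) = mgf k1 m1 n1 t * mgf k2 (m - m1) (n - n1) t"
      unfolding mgf_def words_def case_prod_conv by (rule expect_pair_split) simp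
    then show "expect (words m n) (?f i) = (case i of (m1, n1) \<Rightarrow> mgf k1 m1 n1 t * mgf k2 (m - m1) (n - n1) t)"
      using mn i' by simp
  qed
  finally show ?thesis .
qed

text \<open>
  The lengths of the two pieces determine both the total lengths and the place of the cut, so the
  sum over total lengths and cuts is dominated by the product of the two series.
\<close>

lemma hk_submultiplicative:
  assumes "0 < t" "1 \<le> k1" "1 \<le> k2"
  shows "hk (k1 + k2) t \<le> hk k1 t * hk k2 t"
proof (rule hk_le[OF assms(1)])
  show "1 \<le> k1 + k2" using assms by simp
  fix F :: "(nat \<times> nat) set" assume F: "finite F" "F \<subseteq> {k1 + k2..} \<times> {k1 + k2..}"
  define P where "P = (SIGMA p:F. {k1..fst p - k2} \<times> {k1..snd p - k2})"
  define \<phi> where "\<phi> = (\<lambda>(p, q). (q, (fst p - fst q, snd p - snd q)) :: (nat \<times> nat) \<times> (nat \<times> nat))"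
  have fP: "finite P" unfolding P_def using F(1) by auto
  have inj: "inj_on \<phi> P"
    unfolding inj_on_def P_def \<phi>_def using F(2) assms by (force simp: prod_eq_iff)
  define A where "A = fst ` \<phi> ` P"
  define B where "B = snd ` \<phi> ` P"
  have fAB: "finite A" "finite B" unfolding A_def B_def using fP by auto
  have A: "A \<subseteq> {k1..} \<times> {k1..}" unfolding A_def P_def \<phi>_def by auto
  have B: "B \<subseteq> {k2..} \<times> {k2..}"
  proof
    fix b assume "b \<in> B"
    then obtain p q where pq: "p \<in> F" "q \<in> {k1..fst p - k2} \<times> {k1..snd p - k2}" "b = (fst p - fst q, snd p - snd q)"
      unfolding B_def P_def \<phi>_def by auto
    have "k1 + k2 \<le> fst p \<and> k1 + k2 \<le> snd p" using F(2) pq(1) by auto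
    then show "b \<in> {k2..} \<times> {k2..}" using pq(2,3) by auto
  qed
  let ?w = "\<lambda>((m1, n1), (m2, n2)). mgf k1 m1 n1 t * mgf k2 m2 n2 t"
  have "(\<Sum>(m, n)\<in>F. mgf (k1 + k2) m n t) \<le>
      (\<Sum>p\<in>F. \<Sum>q\<in>{k1..fst p - k2} \<times> {k1..snd p - k2}. ?w (\<phi> (p, q)))"
  proof (rule sum_mono, safe)
    fix m n assume "(m, n) \<in> F"
    then have "k1 + k2 \<le> m" "k1 + k2 \<le> n" using F(2) by auto
    from mgf_split[OF _ assms(2,3) this, of t]
    show "mgf (k1 + k2) m n t \<le> (\<Sum>q\<in>{k1..fst (m, n) - k2} \<times> {k1..snd (m, n) - k2}. ?w (\<phi> ((m, n), q)))"
      using assms(1) unfolding \<phi>_def by (simp add: case_prod_unfold)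
  qed
  also have "\<dots> = (\<Sum>r\<in>P. ?w (\<phi> r))"
    unfolding P_def by (subst sum.Sigma) (use F(1) in \<open>auto simp: case_prod_unfold\<close>)
  also have "\<dots> = (\<Sum>r\<in>\<phi> ` P. ?w r)"
    by (subst sum.reindex[OF inj]) simp
  also have "\<dots> \<le> (\<Sum>r\<in>A \<times> B. ?w r)"
  proof (rule sum_mono2)
    show "\<phi> ` P \<subseteq> A \<times> B"
      unfolding A_def B_def by (rule subsetI) (simp only: mem_Times_iff, blast)
  qed (use fAB in \<open>auto simp: mgf_nonneg\<close>)
  also have "\<dots> = (\<Sum>(m, n)\<in>A. mgf k1 m n t) * (\<Sum>(m, n)\<in>B. mgf k2 m n t)"
    by (simp add: sum_product sum.cartesian_product case_prod_unfold)
  also have "\<dots> \<le> hk k1 t * hk k2 t"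
    using assms fAB A B hk_pos[OF assms(1,2)]
    by (intro mult_mono mgf_sum_le_hk sum_nonneg) (auto simp: mgf_nonneg)
  finally show "(\<Sum>(m, n)\<in>F. mgf (k1 + k2) m n t) \<le> hk k1 t * hk k2 t" .
qed

end

section \<open>The limit \<open>\<psi>\<close>\<close>

text \<open>
  Fekete's lemma, including that the limit is a lower bound of \<open>a n / n\<close>.
\<close>

lemma fekete:
  fixes a :: "nat \<Rightarrow> real"
  assumes sub: "\<And>m n. 1 \<le> m \<Longrightarrow> 1 \<le> n \<Longrightarrow> a (m + n) \<le> a m + a n"
    and lower: "\<And>n. 1 \<le> n \<Longrightarrow> c * n \<le> a n"
  obtains l where "(\<lambda>n. a n / n) \<longlonglongrightarrow> l" "\<And>n. 1 \<le> n \<Longrightarrow> l * n \<le> a n"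
proof -
  define S where "S = (\<lambda>n. a n / n) ` {1..}"
  have bdd: "bdd_below S" unfolding S_def
    by (rule bdd_belowI2[of _ c]) (use lower in \<open>auto simp: field_simps\<close>)
  have ne: "S \<noteq> {}" unfolding S_def by auto
  define l where "l = Inf S"
  have le: "l \<le> a n / n" if "1 \<le> n" for n
    unfolding l_def by (rule cInf_lower[OF _ bdd]) (use that in \<open>auto simp: S_def\<close>)
  have mult: "a (q * k + r) \<le> k * a q + a r" if "1 \<le> q" "1 \<le> r" for q k r
  proof (induction k)
    case (Suc k)
    have "a (q + (q * k + r)) \<le> a q + a (q * k + r)" by (rule sub) (use that in auto)
    then show ?case using Suc by (simp add: algebra_simps)
  qed simp
  have "(\<lambda>n. a n / n) \<longlonglongrightarrow> l"
  proof (rule LIMSEQ_I)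
    fix e :: real assume e: "0 < e"
    then have "\<exists>s\<in>S. s < l + e / 2" using cInf_lessD[OF ne, of "l + e / 2"] unfolding l_def by auto
    then obtain q where q: "1 \<le> q" "a q / q < l + e / 2" unfolding S_def by auto
    define A where "A = (\<Sum>r\<in>{1..q}. \<bar>a r\<bar>) + \<bar>a q\<bar>"
    have "\<forall>\<^sub>F n in sequentially. A / real n < e / 2"
      using e by real_asymp
    then have "\<forall>\<^sub>F n in sequentially. norm (a n / n - l) < e"
      using eventually_ge_at_top[of 1]
    proof eventually_elim
      case (elim n)
      define k where "k = (n - 1) div q"
      define r where "r = Suc ((n - 1) mod q)"
      have n: "n = q * k + r" using elim(2) unfolding k_def r_def by simp
      have r: "1 \<le> r" "r \<le> q" using q(1) unfolding r_def by (auto simp: Suc_le_eq)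
      have "a n \<le> k * a q + a r" using mult[OF q(1) r(1)] n by simp
      moreover have "k * a q = (n - r) * (a q / q)" using n q(1) by (simp add: field_simps)
      moreover have "(n - r) * (a q / q) = n * (a q / q) - r * (a q / q)"
        using n by (simp add: of_nat_diff algebra_simps diff_divide_distrib)
      moreover have "- (r * (a q / q)) \<le> \<bar>a q\<bar>"
      proof -
        have "real r / real q \<le> 1" using r q(1) by simp
        then have "(real r / real q) * \<bar>a q\<bar> \<le> 1 * \<bar>a q\<bar>" by (rule mult_right_mono) simp
        moreover have "- (r * (a q / q)) \<le> (real r / real q) * \<bar>a q\<bar>"
          using mult_left_mono[of "- a q" "\<bar>a q\<bar>" "real r / real q"] by simp
        ultimately show ?thesis by linarith
      qed
      moreover have "a r \<le> (\<Sum>r\<in>{1..q}. \<bar>a r\<bar>)"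
        by (rule order.trans[OF abs_ge_self member_le_sum[of r _ "\<lambda>r. \<bar>a r\<bar>"]]) (use r in auto)
      ultimately have "a n \<le> n * (a q / q) + A" unfolding A_def by linarith
      then have "a n / n \<le> a q / q + A / n" using elim(2) by (simp add: field_simps)
      then have "a n / n < l + e" using q(2) elim(1) by linarith
      then show ?case using le[OF elim(2)] by simp
    qed
    then show "\<exists>no. \<forall>n\<ge>no. norm (a n / n - l) < e" unfolding eventually_sequentially .
  qed
  moreover have "l * n \<le> a n" if "1 \<le> n" for n using le[OF that] that by (simp add: field_simps)
  ultimately show ?thesis using that by blast
qed

context scoring_model
begin

lemma Psi_convergent_and_lower:
  assumes "0 < t"
  shows "(\<lambda>\<kappa>. ln (hk \<kappa> t) / \<kappa>) \<longlonglongrightarrow> Psi t \<and> (\<forall>\<kappa>\<ge>1. Psi t * \<kappa> \<le> ln (hk \<kappa> t))"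
proof -
  have sub: "ln (hk (m + n) t) \<le> ln (hk m t) + ln (hk n t)" if "1 \<le> m" "1 \<le> n" for m n
  proof -
    have "ln (hk (m + n) t) \<le> ln (hk m t * hk n t)"
      using hk_submultiplicative[OF assms that] hk_pos[OF assms, of "m + n"] that by (intro ln_mono) auto
    then show ?thesis using hk_pos[OF assms] that by (simp add: ln_mult_pos)
  qed
  have low: "ln (mgf 1 1 1 t) * n \<le> ln (hk n t)" if "1 \<le> n" for n
  proof -
    have "mgf 1 1 1 t ^ n \<le> hk n t"
      using mgf_power[of t n] mgf_le_hk[of t n n n] assms that by simp
    then have "ln (mgf 1 1 1 t ^ n) \<le> ln (hk n t)" using mgf_pos[of 1 1 1 t] by (intro ln_mono) auto
    then show ?thesis using mgf_pos[of 1 1 1 t] by (simp add: ln_realpow mult.commute)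
  qed
  obtain l where l: "(\<lambda>n. ln (hk n t) / n) \<longlonglongrightarrow> l" "\<And>n. 1 \<le> n \<Longrightarrow> l * n \<le> ln (hk n t)"
    using fekete[of "\<lambda>n. ln (hk n t)" "ln (mgf 1 1 1 t)"] sub low by blast
  moreover have "Psi t = l" unfolding Psi_def by (rule limI[OF l(1)])
  ultimately show ?thesis by blast
qed

lemmas Psi_limit = Psi_convergent_and_lower[THEN conjunct1]

lemma exp_Psi_le_hk:
  assumes "0 < t" "1 \<le> \<kappa>"
  shows "exp (Psi t * \<kappa>) \<le> hk \<kappa> t"
proof -
  have "Psi t * \<kappa> \<le> ln (hk \<kappa> t)" using Psi_convergent_and_lower[OF assms(1)] assms(2) by blast
  then show ?thesis using ln_ge_iff[OF hk_pos[OF assms]] by blast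
qed

text \<open>
  The constant absorbs the finitely many \<open>\<kappa>\<close> for which \<open>\<psi>\<^sub>\<kappa>(t) / \<kappa>\<close> is still far from its limit; the
  union bounds below need an estimate that holds for all \<open>\<kappa>\<close>.
\<close>

lemma hk_le_exp_Psi:
  assumes "0 < t" "0 < \<nu>"
  obtains C where "0 < C" "\<And>\<kappa>. 1 \<le> \<kappa> \<Longrightarrow> hk \<kappa> t \<le> C * exp (\<kappa> * (Psi t + \<nu>))"
proof -
  have "\<forall>\<^sub>F \<kappa> in sequentially. ln (hk \<kappa> t) / \<kappa> < Psi t + \<nu>"
    by (rule order_tendstoD(2)[OF Psi_limit[OF assms(1)]]) (use assms in simp)
  then obtain N where N: "\<And>\<kappa>. N \<le> \<kappa> \<Longrightarrow> ln (hk \<kappa> t) / \<kappa> < Psi t + \<nu>"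
    unfolding eventually_sequentially by blast
  define C where "C = 1 + (\<Sum>\<kappa>\<in>{1..N}. hk \<kappa> t / exp (\<kappa> * (Psi t + \<nu>)))"
  have p: "0 \<le> hk \<kappa> t / exp (\<kappa> * (Psi t + \<nu>))" if "1 \<le> \<kappa>" for \<kappa>
    using hk_pos[OF assms(1) that] by simp
  have s: "0 \<le> (\<Sum>\<kappa>\<in>{1..N}. hk \<kappa> t / exp (\<kappa> * (Psi t + \<nu>)))"
    by (rule sum_nonneg) (use p in simp)
  have "hk \<kappa> t / exp (\<kappa> * (Psi t + \<nu>)) \<le> C" if \<kappa>: "1 \<le> \<kappa>" for \<kappa>
  proof (cases "\<kappa> \<le> N")
    case True
    have "hk \<kappa> t / exp (\<kappa> * (Psi t + \<nu>)) \<le> (\<Sum>\<kappa>\<in>{1..N}. hk \<kappa> t / exp (\<kappa> * (Psi t + \<nu>)))"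
      by (rule member_le_sum[of \<kappa> _ "\<lambda>\<kappa>. hk \<kappa> t / exp (\<kappa> * (Psi t + \<nu>))"]) (use True \<kappa> p in auto)
    then show ?thesis unfolding C_def by simp
  next
    case False
    then have "ln (hk \<kappa> t) < \<kappa> * (Psi t + \<nu>)" using N[of \<kappa>] \<kappa> by (simp add: field_simps)
    then have "exp (ln (hk \<kappa> t)) < exp (\<kappa> * (Psi t + \<nu>))" by simp
    then have "hk \<kappa> t / exp (\<kappa> * (Psi t + \<nu>)) \<le> 1" using hk_pos[OF assms(1) \<kappa>] by simp
    moreover have "1 \<le> C" using s unfolding C_def by simp
    ultimately show ?thesis by linarith
  qed
  moreover have "0 < C" using s unfolding C_def by simp
  ultimately show ?thesis using that by (simp add: field_simps)
qed

text \<open>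
  The gap penalties contribute to \<open>h\<^sub>\<kappa>(t)\<close> a factor that does not depend on \<open>\<kappa>\<close>, and each match at
  most \<open>exp (t K\<^sub>m\<^sub>a\<^sub>x)\<close>.
\<close>

lemma Psi_upper:
  assumes "0 < t"
  shows "Psi t \<le> t * Kmax"
proof (rule LIMSEQ_le[OF Psi_limit[OF assms]])
  show "(\<lambda>\<kappa>. t * Kmax + ln (penalty_sum t ^ 2) / real \<kappa>) \<longlonglongrightarrow> t * Kmax"
    using tendsto_add[OF tendsto_const lim_const_over_n] by fastforce
  show "\<exists>N. \<forall>\<kappa>\<ge>N. ln (hk \<kappa> t) / real \<kappa> \<le> t * Kmax + ln (penalty_sum t ^ 2) / real \<kappa>"
  proof (intro exI allI impI)
    fix \<kappa> :: nat assume \<kappa>: "1 \<le> \<kappa>"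
    have pp: "0 < penalty_sum t ^ 2" using penalty_sum_ge_1[OF assms] by simp
    have "ln (hk \<kappa> t) \<le> ln (exp (t * \<kappa> * Kmax) * penalty_sum t ^ 2)"
      using hk_upper[OF assms \<kappa>] hk_pos[OF assms \<kappa>] by (intro ln_mono) auto
    also have "\<dots> = t * \<kappa> * Kmax + ln (penalty_sum t ^ 2)"
      using pp by (simp add: ln_mult_pos)
    finally show "ln (hk \<kappa> t) / real \<kappa> \<le> t * Kmax + ln (penalty_sum t ^ 2) / real \<kappa>"
      using \<kappa> by (simp add: field_simps)
  qed
qed

text \<open>
  Hoelder's inequality, in the form of the arithmetic-geometric inequality applied to the
  normalised terms of the two series.
\<close>

lemma ln_hk_convex:
  assumes "0 < s" "0 < t" "0 \<le> u" "0 \<le> v" "u + v = 1" "1 \<le> \<kappa>"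
  shows "ln (hk \<kappa> (u * s + v * t)) \<le> u * ln (hk \<kappa> s) + v * ln (hk \<kappa> t)"
proof -
  define A where "A = hk \<kappa> s"
  define B where "B = hk \<kappa> t"
  have AB: "0 < A" "0 < B" unfolding A_def B_def using hk_pos assms by auto
  have w: "0 < u * s + v * t"
    using assms(1-5) by (metis add_nonneg_pos add_pos_nonneg less_eq_real_def mult_nonneg_nonneg mult_pos_pos zero_neq_one add.right_neutral)
  define R where "R = exp (u * ln A + v * ln B)"
  have pw: "exp ((u * s + v * t) * z) \<le> R * (u / A) * exp (s * z) + R * (v / B) * exp (t * z)" for z
  proof -
    have "exp (u *\<^sub>R (s * z - ln A) + v *\<^sub>R (t * z - ln B)) \<le> u * exp (s * z - ln A) + v * exp (t * z - ln B)"
    proof -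
      have u: "u = 1 - v" using assms(5) by simp
      show ?thesis unfolding u
        by (rule convex_onD[OF exp_convex]) (use assms(3-5) in auto)
    qed
    also have "\<dots> = (u / A) * exp (s * z) + (v / B) * exp (t * z)"
      using AB by (simp add: exp_diff)
    finally have "R * exp (u *\<^sub>R (s * z - ln A) + v *\<^sub>R (t * z - ln B)) \<le> R * ((u / A) * exp (s * z) + (v / B) * exp (t * z))"
      by (rule mult_left_mono) (simp add: R_def)
    moreover have "R * exp (u *\<^sub>R (s * z - ln A) + v *\<^sub>R (t * z - ln B)) = exp ((u * s + v * t) * z)"
      unfolding R_def exp_add[symmetric] by (simp add: algebra_simps)
    ultimately show ?thesis by (simp add: algebra_simps)
  qed
  have mg: "mgf \<kappa> m n (u * s + v * t) \<le> R * (u / A) * mgf \<kappa> m n s + R * (v / B) * mgf \<kappa> m n t" for m n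
  proof -
    have "mgf \<kappa> m n (u * s + v * t) \<le> expect (words m n)
        (\<lambda>x. R * (u / A) * (\<lambda>(xs, ys). exp (s * Gwords \<kappa> xs ys)) x + R * (v / B) * (\<lambda>(xs, ys). exp (t * Gwords \<kappa> xs ys)) x)"
      unfolding mgf_def by (rule expect_mono) (use pw in \<open>auto simp: case_prod_unfold\<close>)
    also have "\<dots> = R * (u / A) * mgf \<kappa> m n s + R * (v / B) * mgf \<kappa> m n t"
      unfolding mgf_def by (subst expect_add) simp_all
    finally show ?thesis .
  qed
  have "hk \<kappa> (u * s + v * t) \<le> R"
  proof (rule hk_le[OF w assms(6)])
    fix F :: "(nat \<times> nat) set" assume F: "finite F" "F \<subseteq> {\<kappa>..} \<times> {\<kappa>..}"
    have "(\<Sum>(m, n)\<in>F. mgf \<kappa> m n (u * s + v * t)) \<le>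
        (\<Sum>(m, n)\<in>F. R * (u / A) * mgf \<kappa> m n s + R * (v / B) * mgf \<kappa> m n t)"
      by (rule sum_mono) (use mg in \<open>auto simp: case_prod_unfold\<close>)
    also have "\<dots> = R * (u / A) * (\<Sum>(m, n)\<in>F. mgf \<kappa> m n s) + R * (v / B) * (\<Sum>(m, n)\<in>F. mgf \<kappa> m n t)"
      by (simp add: sum.distrib sum_distrib_left case_prod_unfold)
    also have "\<dots> \<le> R * (u / A) * A + R * (v / B) * B"
      unfolding A_def B_def using assms F AB
      by (intro add_mono mult_left_mono mgf_sum_le_hk) (auto simp: R_def A_def B_def)
    also have "\<dots> = R" using AB assms(5) by (simp add: distrib_left[symmetric])
    finally show "(\<Sum>(m, n)\<in>F. mgf \<kappa> m n (u * s + v * t)) \<le> R" .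
  qed
  then have "ln (hk \<kappa> (u * s + v * t)) \<le> ln R" using hk_pos[OF w assms(6)] by (intro ln_mono) auto
  then show ?thesis unfolding R_def A_def B_def by simp
qed

lemma Psi_convex: "convex_on {0<..} Psi"
proof (rule convex_onI)
  show "convex ({0<..} :: real set)" by (rule convex_real_interval)
  fix v s t :: real assume v: "0 < v" "v < 1" and st: "s \<in> {0<..}" "t \<in> {0<..}"
  have w: "0 < (1 - v) * s + v * t" using v st by (simp add: add_pos_pos)
  have "Psi ((1 - v) * s + v * t) \<le> (1 - v) * Psi s + v * Psi t"
  proof (rule LIMSEQ_le[OF Psi_limit[OF w]])
    show "(\<lambda>\<kappa>. (1 - v) * (ln (hk \<kappa> s) / real \<kappa>) + v * (ln (hk \<kappa> t) / real \<kappa>)) \<longlonglongrightarrow> (1 - v) * Psi s + v * Psi t"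
      by (intro tendsto_add tendsto_mult_left Psi_limit) (use st in auto)
    show "\<exists>N. \<forall>\<kappa>\<ge>N. ln (hk \<kappa> ((1 - v) * s + v * t)) / real \<kappa> \<le> (1 - v) * (ln (hk \<kappa> s) / real \<kappa>) + v * (ln (hk \<kappa> t) / real \<kappa>)"
    proof (intro exI allI impI)
      fix \<kappa> :: nat assume \<kappa>: "1 \<le> \<kappa>"
      have "ln (hk \<kappa> ((1 - v) * s + v * t)) \<le> (1 - v) * ln (hk \<kappa> s) + v * ln (hk \<kappa> t)"
        by (rule ln_hk_convex) (use v st \<kappa> in auto)
      then have "ln (hk \<kappa> ((1 - v) * s + v * t)) / real \<kappa> \<le> ((1 - v) * ln (hk \<kappa> s) + v * ln (hk \<kappa> t)) / real \<kappa>"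
        by (rule divide_right_mono) simp
      then show "ln (hk \<kappa> ((1 - v) * s + v * t)) / real \<kappa> \<le> (1 - v) * (ln (hk \<kappa> s) / real \<kappa>) + v * (ln (hk \<kappa> t) / real \<kappa>)"
        by (simp add: add_divide_distrib)
    qed
  qed
  then show "Psi ((1 - v) *\<^sub>R s + v *\<^sub>R t) \<le> (1 - v) * Psi s + v * Psi t" by simp
qed

text \<open>
  Since \<open>\<psi>(t) \<le> t K\<^sub>m\<^sub>a\<^sub>x\<close>, the convex function \<open>\<psi>\<close> is at most \<open>0\<close> between \<open>0\<close> and its root. A
  nonpositive slope at the root would keep \<open>\<psi>\<close> nonnegative there, hence zero on a whole interval.
\<close>

lemma Psi_root_derivative_pos:
  assumes "0 < \<theta>" "Psi \<theta> = 0" "\<And>t. 0 < t \<Longrightarrow> Psi t = 0 \<Longrightarrow> t = \<theta>"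
    and D: "(Psi has_real_derivative D) (at \<theta>)"
  shows "0 < D"
proof (rule ccontr)
  assume "\<not> 0 < D"
  define t where "t = \<theta> / 2"
  have t: "0 < t" "t < \<theta>" using assms(1) unfolding t_def by auto
  have "(Psi has_real_derivative D) (at \<theta> within {0<..})" using D by (rule has_field_derivative_at_within)
  then have "Psi t - Psi \<theta> \<ge> D * (t - \<theta>)"
    using convex_on_imp_above_tangent[OF Psi_convex, of \<theta> t D] assms(1) t by (auto simp: interior_open)
  moreover have "D * (t - \<theta>) \<ge> 0" using \<open>\<not> 0 < D\<close> t by (simp add: mult_nonpos_nonpos)
  ultimately have ge: "0 \<le> Psi t" using assms(2) by simp
  have le: "Psi t \<le> s * \<bar>Kmax\<bar>" if s: "0 < s" "s < t" for s
  proof -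
    define v where "v = (t - s) / (\<theta> - s)"
    have v: "0 \<le> v" "v \<le> 1" using s t unfolding v_def by auto
    have "(1 - v) * s + v * \<theta> = s + v * (\<theta> - s)" by (simp add: algebra_simps)
    also have "\<dots> = t" using s t unfolding v_def by simp
    finally have "Psi t \<le> (1 - v) * Psi s + v * Psi \<theta>"
      using convex_onD[OF Psi_convex v, of s \<theta>] s assms(1) by simp
    also have "\<dots> \<le> (1 - v) * (s * \<bar>Kmax\<bar>)"
    proof -
      have "s * Kmax \<le> s * \<bar>Kmax\<bar>" using s by (intro mult_left_mono) auto
      then have "Psi s \<le> s * \<bar>Kmax\<bar>" using Psi_upper[OF s(1)] by linarith
      then show ?thesis using v assms(2) by (simp add: mult_left_mono)
    qed
    also have "\<dots> \<le> 1 * (s * \<bar>Kmax\<bar>)" using v s by (intro mult_right_mono) auto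
    finally show ?thesis by simp
  qed
  have "((\<lambda>s. s * \<bar>Kmax\<bar>) \<longlongrightarrow> 0 * \<bar>Kmax\<bar>) (at_right 0)" by (intro tendsto_intros)
  moreover have "\<forall>\<^sub>F s in at_right 0. Psi t \<le> s * \<bar>Kmax\<bar>"
    unfolding eventually_at_right_field using le t(1) by blast
  ultimately have "Psi t \<le> 0 * \<bar>Kmax\<bar>" by (intro tendsto_lowerbound) (auto simp: trivial_limit_at_right_real)
  then have "Psi t = 0" using ge by simp
  then show False using assms(3)[OF t(1)] t by simp
qed

text \<open>
  Only subexponentially many pairs of lengths matter, so that a positive \<open>\<psi>(t)\<close> is due to a single
  pair. The count is made by interpolating: \<open>min 1 b \<le> b\<^sup>s\<close> replaces \<open>t\<close> by \<open>s t\<close> in the bound for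
  \<open>h\<^sub>\<kappa>\<close>, at a cost \<open>s t \<kappa> K\<^sub>m\<^sub>a\<^sub>x\<close> in the exponent that can be made smaller than \<open>\<kappa> \<psi>(t)\<close>.
\<close>

lemma mgf_gt_1_exists:
  assumes "0 < t" "0 < Psi t"
  obtains \<kappa> m n where "1 \<le> \<kappa>" "\<kappa> \<le> m" "\<kappa> \<le> n" "1 < mgf \<kappa> m n t"
proof (rule ccontr)
  note * = that
  assume "\<not> thesis"
  then have le1: "mgf \<kappa> m n t \<le> 1" if "1 \<le> \<kappa>" "\<kappa> \<le> m" "\<kappa> \<le> n" for \<kappa> m n
    using that(1-3) *[of \<kappa> m n] \<open>\<not> thesis\<close> by (cases "1 < mgf \<kappa> m n t") auto
  define b where "b = \<bar>Kmax\<bar> + 1"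
  have b: "0 < b" unfolding b_def by simp
  define s where "s = min 1 (Psi t / (2 * t * b))"
  have s: "0 < s" "s \<le> 1" using assms b unfolding s_def by auto
  have "s * (t * b) \<le> Psi t / (2 * t * b) * (t * b)"
    by (rule mult_right_mono) (use assms b in \<open>auto simp: s_def\<close>)
  also have "\<dots> = Psi t / 2" using assms b by simp
  finally have "s * t * \<bar>Kmax\<bar> + s * t \<le> Psi t / 2" unfolding b_def by (simp add: algebra_simps)
  moreover have "s * t * Kmax \<le> s * t * \<bar>Kmax\<bar>" "0 < s * t" using s assms by (auto intro: mult_left_mono)
  ultimately have stK: "s * t * Kmax \<le> Psi t / 2" by linarith
  have st: "0 < s * t" using s assms by simp
  have hs: "hk \<kappa> t \<le> exp (s * t * \<kappa> * Kmax) * penalty_sum (s * t) ^ 2" if \<kappa>: "1 \<le> \<kappa>" for \<kappa>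
  proof (rule hk_le[OF assms(1) \<kappa>])
    fix F :: "(nat \<times> nat) set" assume F: "finite F" "F \<subseteq> {\<kappa>..} \<times> {\<kappa>..}"
    have *: "mgf \<kappa> m n t \<le> exp (s * t * \<kappa> * Kmax) * (exp (- (s * t) * g (m - \<kappa>)) * exp (- (s * t) * g (n - \<kappa>)))"
      if mn: "\<kappa> \<le> m" "\<kappa> \<le> n" for m n
    proof -
      define x where "x = t * \<kappa> * Kmax - t * g (m - \<kappa>) - t * g (n - \<kappa>)"
      have "mgf \<kappa> m n t \<le> exp x"
        using mgf_upper[OF _ \<kappa> mn, of t] assms unfolding x_def by (simp add: exp_add[symmetric] algebra_simps)
      then have "mgf \<kappa> m n t \<le> min 1 (exp x)" using le1[OF \<kappa> mn] by simp
      also have "\<dots> \<le> exp (s * x)"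
      proof (cases "0 \<le> x")
        case False
        then have "1 * x \<le> s * x" using s by (intro mult_right_mono_neg) auto
        then show ?thesis by (simp add: min.coboundedI2)
      qed (use s in simp)
      also have "\<dots> = exp (s * t * \<kappa> * Kmax) * (exp (- (s * t) * g (m - \<kappa>)) * exp (- (s * t) * g (n - \<kappa>)))"
        unfolding x_def exp_add[symmetric] by (simp add: algebra_simps)
      finally show ?thesis .
    qed
    have "(\<Sum>(m, n)\<in>F. mgf \<kappa> m n t) \<le>
       (\<Sum>(m, n)\<in>F. exp (s * t * \<kappa> * Kmax) * (exp (- (s * t) * g (m - \<kappa>)) * exp (- (s * t) * g (n - \<kappa>))))"
      by (rule sum_mono) (use * F in auto)
    also have "\<dots> = exp (s * t * \<kappa> * Kmax) * (\<Sum>(m, n)\<in>F. exp (- (s * t) * g (m - \<kappa>)) * exp (- (s * t) * g (n - \<kappa>)))"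
      by (simp add: sum_distrib_left case_prod_unfold)
    also have "\<dots> \<le> exp (s * t * \<kappa> * Kmax) * penalty_sum (s * t) ^ 2"
      by (intro mult_left_mono penalty_product_sum_le st F) auto
    finally show "(\<Sum>(m, n)\<in>F. mgf \<kappa> m n t) \<le> exp (s * t * \<kappa> * Kmax) * penalty_sum (s * t) ^ 2" .
  qed
  have pp: "0 < penalty_sum (s * t) ^ 2" using penalty_sum_ge_1[OF st] by simp
  have "Psi t / 2 * \<kappa> \<le> ln (penalty_sum (s * t) ^ 2)" if \<kappa>: "1 \<le> \<kappa>" for \<kappa> :: nat
  proof -
    have "Psi t * \<kappa> \<le> ln (exp (s * t * \<kappa> * Kmax) * penalty_sum (s * t) ^ 2)"
      using exp_Psi_le_hk[OF assms(1) \<kappa>] hs[OF \<kappa>] pp by (subst ln_ge_iff) auto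
    also have "\<dots> = s * t * Kmax * \<kappa> + ln (penalty_sum (s * t) ^ 2)" using pp by (simp add: ln_mult_pos)
    also have "\<dots> \<le> Psi t / 2 * \<kappa> + ln (penalty_sum (s * t) ^ 2)"
      using stK by (intro add_right_mono mult_right_mono) auto
    finally show ?thesis by (simp add: field_simps)
  qed
  moreover obtain k :: nat where "ln (penalty_sum (s * t) ^ 2) / (Psi t / 2) < k"
    using reals_Archimedean2 by blast
  then have "ln (penalty_sum (s * t) ^ 2) < Psi t / 2 * Suc k" using assms(2) by (simp add: field_simps)
  ultimately show False by (metis le_add1 not_less plus_1_eq_Suc)
qed

text \<open>
  Following a block with lengths \<open>(m, n)\<close> by one with lengths \<open>(n, m)\<close> makes the two lengths equal.
\<close>

lemma square_mgf_gt_1_exists: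
  assumes "0 < t" "0 < Psi t"
  obtains \<kappa> L where "1 \<le> \<kappa>" "\<kappa> \<le> L" "1 < mgf \<kappa> L L t"
proof -
  obtain \<kappa> m n where *: "1 \<le> \<kappa>" "\<kappa> \<le> m" "\<kappa> \<le> n" "1 < mgf \<kappa> m n t"
    using mgf_gt_1_exists[OF assms] by blast
  have "1 < mgf \<kappa> m n t * mgf \<kappa> n m t"
    using *(4) mgf_sym[OF *(1-3), of t] by (simp add: less_1_mult)
  also have "\<dots> \<le> mgf (\<kappa> + \<kappa>) (m + n) (n + m) t"
    by (rule mgf_supermultiplicative) (use * assms in auto)
  finally have "1 < mgf (\<kappa> + \<kappa>) (m + n) (m + n) t" by (simp add: add.commute)
  then show ?thesis using that[of "\<kappa> + \<kappa>" "m + n"] * by simp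
qed

end

section \<open>Moments of sums over independent letters\<close>

lemma replicate_pmf_Suc_map:
  "replicate_pmf (Suc n) p = map_pmf (\<lambda>(x, xs). x # xs) (pair_pmf p (replicate_pmf n p))"
  by (simp add: pair_pmf_def map_pmf_def bind_assoc_pmf bind_return_pmf)

lemma expect_replicate_Suc:
  assumes "finite (set_pmf p)"
  shows "expect (replicate_pmf (Suc n) p) F = expect p (\<lambda>x. expect (replicate_pmf n p) (\<lambda>xs. F (x # xs)))"
  unfolding replicate_pmf_Suc_map integral_map_pmf
  by (simp add: expect_pair[OF assms finite_set_replicate_pmf[OF assms]])

lemma expect_sum_list:
  assumes "finite (set_pmf p)"
  shows "expect (replicate_pmf n p) (\<lambda>xs. \<Sum>x\<leftarrow>xs. F x) = n * expect p F"
proof (induction n)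
  case (Suc n)
  note fin = assms finite_set_replicate_pmf[OF assms]
  show ?case
    unfolding expect_replicate_Suc[OF assms] using Suc by (simp add: expect_add fin algebra_simps)
qed simp

lemma expect_sum_list_square:
  assumes "finite (set_pmf p)"
  shows "expect (replicate_pmf n p) (\<lambda>xs. (\<Sum>x\<leftarrow>xs. F x)\<^sup>2) =
     n * expect p (\<lambda>x. (F x)\<^sup>2) + n * (real n - 1) * (expect p F)\<^sup>2"
proof (induction n)
  case (Suc n)
  note fin = assms finite_set_replicate_pmf[OF assms, of n]
  let ?S = "\<lambda>xs. \<Sum>x\<leftarrow>xs. F x"
  have "expect (replicate_pmf n p) (\<lambda>xs. (F x + ?S xs)\<^sup>2) =
      (F x)\<^sup>2 + (2 * n * expect p F) * F x + expect (replicate_pmf n p) (\<lambda>xs. (?S xs)\<^sup>2)" for x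
    unfolding power2_sum by (simp add: expect_add fin expect_sum_list[OF assms])
  then have "expect (replicate_pmf (Suc n) p) (\<lambda>xs. (?S xs)\<^sup>2) =
      expect p (\<lambda>x. (F x)\<^sup>2) + (2 * n * expect p F) * expect p F + expect (replicate_pmf n p) (\<lambda>xs. (?S xs)\<^sup>2)"
    unfolding expect_replicate_Suc[OF assms] by (simp add: expect_add fin)
  then show ?case using Suc by (simp add: algebra_simps power2_eq_square)
qed simp

lemma prob_eq_expect: "measure_pmf.prob p A = expect p (\<lambda>x. of_bool (x \<in> A))"
proof -
  have "(\<lambda>x. of_bool (x \<in> A) :: real) = indicator A" by (auto simp: indicator_def)
  then show ?thesis by simp
qed

lemma markov_pmf:
  assumes "finite (set_pmf p)" "\<And>x. x \<in> set_pmf p \<Longrightarrow> 0 \<le> F x" "\<And>x. x \<in> set_pmf p \<Longrightarrow> x \<in> A \<Longrightarrow> c \<le> F x" "0 < c"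
  shows "measure_pmf.prob p A \<le> expect p F / c"
proof -
  have "c * measure_pmf.prob p A = expect p (\<lambda>x. c * of_bool (x \<in> A))" unfolding prob_eq_expect by simp
  also have "\<dots> \<le> expect p F" by (rule expect_mono) (use assms in auto)
  finally show ?thesis using assms(4) by (simp add: field_simps)
qed

lemma weak_law_pmf:
  fixes F :: "'b \<Rightarrow> real" and d :: real
  assumes "finite (set_pmf p)" "0 < d" "1 \<le> n"
  shows "measure_pmf.prob (replicate_pmf n p) {xs. n * d < \<bar>(\<Sum>x\<leftarrow>xs. F x) - n * expect p F\<bar>}
     \<le> expect p (\<lambda>x. (F x)\<^sup>2) / (n * d\<^sup>2)"
proof -
  define m where "m = n * expect p F"
  note fin = finite_set_replicate_pmf[OF assms(1), of n]
  have "measure_pmf.prob (replicate_pmf n p) {xs. n * d < \<bar>(\<Sum>x\<leftarrow>xs. F x) - m\<bar>}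
      \<le> expect (replicate_pmf n p) (\<lambda>xs. ((\<Sum>x\<leftarrow>xs. F x) - m)\<^sup>2) / (n * d)\<^sup>2"
  proof (rule markov_pmf[OF fin])
    fix xs assume "xs \<in> {xs. n * d < \<bar>(\<Sum>x\<leftarrow>xs. F x) - m\<bar>}"
    then have "(n * d)\<^sup>2 \<le> \<bar>(\<Sum>x\<leftarrow>xs. F x) - m\<bar>\<^sup>2"
      using assms by (intro power_mono) auto
    then show "(n * d)\<^sup>2 \<le> ((\<Sum>x\<leftarrow>xs. F x) - m)\<^sup>2" by simp
  qed (use assms in auto)
  also have "expect (replicate_pmf n p) (\<lambda>xs. ((\<Sum>x\<leftarrow>xs. F x) - m)\<^sup>2) =
      expect (replicate_pmf n p) (\<lambda>xs. (\<Sum>x\<leftarrow>xs. F x)\<^sup>2 + ((- 2 * m) * (\<Sum>x\<leftarrow>xs. F x) + m\<^sup>2))"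
    by (rule expect_cong) (simp add: power2_diff)
  also have "\<dots> = n * expect p (\<lambda>x. (F x)\<^sup>2) + n * (real n - 1) * (expect p F)\<^sup>2 - m\<^sup>2"
    by (simp only: expect_add[OF fin] expect_sum_list_square[OF assms(1)])
       (simp add: expect_sum_list[OF assms(1)] m_def power2_eq_square)
  also have "\<dots> \<le> n * expect p (\<lambda>x. (F x)\<^sup>2)"
    unfolding m_def by (simp add: power2_eq_square algebra_simps)
  finally have "measure_pmf.prob (replicate_pmf n p) {xs. n * d < \<bar>(\<Sum>x\<leftarrow>xs. F x) - m\<bar>}
      \<le> n * expect p (\<lambda>x. (F x)\<^sup>2) / (n * d)\<^sup>2"
    by (simp add: divide_right_mono)
  also have "\<dots> = expect p (\<lambda>x. (F x)\<^sup>2) / (n * d\<^sup>2)"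
    using assms by (simp add: power2_eq_square)
  finally show ?thesis unfolding m_def .
qed

lemma weak_law_pmf_eventually:
  fixes F :: "'b \<Rightarrow> real" and d e :: real
  assumes "finite (set_pmf p)" "0 < d" "0 < e"
  shows "\<forall>\<^sub>F n in sequentially. measure_pmf.prob (replicate_pmf n p)
    {xs. n * d < \<bar>(\<Sum>x\<leftarrow>xs. F x) - n * expect p F\<bar>} \<le> e"
proof -
  have "(\<lambda>n. (expect p (\<lambda>x. (F x)\<^sup>2) / d\<^sup>2) / n) \<longlonglongrightarrow> 0" by (rule lim_const_over_n)
  from order_tendstoD(2)[OF this assms(3)]
  show ?thesis using eventually_ge_at_top[of 1]
  proof eventually_elim
    case (elim n)
    then show ?case using weak_law_pmf[OF assms(1,2) elim(2), of F] by (simp add: mult.commute)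
  qed
qed

lemma expect_swap:
  assumes "finite (set_pmf p)" "finite (set_pmf q)"
  shows "expect p (\<lambda>a. expect q (\<lambda>b. F a b)) = expect q (\<lambda>b. expect p (\<lambda>a. F a b))"
proof -
  have *: "expect r h = (\<Sum>x\<in>set_pmf r. pmf r x * h x)" if "finite (set_pmf r)" for r :: "'c pmf" and h
    using integral_measure_pmf[OF that, of r h] by simp
  have **: "expect r h = (\<Sum>x\<in>set_pmf r. pmf r x * h x)" if "finite (set_pmf r)" for r :: "'d pmf" and h
    using integral_measure_pmf[OF that, of r h] by simp
  show ?thesis using assms
    by (simp add: * ** sum_distrib_left sum.swap[of _ "set_pmf p"] mult.left_commute)
qed

text \<open>
  Two families of independent blocks give \<open>N\<^sup>2\<close> pairs, of which those sharing a block are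
  dependent. Their contribution to the variance is governed by the largest conditional matching
  probability \<open>c\<close> given one of the blocks.
\<close>

lemma second_moment_no_match:
  fixes f :: "'b \<Rightarrow> 'b \<Rightarrow> bool" and Q :: "'b pmf"
  assumes fin: "finite (set_pmf Q)" and sym: "\<And>u v. f u v = f v u"
    and c: "\<And>u. u \<in> set_pmf Q \<Longrightarrow> expect Q (\<lambda>v. of_bool (f u v)) \<le> c"
    and p: "p = expect (pair_pmf Q Q) (\<lambda>(u, v). of_bool (f u v))" "0 < p" and N: "1 \<le> N"
  shows "measure_pmf.prob (pair_pmf (replicate_pmf N Q) (replicate_pmf N Q))
      {(us, vs). \<forall>u\<in>set us. \<forall>v\<in>set vs. \<not> f u v} \<le> 1 / (real N ^ 2 * p) + 2 * c / (N * p)"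
proof -
  let ?R = "replicate_pmf N Q"
  note finR = finite_set_replicate_pmf[OF fin, of N]
  define \<phi> where "\<phi> u v = (of_bool (f u v) :: real)" for u v
  define q where "q u = expect Q (\<phi> u)" for u
  have \<phi>_sym: "\<phi> u v = \<phi> v u" for u v unfolding \<phi>_def using sym by simp
  have \<phi>_sq: "(\<phi> u v)\<^sup>2 = \<phi> u v" for u v unfolding \<phi>_def by simp
  have q': "expect Q (\<lambda>u. \<phi> u v) = q v" for v unfolding q_def \<phi>_sym[of _ v] ..
  have pq: "expect Q q = p" unfolding q_def p(1) expect_pair[OF fin fin] \<phi>_def by simp
  define T where "T us vs = (\<Sum>v\<leftarrow>vs. \<Sum>u\<leftarrow>us. \<phi> u v)" for us vs
  define m where "m = real N ^ 2 * p"
  have m: "0 < m" unfolding m_def using p N by simp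
  have q2: "expect Q (\<lambda>u. (q u)\<^sup>2) \<le> c * p"
  proof -
    have "expect Q (\<lambda>u. (q u)\<^sup>2) \<le> expect Q (\<lambda>u. c * q u)"
    proof (rule expect_mono[OF fin])
      fix u assume u: "u \<in> set_pmf Q"
      have "0 \<le> q u" unfolding q_def \<phi>_def by (rule integral_nonneg_AE) simp
      then show "(q u)\<^sup>2 \<le> c * q u"
        using c[OF u] unfolding power2_eq_square q_def \<phi>_def by (intro mult_right_mono) auto
    qed
    then show ?thesis using pq by simp
  qed
  have inner: "expect Q (\<lambda>v. \<Sum>u\<leftarrow>us. \<phi> u v) = (\<Sum>u\<leftarrow>us. q u)" for us
    by (induction us) (simp_all add: expect_add[OF fin] q_def)
  have ET: "expect ?R (\<lambda>us. expect ?R (\<lambda>vs. T us vs)) = m"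
    unfolding T_def expect_sum_list[OF fin] inner
    by (simp add: expect_sum_list[OF fin] pq m_def power2_eq_square)
  have ET2: "expect ?R (\<lambda>us. expect ?R (\<lambda>vs. (T us vs)\<^sup>2)) \<le> m + 2 * c * p * real N ^ 3 + m\<^sup>2"
  proof -
    define A where "A = expect Q (\<lambda>u. (q u)\<^sup>2)"
    have "expect ?R (\<lambda>us. expect ?R (\<lambda>vs. (T us vs)\<^sup>2)) =
       expect ?R (\<lambda>us. N * expect Q (\<lambda>v. (\<Sum>u\<leftarrow>us. \<phi> u v)\<^sup>2) + N * (real N - 1) * (\<Sum>u\<leftarrow>us. q u)\<^sup>2)"
      unfolding T_def expect_sum_list_square[OF fin] inner ..
    also have "\<dots> = N * expect ?R (\<lambda>us. expect Q (\<lambda>v. (\<Sum>u\<leftarrow>us. \<phi> u v)\<^sup>2)) +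
       N * (real N - 1) * expect ?R (\<lambda>us. (\<Sum>u\<leftarrow>us. q u)\<^sup>2)"
      by (simp add: expect_add[OF finR])
    also have "expect ?R (\<lambda>us. expect Q (\<lambda>v. (\<Sum>u\<leftarrow>us. \<phi> u v)\<^sup>2)) =
       expect Q (\<lambda>v. N * q v + N * (real N - 1) * (q v)\<^sup>2)"
      unfolding expect_swap[OF finR fin] expect_sum_list_square[OF fin] \<phi>_sq q' ..
    also have "\<dots> = N * p + N * (real N - 1) * A"
      by (simp add: expect_add[OF fin] pq A_def)
    also have "expect ?R (\<lambda>us. (\<Sum>u\<leftarrow>us. q u)\<^sup>2) = N * A + N * (real N - 1) * p\<^sup>2"
      unfolding expect_sum_list_square[OF fin] pq A_def ..
    finally have E: "expect ?R (\<lambda>us. expect ?R (\<lambda>vs. (T us vs)\<^sup>2)) =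
       real N ^ 2 * p + 2 * real N ^ 2 * (real N - 1) * A + (real N * (real N - 1) * p)\<^sup>2"
      by (simp add: power2_eq_square algebra_simps)
    have A0: "0 \<le> A" unfolding A_def by (rule integral_nonneg_AE) simp
    have "2 * real N ^ 2 * (real N - 1) * A \<le> 2 * real N ^ 2 * real N * (c * p)"
      using q2 A0 N unfolding A_def by (intro mult_mono) auto
    moreover have "(real N * (real N - 1) * p)\<^sup>2 \<le> (real N * real N * p)\<^sup>2"
      using N p by (intro power_mono mult_mono) auto
    ultimately show ?thesis unfolding E m_def by (simp add: power2_eq_square power3_eq_cube algebra_simps)
  qed
  have "measure_pmf.prob (pair_pmf ?R ?R) {(us, vs). \<forall>u\<in>set us. \<forall>v\<in>set vs. \<not> f u v}
      \<le> expect (pair_pmf ?R ?R) (\<lambda>(us, vs). (T us vs - m)\<^sup>2) / m\<^sup>2"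
  proof (rule markov_pmf)
    fix w assume "w \<in> {(us, vs). \<forall>u\<in>set us. \<forall>v\<in>set vs. \<not> f u v}"
    then obtain us vs where w: "w = (us, vs)" "\<forall>u\<in>set us. \<forall>v\<in>set vs. \<not> f u v" by auto
    have "T us vs = (\<Sum>v\<leftarrow>vs. \<Sum>u\<leftarrow>us. 0)"
      unfolding T_def by (intro arg_cong[where f = sum_list] map_cong refl) (use w(2) in \<open>auto simp: \<phi>_def\<close>)
    then have "T us vs = 0" by simp
    then show "m\<^sup>2 \<le> (\<lambda>(us, vs). (T us vs - m)\<^sup>2) w" using w(1) by simp
  qed (use finR m in auto)
  also have "expect (pair_pmf ?R ?R) (\<lambda>(us, vs). (T us vs - m)\<^sup>2) =
      expect ?R (\<lambda>us. expect ?R (\<lambda>vs. (T us vs)\<^sup>2 + ((- 2 * m) * T us vs + m\<^sup>2)))"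
    unfolding expect_pair[OF finR finR] by (simp add: power2_diff algebra_simps)
  also have "\<dots> = expect ?R (\<lambda>us. expect ?R (\<lambda>vs. (T us vs)\<^sup>2) + ((- 2 * m) * expect ?R (\<lambda>vs. T us vs) + m\<^sup>2))"
    by (simp only: expect_add[OF finR]) simp
  also have "\<dots> = expect ?R (\<lambda>us. expect ?R (\<lambda>vs. (T us vs)\<^sup>2)) + (- 2 * m) * m + m\<^sup>2"
    by (simp only: expect_add[OF finR]) (simp add: ET)
  also have "\<dots> \<le> m + 2 * c * p * real N ^ 3"
    using ET2 by (simp add: power2_eq_square)
  finally have "measure_pmf.prob (pair_pmf ?R ?R) {(us, vs). \<forall>u\<in>set us. \<forall>v\<in>set vs. \<not> f u v}
      \<le> (m + 2 * c * p * real N ^ 3) / m\<^sup>2" by (simp add: divide_right_mono)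
  also have "\<dots> = 1 / (real N ^ 2 * p) + 2 * c / (N * p)"
    using p(2) N unfolding m_def by (simp add: field_simps power2_eq_square power3_eq_cube)
  finally show ?thesis .
qed

section \<open>Exponential tilting\<close>

text \<open>
  The law with density \<open>w\<close> relative to \<open>p\<close>, for nonnegative \<open>w\<close> of mean \<open>1\<close>.
\<close>

definition tilt :: "'b pmf \<Rightarrow> ('b \<Rightarrow> real) \<Rightarrow> 'b pmf" where
  "tilt p w = embed_pmf (\<lambda>x. pmf p x * w x)"

lemma tilt:
  assumes "finite (set_pmf p)" "\<And>x. 0 \<le> w x" "expect p w = 1"
  shows "pmf (tilt p w) x = pmf p x * w x"
    and "finite (set_pmf (tilt p w))"
    and "expect (tilt p w) F = expect p (\<lambda>x. w x * F x)"
proof -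
  have "(\<integral>\<^sup>+ x. ennreal (pmf p x * w x) \<partial>count_space UNIV) = (\<integral>\<^sup>+ x. ennreal (w x) \<partial>measure_pmf p)"
    unfolding nn_integral_measure_pmf using assms(2) by (simp add: ennreal_mult)
  also have "\<dots> = ennreal (expect p w)"
    by (rule nn_integral_eq_integral) (use assms in \<open>auto intro: integrable_measure_pmf_finite\<close>)
  finally have "(\<integral>\<^sup>+ x. ennreal (pmf p x * w x) \<partial>count_space UNIV) = 1" using assms(3) by simp
  then show pmf: "pmf (tilt p w) x = pmf p x * w x" for x
    unfolding tilt_def by (intro pmf_embed_pmf) (use assms in auto)
  have sub: "set_pmf (tilt p w) \<subseteq> set_pmf p" by (auto simp: set_pmf_iff pmf)
  then show "finite (set_pmf (tilt p w))" using assms(1) finite_subset by blast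
  have "expect (tilt p w) F = (\<Sum>x\<in>set_pmf p. pmf (tilt p w) x *\<^sub>R F x)"
    by (rule integral_measure_pmf) (use assms sub in auto)
  also have "\<dots> = (\<Sum>x\<in>set_pmf p. pmf p x *\<^sub>R (w x * F x))" unfolding pmf by (simp add: mult.assoc)
  also have "\<dots> = expect p (\<lambda>x. w x * F x)"
    by (rule integral_measure_pmf[symmetric]) (use assms in auto)
  finally show "expect (tilt p w) F = expect p (\<lambda>x. w x * F x)" .
qed

lemma expect_replicate_tilt:
  assumes "finite (set_pmf p)" "\<And>x. 0 \<le> w x" "expect p w = 1"
  shows "expect (replicate_pmf n (tilt p w)) F = expect (replicate_pmf n p) (\<lambda>xs. (\<Prod>x\<leftarrow>xs. w x) * F xs)"
proof (induction n arbitrary: F)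
  case (Suc n)
  show ?case
    unfolding expect_replicate_Suc[OF tilt(2)[OF assms]] expect_replicate_Suc[OF assms(1)] Suc tilt(3)[OF assms]
    by (simp add: mult.assoc)
qed simp

lemma expect_zip:
  fixes p :: "'b pmf" and q :: "'c pmf"
  assumes "finite (set_pmf p)" "finite (set_pmf q)"
  shows "expect (pair_pmf (replicate_pmf n p) (replicate_pmf n q)) (\<lambda>(us, vs). F (zip us vs)) =
     expect (replicate_pmf n (pair_pmf p q)) F"
proof (induction n arbitrary: F)
  case (Suc n)
  note fins = finite_set_replicate_pmf[OF assms(1)] finite_set_replicate_pmf[OF assms(2)]
  have fp: "finite (set_pmf (pair_pmf p q))" using assms by simp
  have "expect (replicate_pmf (Suc n) (pair_pmf p q)) F =
     expect (pair_pmf p q) (\<lambda>x. expect (replicate_pmf n (pair_pmf p q)) (\<lambda>xs. F (x # xs)))"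
    by (rule expect_replicate_Suc[OF fp])
  also have "\<dots> = expect p (\<lambda>u. expect q (\<lambda>v. expect (replicate_pmf n p) (\<lambda>us. expect (replicate_pmf n q) (\<lambda>vs. F ((u, v) # zip us vs)))))"
    unfolding Suc[symmetric] expect_pair[OF fins] expect_pair[OF assms] by simp
  also have "\<dots> = expect p (\<lambda>u. expect (replicate_pmf n p) (\<lambda>us. expect q (\<lambda>v. expect (replicate_pmf n q) (\<lambda>vs. F ((u, v) # zip us vs)))))"
    by (subst expect_swap[OF assms(2) fins(1)]) simp
  also have "\<dots> = expect (pair_pmf (replicate_pmf (Suc n) p) (replicate_pmf (Suc n) q)) (\<lambda>(us, vs). F (zip us vs))"
    unfolding expect_pair[OF fins] expect_replicate_Suc[OF assms(1)] expect_replicate_Suc[OF assms(2)] by simp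
  finally show ?case ..
qed simp

lemma expect_prod_zip:
  fixes q :: "'c pmf"
  assumes "finite (set_pmf q)"
  shows "expect (replicate_pmf (length us) q) (\<lambda>vs. \<Prod>z\<leftarrow>zip us vs. w z) = (\<Prod>u\<leftarrow>us. expect q (\<lambda>v. w (u, v)))"
  by (induction us) (simp_all add: expect_replicate_Suc[OF assms] del: replicate_pmf.simps(2))

lemma prod_list_exp: "(\<Prod>x\<leftarrow>xs. exp (F x :: real)) = exp (\<Sum>x\<leftarrow>xs. F x)"
  by (induction xs) (auto simp: exp_add)

abbreviation block_pairs :: "nat \<Rightarrow> nat \<Rightarrow> 'b pmf \<Rightarrow> ('b list list \<times> 'b list list) pmf" where
  "block_pairs N l p \<equiv> pair_pmf (replicate_pmf N (replicate_pmf l p)) (replicate_pmf N (replicate_pmf l p))"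

text \<open>
  Tilt the law \<open>\<nu> \<times> \<nu>\<close> of a pair by \<open>exp (t G)\<close>. Let \<open>\<gamma>\<close> be the mean score under the tilted law \<open>\<alpha>\<close>
  and \<open>h\<close> its relative entropy with respect to \<open>\<nu> \<times> \<nu>\<close>. The normalising constant exceeds \<open>1\<close>, hence
  \<open>h \<le> t \<gamma>\<close>. Because \<open>G\<close> is symmetric, the two marginals of \<open>\<alpha>\<close> agree, and since relative entropy with
  respect to a product is at least the sum of those of the marginals, each has relative entropy at most
  \<open>h / 2\<close>. Two independent blocks of length \<open>l\<close> form a pair that is typical for \<open>\<alpha>\<close> with probability
  about \<open>exp (- l h)\<close>, but given one of the blocks this probability is at most about the square root
  \<open>exp (- l h / 2)\<close>. That is just what the second moment bound can afford: \<open>N\<close> blocks on each side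
  contain a typical pair as soon as \<open>l t \<gamma>\<close> is below \<open>2 ln N\<close>.
\<close>

lemma block_matching:
  fixes \<nu> :: "'w pmf" and G :: "'w \<Rightarrow> 'w \<Rightarrow> real" and t :: real
  assumes fin: "finite (set_pmf \<nu>)" and sym: "\<And>u v. G u v = G v u" and t: "0 < t"
    and Z: "1 < expect (pair_pmf \<nu> \<nu>) (\<lambda>(u, v). exp (t * G u v))"
  obtains \<gamma> :: real where "0 < \<gamma>"
    "\<And>d :: real. 0 < d \<Longrightarrow> \<forall>\<^sub>F l in sequentially. \<forall>N\<ge>1.
      measure_pmf.prob (block_pairs N l \<nu>)
        {(Us, Vs). \<forall>U\<in>set Us. \<forall>V\<in>set Vs. (\<Sum>z\<leftarrow>zip U V. G (fst z) (snd z)) < l * (\<gamma> - d)}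
      \<le> 2 * exp (l * (t * (\<gamma> + d))) / real N ^ 2 + 4 * exp (l * (t * \<gamma> / 2 + d * (1 + 2 * t))) / N"
proof -
  let ?\<nu>\<nu> = "pair_pmf \<nu> \<nu>"
  have fin2: "finite (set_pmf ?\<nu>\<nu>)" using fin by simp
  define Z0 where "Z0 = expect ?\<nu>\<nu> (\<lambda>(u, v). exp (t * G u v))"
  have Z0: "1 < Z0" using Z unfolding Z0_def .
  define w where "w z = exp (t * G (fst z) (snd z)) / Z0" for z
  have wpos: "0 < w z" for z unfolding w_def using Z0 by simp
  have wnn: "0 \<le> w z" for z using wpos less_imp_le by blast
  have wsym: "w (u, v) = w (v, u)" for u v unfolding w_def using sym by simp
  have w1: "expect ?\<nu>\<nu> w = 1"
    using Z0 unfolding w_def Z0_def by (simp add: case_prod_unfold)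
  have lnw: "ln (w z) = t * G (fst z) (snd z) - ln Z0" for z
    unfolding w_def using Z0 by (simp add: ln_div)
  define \<alpha> where "\<alpha> = tilt ?\<nu>\<nu> w"
  have fin\<alpha>: "finite (set_pmf \<alpha>)" and E\<alpha>: "expect \<alpha> F = expect ?\<nu>\<nu> (\<lambda>z. w z * F z)" for F
    using tilt(2,3)[OF fin2 wnn w1] unfolding \<alpha>_def by auto
  define \<gamma> where "\<gamma> = expect \<alpha> (\<lambda>z. G (fst z) (snd z))"
  \<comment> \<open>The density of the marginal of \<open>\<alpha>\<close> relative to \<open>\<nu>\<close>.\<close>
  define \<rho> where "\<rho> u = expect \<nu> (\<lambda>v. w (u, v))" for u
  have \<rho>pos: "0 < \<rho> u" for u unfolding \<rho>_def by (rule expect_pos[OF fin]) (rule wpos)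
  have E\<rho>: "expect \<nu> \<rho> = 1" using w1 unfolding \<rho>_def expect_pair[OF fin fin] .
  define H where "H = expect \<alpha> (\<lambda>z. ln (\<rho> (fst z)))"
  have H': "expect \<alpha> (\<lambda>z. ln (\<rho> (snd z))) = H"
    unfolding H_def E\<alpha> expect_pair[OF fin fin] by (subst expect_swap[OF fin fin]) (simp add: wsym)
  have Elnw: "expect \<alpha> (\<lambda>z. ln (w z)) = t * \<gamma> - ln Z0"
    unfolding lnw \<gamma>_def using expect_add[OF fin\<alpha>, of "\<lambda>z. t * G (fst z) (snd z)" "\<lambda>_. - ln Z0"] by simp
  \<comment> \<open>Nonnegativity of relative entropy, from \<open>ln y \<le> y - 1\<close>.\<close>
  have "expect ?\<nu>\<nu> (\<lambda>z. w z * - ln (w z)) \<le> expect ?\<nu>\<nu> (\<lambda>z. 1 + - w z)"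
  proof (rule expect_mono[OF fin2])
    fix z
    have "- ln (w z) \<le> 1 / w z - 1"
      using ln_le_minus_one[of "1 / w z"] wpos[of z] by (simp add: ln_div)
    then have "w z * - ln (w z) \<le> w z * (1 / w z - 1)" by (rule mult_left_mono) (rule wnn)
    then show "w z * - ln (w z) \<le> 1 + - w z" using wpos[of z] by (simp add: algebra_simps)
  qed
  also have "\<dots> = 0" unfolding expect_add[OF fin2] using w1 by simp
  finally have entropy: "ln Z0 \<le> t * \<gamma>" using Elnw unfolding E\<alpha> by simp
  have \<gamma>: "0 < \<gamma>" using entropy Z0 t by (smt (verit) ln_gt_zero zero_less_mult_pos)
  \<comment> \<open>The same inequality for \<open>\<alpha>\<close> and the product of its marginals: superadditivity of relative entropy.\<close>
  have "expect ?\<nu>\<nu> (\<lambda>z. w z * (ln (\<rho> (fst z)) + (ln (\<rho> (snd z)) + - ln (w z)))) \<le> expect ?\<nu>\<nu> (\<lambda>z. \<rho> (fst z) * \<rho> (snd z) + - w z)"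
  proof (rule expect_mono[OF fin2])
    fix z
    define y where "y = \<rho> (fst z) * \<rho> (snd z) / w z"
    have y: "0 < y" unfolding y_def using \<rho>pos wpos by simp
    have "ln (\<rho> (fst z)) + (ln (\<rho> (snd z)) + - ln (w z)) = ln y"
      unfolding y_def using \<rho>pos[of "fst z"] \<rho>pos[of "snd z"] wpos[of z] by (simp add: ln_div ln_mult_pos)
    also have "\<dots> \<le> y - 1" by (rule ln_le_minus_one[OF y])
    finally have "w z * (ln (\<rho> (fst z)) + (ln (\<rho> (snd z)) + - ln (w z))) \<le> w z * (y - 1)"
      by (rule mult_left_mono) (rule wnn)
    then show "w z * (ln (\<rho> (fst z)) + (ln (\<rho> (snd z)) + - ln (w z))) \<le> \<rho> (fst z) * \<rho> (snd z) + - w z"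
      using wpos[of z] unfolding y_def by (simp add: algebra_simps)
  qed
  also have "\<dots> = 0"
  proof -
    have "expect ?\<nu>\<nu> (\<lambda>z. \<rho> (fst z) * \<rho> (snd z)) = 1"
      unfolding expect_pair[OF fin fin] by (simp add: E\<rho>)
    then show ?thesis unfolding expect_add[OF fin2] using w1 by simp
  qed
  finally have "expect \<alpha> (\<lambda>z. ln (\<rho> (fst z)) + (ln (\<rho> (snd z)) + - ln (w z))) \<le> 0" unfolding E\<alpha> .
  then have "H + (H - (t * \<gamma> - ln Z0)) \<le> 0"
    unfolding expect_add[OF fin\<alpha>] using H' Elnw unfolding H_def by simp
  moreover have "0 < ln Z0" using Z0 by simp
  ultimately have H: "H \<le> t * \<gamma> / 2" by linarith
  show ?thesis
  proof (rule that[OF \<gamma>])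
    fix d :: real assume d: "0 < d"
    define S where "S zs = (\<Sum>z\<leftarrow>zs. G (fst z) (snd z))" for zs
    \<comment> \<open>Typical pairs of blocks: the score is within \<open>l d\<close> of its mean under \<open>\<alpha>\<close>, and both marginal log-densities exceed theirs by at most \<open>l d\<close>.\<close>
    define B where "B l zs \<longleftrightarrow> \<bar>S zs - l * \<gamma>\<bar> \<le> l * d \<and> (\<Sum>z\<leftarrow>zs. ln (\<rho> (fst z))) \<le> l * (H + d)
        \<and> (\<Sum>z\<leftarrow>zs. ln (\<rho> (snd z))) \<le> l * (H + d)" for l :: nat and zs
    have B_bounds: "l * (\<gamma> - d) \<le> S zs \<and> S zs \<le> l * (\<gamma> + d)" if "B l zs" for l zs
      using that unfolding B_def by (auto simp: abs_le_iff algebra_simps)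
    have sixth: "0 < (1 / 6 :: real)" by simp
    have "\<forall>\<^sub>F l in sequentially. 1 / 2 \<le> measure_pmf.prob (replicate_pmf l \<alpha>) {zs. B l zs}"
      using weak_law_pmf_eventually[OF fin\<alpha> d sixth, of "\<lambda>z. G (fst z) (snd z)"]
        weak_law_pmf_eventually[OF fin\<alpha> d sixth, of "\<lambda>z. ln (\<rho> (fst z))"]
        weak_law_pmf_eventually[OF fin\<alpha> d sixth, of "\<lambda>z. ln (\<rho> (snd z))"]
    proof eventually_elim
      case (elim l)
      let ?P = "measure_pmf.prob (replicate_pmf l \<alpha>)"
      let ?A1 = "{zs. l * d < \<bar>S zs - l * \<gamma>\<bar>}"
      let ?A2 = "{zs. l * d < \<bar>(\<Sum>z\<leftarrow>zs. ln (\<rho> (fst z))) - l * H\<bar>}"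
      let ?A3 = "{zs. l * d < \<bar>(\<Sum>z\<leftarrow>zs. ln (\<rho> (snd z))) - l * H\<bar>}"
      have "- {zs. B l zs} \<subseteq> ?A1 \<union> (?A2 \<union> ?A3)"
        unfolding B_def by (auto simp: distrib_left)
      then have "?P (- {zs. B l zs}) \<le> ?P (?A1 \<union> (?A2 \<union> ?A3))"
        by (intro measure_pmf.finite_measure_mono) auto
      also have "\<dots> \<le> ?P ?A1 + ?P (?A2 \<union> ?A3)" by (rule measure_subadditive) auto
      also have "?P (?A2 \<union> ?A3) \<le> ?P ?A2 + ?P ?A3" by (rule measure_subadditive) auto
      finally have "?P (- {zs. B l zs}) \<le> 1 / 2"
        using elim H' unfolding S_def \<gamma>_def[symmetric] H_def[symmetric] by simp
      then show ?case using measure_pmf.prob_compl[of "{zs. B l zs}" "replicate_pmf l \<alpha>"]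
        by (simp add: Compl_eq_Diff_UNIV)
    qed
    then show "\<forall>\<^sub>F l in sequentially. \<forall>N\<ge>1.
      measure_pmf.prob (block_pairs N l \<nu>)
        {(Us, Vs). \<forall>U\<in>set Us. \<forall>V\<in>set Vs. (\<Sum>z\<leftarrow>zip U V. G (fst z) (snd z)) < l * (\<gamma> - d)}
      \<le> 2 * exp (l * (t * (\<gamma> + d))) / real N ^ 2 + 4 * exp (l * (t * \<gamma> / 2 + d * (1 + 2 * t))) / N"
    proof eventually_elim
      case (elim l)
      let ?Q = "replicate_pmf l \<nu>"
      note finQ = finite_set_replicate_pmf[OF fin, of l]
      define f where "f U V \<longleftrightarrow> B l (zip U V)" for U V
      have f_sym: "f U V = f V U" for U V
      proof -
        have z: "zip V U = map prod.swap (zip U V)"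
          by (subst zip_commute) (simp add: case_prod_unfold prod.swap_def)
        show ?thesis unfolding f_def B_def S_def z by (auto simp: o_def sym)
      qed
      have weight: "(\<Prod>z\<leftarrow>zs. w z) = exp (t * S zs - l * ln Z0)" if "length zs = l" for zs
      proof -
        have "(\<Prod>z\<leftarrow>zs. w z) = (\<Prod>z\<leftarrow>zs. exp (ln (w z)))" using wpos by simp
        also have "(\<Sum>z\<leftarrow>zs. ln (w z)) = t * S zs - l * ln Z0"
          unfolding lnw S_def that[symmetric] by (induction zs) (simp_all add: algebra_simps)
        ultimately show ?thesis unfolding prod_list_exp by simp
      qed
      \<comment> \<open>On typical pairs the density of \<open>\<alpha>\<close> lies between \<open>1 / b\<close> and \<open>1 / a\<close>, which transfers probabilities under \<open>\<alpha>\<close> to probabilities under \<open>\<nu> \<times> \<nu>\<close>.\<close>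
      define p where "p = expect (pair_pmf ?Q ?Q) (\<lambda>(U, V). of_bool (f U V))"
      define a where "a = exp (l * ln Z0 - t * (l * (\<gamma> + d)))"
      define b where "b = exp (l * ln Z0 - t * (l * (\<gamma> - d)))"
      define c where "c = b * exp (l * (H + d))"
      have "a * (1 / 2) \<le> a * expect (replicate_pmf l \<alpha>) (\<lambda>zs. of_bool (B l zs))"
        using elim unfolding prob_eq_expect a_def by (intro mult_left_mono) auto
      also have "\<dots> = expect (replicate_pmf l ?\<nu>\<nu>) (\<lambda>zs. (\<Prod>z\<leftarrow>zs. w z) * (a * of_bool (B l zs)))"
        unfolding \<alpha>_def expect_replicate_tilt[OF fin2 wnn w1, symmetric] by simp
      also have "\<dots> \<le> expect (replicate_pmf l ?\<nu>\<nu>) (\<lambda>zs. of_bool (B l zs))"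
      proof (rule expect_mono[OF finite_set_replicate_pmf[OF fin2]])
        fix zs assume "zs \<in> set_pmf (replicate_pmf l ?\<nu>\<nu>)"
        then have l: "length zs = l" by (rule length_replicate_pmf)
        show "(\<Prod>z\<leftarrow>zs. w z) * (a * of_bool (B l zs)) \<le> of_bool (B l zs)"
        proof (cases "B l zs")
          case True
          then have "S zs \<le> l * (\<gamma> + d)" using B_bounds by blast
          then have "t * S zs \<le> t * (l * (\<gamma> + d))" using t by (intro mult_left_mono) auto
          then show ?thesis using True unfolding weight[OF l] a_def by (simp add: exp_add[symmetric])
        qed simp
      qed
      also have "\<dots> = p" unfolding p_def f_def by (rule expect_zip[OF fin fin, symmetric])
      finally have pa: "a / 2 \<le> p" by simp
      have a0: "0 < a" and c0: "0 < c" unfolding a_def c_def b_def by auto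
      have p0: "0 < p" using pa a0 by simp
      have q: "expect ?Q (\<lambda>V. of_bool (f U V)) \<le> c" if U: "U \<in> set_pmf ?Q" for U
      proof -
        have lU: "length U = l" using U by (rule length_replicate_pmf)
        show ?thesis
        proof (cases "(\<Sum>u\<leftarrow>U. ln (\<rho> u)) \<le> l * (H + d)")
          case True
          have "expect ?Q (\<lambda>V. of_bool (f U V)) \<le> expect ?Q (\<lambda>V. b * (\<Prod>z\<leftarrow>zip U V. w z))"
          proof (rule expect_mono[OF finQ])
            fix V assume "V \<in> set_pmf ?Q"
            then have lz: "length (zip U V) = l" using lU length_replicate_pmf by force
            show "of_bool (f U V) \<le> b * (\<Prod>z\<leftarrow>zip U V. w z)"
            proof (cases "f U V")
              case True
              then have "l * (\<gamma> - d) \<le> S (zip U V)" unfolding f_def using B_bounds by blast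
              then have "t * (l * (\<gamma> - d)) \<le> t * S (zip U V)" using t by (intro mult_left_mono) auto
              then show ?thesis using True unfolding weight[OF lz] b_def by (simp add: exp_add[symmetric])
            next
              case False
              then show ?thesis unfolding weight[OF lz] b_def by simp
            qed
          qed
          also have "\<dots> = b * expect (replicate_pmf (length U) \<nu>) (\<lambda>V. \<Prod>z\<leftarrow>zip U V. w z)"
            using lU by simp
          also have "\<dots> = b * (\<Prod>u\<leftarrow>U. exp (ln (\<rho> u)))"
            unfolding expect_prod_zip[OF fin] using \<rho>pos by (simp add: \<rho>_def)
          also have "\<dots> \<le> c"
            unfolding prod_list_exp c_def b_def using True by (intro mult_left_mono) auto
          finally show ?thesis .
        next
          case False
          have "expect ?Q (\<lambda>V. of_bool (f U V)) = expect ?Q (\<lambda>V. 0)"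
          proof (rule expect_cong)
            fix V assume "V \<in> set_pmf ?Q"
            then have "length V = length U" using lU length_replicate_pmf by force
            then have fst: "map fst (zip U V) = U" by simp
            have "(\<Sum>z\<leftarrow>zip U V. ln (\<rho> (fst z))) = (\<Sum>u\<leftarrow>map fst (zip U V). ln (\<rho> u))"
              by (simp only: map_map o_def)
            then have "(\<Sum>z\<leftarrow>zip U V. ln (\<rho> (fst z))) = (\<Sum>u\<leftarrow>U. ln (\<rho> u))" unfolding fst .
            then show "of_bool (f U V) = (0 :: real)" using False unfolding f_def B_def by simp
          qed
          then show ?thesis using c0 by simp
        qed
      qed
      show ?case
      proof (intro allI impI)
        fix N :: nat assume N: "1 \<le> N"
        let ?PN = "pair_pmf (replicate_pmf N ?Q) (replicate_pmf N ?Q)"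
        have "measure_pmf.prob ?PN {(Us, Vs). \<forall>U\<in>set Us. \<forall>V\<in>set Vs. S (zip U V) < l * (\<gamma> - d)}
            \<le> measure_pmf.prob ?PN {(Us, Vs). \<forall>U\<in>set Us. \<forall>V\<in>set Vs. \<not> f U V}"
        proof (rule measure_pmf.finite_measure_mono)
          have "l * (\<gamma> - d) \<le> S (zip U V)" if "f U V" for U V
            using that B_bounds unfolding f_def by blast
          then show "{(Us, Vs). \<forall>U\<in>set Us. \<forall>V\<in>set Vs. S (zip U V) < l * (\<gamma> - d)}
             \<subseteq> {(Us, Vs). \<forall>U\<in>set Us. \<forall>V\<in>set Vs. \<not> f U V}" by (fastforce simp: not_less)
        qed simp
        also have "\<dots> \<le> 1 / (real N ^ 2 * p) + 2 * c / (N * p)"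
          by (rule second_moment_no_match[OF finQ f_sym q p_def p0 N])
        also have "\<dots> \<le> 1 / (real N ^ 2 * (a / 2)) + 2 * c / (N * (a / 2))"
          using pa a0 c0 p0 N by (intro add_mono divide_left_mono mult_left_mono mult_pos_pos) auto
        also have "\<dots> = 2 * (1 / a) / real N ^ 2 + 4 * (c / a) / N" by (simp add: mult.commute)
        also have "\<dots> \<le> 2 * exp (l * (t * (\<gamma> + d))) / real N ^ 2 + 4 * exp (l * (t * \<gamma> / 2 + d * (1 + 2 * t))) / N"
        proof (intro add_mono divide_right_mono mult_left_mono)
          have "1 / a = exp (t * (l * (\<gamma> + d)) - l * ln Z0)"
            unfolding a_def by (simp add: exp_diff)
          also have "\<dots> \<le> exp (l * (t * (\<gamma> + d)))" using \<open>0 < ln Z0\<close> by (simp add: algebra_simps)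
          finally show "1 / a \<le> exp (l * (t * (\<gamma> + d)))" .
          have "c / a = exp (l * (H + d + 2 * t * d))"
            unfolding c_def b_def a_def exp_add[symmetric] exp_diff[symmetric] by (simp add: algebra_simps)
          also have "\<dots> \<le> exp (l * (t * \<gamma> / 2 + d * (1 + 2 * t)))"
          proof -
            have "H + d + 2 * t * d \<le> t * \<gamma> / 2 + d * (1 + 2 * t)" using H by (simp add: algebra_simps)
            then show ?thesis by (simp add: mult_left_mono)
          qed
          finally show "c / a \<le> exp (l * (t * \<gamma> / 2 + d * (1 + 2 * t)))" .
        qed auto
        finally show "measure_pmf.prob ?PN
            {(Us, Vs). \<forall>U\<in>set Us. \<forall>V\<in>set Vs. (\<Sum>z\<leftarrow>zip U V. G (fst z) (snd z)) < l * (\<gamma> - d)}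
          \<le> 2 * exp (l * (t * (\<gamma> + d))) / real N ^ 2 + 4 * exp (l * (t * \<gamma> / 2 + d * (1 + 2 * t))) / N"
          unfolding S_def .
      qed
    qed
  qed
qed

section \<open>Blocks of words\<close>

lemma replicate_pmf_concat:
  "map_pmf concat (replicate_pmf N (replicate_pmf m p)) = replicate_pmf (N * m) p"
proof (induction N)
  case (Suc N)
  have "map_pmf concat (replicate_pmf (Suc N) (replicate_pmf m p)) =
     bind_pmf (replicate_pmf m p) (\<lambda>xs. bind_pmf (map_pmf concat (replicate_pmf N (replicate_pmf m p))) (\<lambda>ys. return_pmf (xs @ ys)))"
    by (simp add: map_pmf_def bind_assoc_pmf bind_return_pmf)
  then show ?case unfolding Suc by (simp add: replicate_pmf_distrib)
qed simp

lemma take_drop_concat: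
  assumes "\<And>w. w \<in> set ws \<Longrightarrow> length w = m" "i < length ws"
  shows "take m (drop (i * m) (concat ws)) = ws ! i"
  using assms
proof (induction ws arbitrary: i)
  case (Cons w ws)
  have w: "length w = m" using Cons.prems by simp
  show ?case
  proof (cases i)
    case (Suc j)
    then show ?thesis using Cons w by simp
  qed (use w in simp)
qed simp

lemma length_concat_blocks: "(\<And>w. w \<in> set ws \<Longrightarrow> length w = m) \<Longrightarrow> length (concat ws) = length ws * m"
  by (induction ws) auto

context scoring_model
begin

lemma Gwords_segment:
  assumes "a + m \<le> length xs" "b + n \<le> length ys"
  shows "Gwords \<kappa> (take m (drop a xs)) (take n (drop b ys)) =
    Gmax K g \<kappa> (\<lambda>i. letter xs (a + i)) (\<lambda>j. letter ys (b + j)) m n"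
proof -
  have "length (take m (drop a xs)) = m" "length (take n (drop b ys)) = n" using assms by auto
  moreover have "Gmax K g \<kappa> (letter (take m (drop a xs))) (letter (take n (drop b ys))) m n =
     Gmax K g \<kappa> (\<lambda>i. letter xs (a + i)) (\<lambda>j. letter ys (b + j)) m n"
    by (rule Gmax_cong) (use assms in \<open>auto simp: letter_take letter_drop\<close>)
  ultimately show ?thesis unfolding Gwords_def by simp
qed

lemma segment_alignment:
  assumes "1 \<le> \<kappa>" "\<kappa> \<le> m" "\<kappa> \<le> n" "a + m \<le> length xs" "b + n \<le> length ys"
  obtains z where "z \<in> alignments" "fits (length xs) (length ys) z"
    "Gwords \<kappa> (take m (drop a xs)) (take n (drop b ys)) \<le> raw_score K g (letter xs) (letter ys) z"
proof -
  obtain z where z: "z \<in> anchored_fits \<kappa> m n"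
    "Gmax K g \<kappa> (\<lambda>i. letter xs (a + i)) (\<lambda>j. letter ys (b + j)) m n =
      end_score K g (\<lambda>i. letter xs (a + i)) (\<lambda>j. letter ys (b + j)) m n z"
    using Gmax_attained[OF assms(1-3)] .
  have za: "z \<in> alignments" "fits m n z" "z \<noteq> []"
    using z(1) unfolding anchored_fits_def anchored_iff alignments_def by auto
  have "fits (length xs) (length ys) (shift a b z)"
    using za assms unfolding fits_def by (auto simp: last_shift)
  moreover have "Gwords \<kappa> (take m (drop a xs)) (take n (drop b ys)) \<le> raw_score K g (letter xs) (letter ys) (shift a b z)"
    unfolding Gwords_segment[OF assms(4,5)] z(2) end_score_def raw_score_shift
    using g_nonneg[of "m - fst (last z)"] g_nonneg[of "n - snd (last z)"] by linarith
  ultimately show ?thesis using that alignment_shift[OF za(1)] by blast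
qed

lemma alignment_segment:
  assumes "z \<in> alignments" "fits (length xs) (length ys) z"
  obtains a b m n where "a + m \<le> length xs" "b + n \<le> length ys" "length z \<le> m" "length z \<le> n"
    "raw_score K g (letter xs) (letter ys) z \<le> Gwords (length z) (take m (drop a xs)) (take n (drop b ys))"
  using raw_score_le_shifted_Gmax[where g = g and K = K and x = "letter xs" and y = "letter ys", OF g_0 assms]
    Gwords_segment by metis

lemma Gwords_concat:
  assumes "1 \<le> \<kappa>" "\<kappa> \<le> L" "length U = length V" "U \<noteq> []"
    "\<And>u. u \<in> set U \<Longrightarrow> length u = L" "\<And>v. v \<in> set V \<Longrightarrow> length v = L"
  shows "(\<Sum>z\<leftarrow>zip U V. Gwords \<kappa> (fst z) (snd z)) \<le> Gwords (length U * \<kappa>) (concat U) (concat V)"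
  using assms(3-6)
proof (induction U V rule: list_induct2)
  case (Cons u U v V)
  show ?case
  proof (cases "U = []")
    case True
    then show ?thesis using Cons(1) by simp
  next
    case False
    have lU: "length (concat U) = length U * L" "length (concat V) = length U * L"
      using length_concat_blocks[of U L] length_concat_blocks[of V L] Cons by auto
    have uv: "length u = L" "length v = L" using Cons by auto
    have "Gwords \<kappa> (take L (u @ concat U)) (take L (v @ concat V)) +
        Gwords (length U * \<kappa>) (drop L (u @ concat U)) (drop L (v @ concat V))
      \<le> Gwords (\<kappa> + length U * \<kappa>) (u @ concat U) (v @ concat V)"
      by (rule Gwords_superadditive[of \<kappa> L L "length U * \<kappa>" "length U * L" "length U * L"])
         (use assms False lU uv in \<open>auto simp: Suc_le_eq\<close>)
    then show ?thesis using Cons False uv by simp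
  qed
qed simp

end

lemma prob_mono_support:
  assumes "\<And>x. x \<in> set_pmf p \<Longrightarrow> x \<in> A \<Longrightarrow> x \<in> B"
  shows "measure_pmf.prob p A \<le> measure_pmf.prob p B"
  by (rule measure_pmf.finite_measure_mono_AE) (use assms in \<open>auto simp: AE_measure_pmf_iff\<close>)

lemma concat_concat: "concat (concat xs) = concat (map concat xs)"
  by (induction xs) auto

section \<open>Scores are rarely small\<close>

context scoring_model
begin

definition reaches :: "nat \<Rightarrow> nat set \<Rightarrow> real \<Rightarrow> ('a list \<times> 'a list) set" where
  "reaches n J s = {(xs, ys). \<exists>z\<in>alignments. fits n n z \<and> length z \<in> J \<and> s \<le> raw_score K g (letter xs) (letter ys) z}"

lemma reaches_take:
  assumes "T \<le> n" "(take T xs, take T ys) \<in> reaches T J s"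
  shows "(xs, ys) \<in> reaches n J s"
proof -
  obtain z where z: "z \<in> alignments" "fits T T z" "length z \<in> J" "s \<le> raw_score K g (letter (take T xs)) (letter (take T ys)) z"
    using assms(2) unfolding reaches_def by auto
  have "raw_score K g (letter (take T xs)) (letter (take T ys)) z = raw_score K g (letter xs) (letter ys) z"
    by (rule raw_score_cong_fits[OF z(1,2)]) (simp_all add: letter_take)
  moreover have "fits n n z" using z(2) assms(1) unfolding fits_def by auto
  ultimately show ?thesis using z unfolding reaches_def by auto
qed

lemma prob_not_reaches_antimono:
  assumes "T \<le> n"
  shows "measure_pmf.prob (words n n) (- reaches n J s) \<le> measure_pmf.prob (words T T) (- reaches T J s)"
proof -
  obtain r where r: "n = T + r" using assms le_Suc_ex by blast
  have "words T T = map_pmf (\<lambda>(xs, ys). (take T xs, take T ys)) (words n n)"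
    unfolding words_def map_pair r map_take_replicate_pmf ..
  then have "measure_pmf.prob (words T T) (- reaches T J s) =
     measure_pmf.prob (words n n) ((\<lambda>(xs, ys). (take T xs, take T ys)) -` (- reaches T J s))" by simp
  also have "\<dots> \<ge> measure_pmf.prob (words n n) (- reaches n J s)"
    by (rule measure_pmf.finite_measure_mono) (use reaches_take[OF assms] in auto)
  finally show ?thesis .
qed

lemma words_blocks:
  "words (N * l * L) (N * l * L) = map_pmf (\<lambda>(Us, Vs). (concat (concat Us), concat (concat Vs)))
     (block_pairs N l (replicate_pmf L \<mu>))"
proof -
  have "map_pmf (\<lambda>Us. concat (concat Us)) (replicate_pmf N (replicate_pmf l (replicate_pmf L \<mu>))) =
     map_pmf concat (map_pmf concat (replicate_pmf N (replicate_pmf l (replicate_pmf L \<mu>))))"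
    by (simp add: map_pmf_comp)
  also have "\<dots> = replicate_pmf (N * l * L) \<mu>" unfolding replicate_pmf_concat ..
  finally show ?thesis unfolding words_def map_pair by simp
qed

text \<open>
  Concatenating block-wise optimal anchored alignments turns a high-scoring pair of blocks of
  superletters, words of length \<open>L\<close>, into an alignment of the whole words.
\<close>

lemma prob_not_reaches_blocks:
  assumes \<kappa>: "1 \<le> \<kappa>" "\<kappa> \<le> L" and l: "1 \<le> l" and s: "s \<le> s'"
    and G: "\<And>u v. length u = L \<Longrightarrow> length v = L \<Longrightarrow> G u v = Gwords \<kappa> u v"
  shows "measure_pmf.prob (words (N * l * L) (N * l * L)) (- reaches (N * l * L) UNIV s) \<le>
    measure_pmf.prob (block_pairs N l (replicate_pmf L \<mu>))
      {(Us, Vs). \<forall>U\<in>set Us. \<forall>V\<in>set Vs. (\<Sum>z\<leftarrow>zip U V. G (fst z) (snd z)) < s'}"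
  unfolding words_blocks measure_map_pmf
proof (rule prob_mono_support)
  let ?R = "replicate_pmf N (replicate_pmf l (replicate_pmf L \<mu>))"
  let ?T = "N * l * L"
  fix w assume w: "w \<in> set_pmf (pair_pmf ?R ?R)"
    "w \<in> (\<lambda>(Us, Vs). (concat (concat Us), concat (concat Vs))) -` (- reaches ?T UNIV s)"
  obtain Us Vs where w': "w = (Us, Vs)" by force
  define xs where "xs = concat (map concat Us)"
  define ys where "ys = concat (map concat Vs)"
  have nr: "(xs, ys) \<notin> reaches ?T UNIV s" using w(2) unfolding w' xs_def ys_def concat_concat by simp
  have len: "length Us = N" "length Vs = N"
    "\<And>U. U \<in> set Us \<Longrightarrow> length U = l" "\<And>V. V \<in> set Vs \<Longrightarrow> length V = l"
    "\<And>U u. U \<in> set Us \<Longrightarrow> u \<in> set U \<Longrightarrow> length u = L" "\<And>V v. V \<in> set Vs \<Longrightarrow> v \<in> set V \<Longrightarrow> length v = L"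
    using w(1) unfolding w' by (auto simp: set_replicate_pmf lists_eq_set)
  have bx: "length (concat U) = l * L" if "U \<in> set Us" for U
    using length_concat_blocks[of U L] len that by auto
  have byy: "length (concat V) = l * L" if "V \<in> set Vs" for V
    using length_concat_blocks[of V L] len that by auto
  have bx': "length w = l * L" if "w \<in> set (map concat Us)" for w using bx that by auto
  have by': "length w = l * L" if "w \<in> set (map concat Vs)" for w using byy that by auto
  have "length (concat (map concat Us)) = length (map concat Us) * (l * L)"
    by (rule length_concat_blocks) (rule bx')
  moreover have "length (concat (map concat Vs)) = length (map concat Vs) * (l * L)"
    by (rule length_concat_blocks) (rule by')
  ultimately have lx: "length xs = ?T" and ly: "length ys = ?T"
    unfolding xs_def ys_def using len by simp_all
  have "(\<Sum>z\<leftarrow>zip U V. G (fst z) (snd z)) < s'" if UV: "U \<in> set Us" "V \<in> set Vs" for U V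
  proof (rule ccontr)
    assume "\<not> (\<Sum>z\<leftarrow>zip U V. G (fst z) (snd z)) < s'"
    moreover have "(\<Sum>z\<leftarrow>zip U V. G (fst z) (snd z)) = (\<Sum>z\<leftarrow>zip U V. Gwords \<kappa> (fst z) (snd z))"
    proof (intro arg_cong[where f = sum_list] map_cong refl)
      fix z assume "z \<in> set (zip U V)"
      then have "fst z \<in> set U" "snd z \<in> set V" by (metis prod.collapse set_zip_leftD) (metis \<open>z \<in> set (zip U V)\<close> prod.collapse set_zip_rightD)
      then show "G (fst z) (snd z) = Gwords \<kappa> (fst z) (snd z)" using G len UV by auto
    qed
    moreover have "(\<Sum>z\<leftarrow>zip U V. Gwords \<kappa> (fst z) (snd z)) \<le> Gwords (l * \<kappa>) (concat U) (concat V)"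
      using Gwords_concat[OF \<kappa>, of U V] len UV l by fastforce
    ultimately have s1: "s \<le> Gwords (l * \<kappa>) (concat U) (concat V)" using s by linarith
    obtain i where i: "i < N" "U = Us ! i" using UV(1) len(1) by (metis in_set_conv_nth)
    obtain j where j: "j < N" "V = Vs ! j" using UV(2) len(2) by (metis in_set_conv_nth)
    have U: "concat U = take (l * L) (drop (i * (l * L)) xs)"
      unfolding xs_def using take_drop_concat[of "map concat Us" "l * L" i, OF bx'] len i by simp
    have V: "concat V = take (l * L) (drop (j * (l * L)) ys)"
      unfolding ys_def using take_drop_concat[of "map concat Vs" "l * L" j, OF by'] len j by simp
    have ij: "i * (l * L) + l * L \<le> length xs" "j * (l * L) + l * L \<le> length ys"
      using i(1) j(1) unfolding lx ly
      by (metis Suc_leI add.commute mult.assoc mult_Suc mult_le_mono1)+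
    have "1 \<le> l * \<kappa>" "l * \<kappa> \<le> l * L" using l \<kappa> by auto
    then obtain z where z: "z \<in> alignments" "fits (length xs) (length ys) z"
      "Gwords (l * \<kappa>) (concat U) (concat V) \<le> raw_score K g (letter xs) (letter ys) z"
      using segment_alignment[OF _ _ _ ij, of "l * \<kappa>"] unfolding U V by metis
    then have "(xs, ys) \<in> reaches ?T UNIV s" using s1 unfolding reaches_def lx ly by auto
    then show False using nr by simp
  qed
  then show "w \<in> {(Us, Vs). \<forall>U\<in>set Us. \<forall>V\<in>set Vs. (\<Sum>z\<leftarrow>zip U V. G (fst z) (snd z)) < s'}"
    unfolding w' by simp
qed

text \<open>
  Words of length \<open>2\<^sup>k\<close> contain at least \<open>N \<approx> 2\<^bsup>(1 - \<epsilon>) k\<^esup>\<close> blocks of logarithmic length \<open>l \<approx> \<beta> k\<close>. The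
  constant \<open>\<beta>\<close> is chosen so that \<open>l t \<gamma>\<close> stays just below \<open>2 ln N\<close>, and the tolerance \<open>d\<close> for the mean
  score so small that its effect on the exponents does not use up this margin.
\<close>

lemma lower_tail:
  assumes t: "0 < t" "0 < Psi t" and \<epsilon>: "0 < \<epsilon>" "\<epsilon> \<le> 1 / 8"
  shows "\<forall>\<^sub>F k in sequentially. measure_pmf.prob (words (2 ^ k) (2 ^ k))
     (- reaches (2 ^ k) UNIV (2 * (1 - 4 * \<epsilon>) / t * (k * ln 2))) \<le> 6 * exp (- (\<epsilon> * ln 2) * k)"
proof -
  obtain \<kappa> L where \<kappa>: "1 \<le> \<kappa>" "\<kappa> \<le> L" and Z: "1 < mgf \<kappa> L L t"
    using square_mgf_gt_1_exists[OF t] by blast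
  define \<nu> where "\<nu> = replicate_pmf L \<mu>"
  have fin: "finite (set_pmf \<nu>)" unfolding \<nu>_def by (simp add: finite_set_replicate_pmf)
  \<comment> \<open>The value for words of other lengths, which have probability \<open>0\<close>, is chosen to make \<open>G\<close> symmetric everywhere.\<close>
  define G where "G u v = (if length u = L \<and> length v = L then Gwords \<kappa> u v else 0)" for u v
  have G_sym: "G u v = G v u" for u v
    unfolding G_def Gwords_def using Gmax_swap[of K \<kappa> L L g] K_sym \<kappa> by auto
  have "mgf \<kappa> L L t = expect (pair_pmf \<nu> \<nu>) (\<lambda>(u, v). exp (t * G u v))"
    unfolding mgf_def words_def \<nu>_def G_def
    by (rule expect_cong) (auto dest: length_replicate_pmf)
  then have Z': "1 < expect (pair_pmf \<nu> \<nu>) (\<lambda>(u, v). exp (t * G u v))" using Z by simp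
  obtain \<gamma> :: real where \<gamma>: "0 < \<gamma>" and match: "\<And>d :: real. 0 < d \<Longrightarrow> \<forall>\<^sub>F l in sequentially. \<forall>N\<ge>1.
      measure_pmf.prob (block_pairs N l \<nu>)
        {(Us, Vs). \<forall>U\<in>set Us. \<forall>V\<in>set Vs. (\<Sum>z\<leftarrow>zip U V. G (fst z) (snd z)) < l * (\<gamma> - d)}
      \<le> 2 * exp (l * (t * (\<gamma> + d))) / real N ^ 2 + 4 * exp (l * (t * \<gamma> / 2 + d * (1 + 2 * t))) / N"
    using block_matching[OF fin G_sym t(1) Z'] by blast
  define \<beta> where "\<beta> = 2 * (1 - 3 * \<epsilon>) * ln 2 / (t * \<gamma>)"
  have ln2: "0 < (ln 2 :: real)" by simp
  have \<beta>: "0 < \<beta>" unfolding \<beta>_def using t \<gamma> \<epsilon> by (intro divide_pos_pos mult_pos_pos) auto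
  have \<beta>\<gamma>: "\<beta> * (t * \<gamma>) = 2 * (1 - 3 * \<epsilon>) * ln 2" unfolding \<beta>_def using t \<gamma> by simp
  define d where "d = \<epsilon> * ln 2 / (\<beta> * (1 + 2 * t))"
  have d: "0 < d" unfolding d_def using \<epsilon> \<beta> t by (intro divide_pos_pos mult_pos_pos) auto
  have \<beta>d: "\<beta> * (d * (1 + 2 * t)) = \<epsilon> * ln 2"
  proof -
    have "\<beta> * (d * (1 + 2 * t)) = d * (\<beta> * (1 + 2 * t))" by (simp only: mult.left_commute)
    also have "\<dots> = \<epsilon> * ln 2" unfolding d_def using mult_pos_pos[OF \<beta>, of "1 + 2 * t"] t(1) \<beta> by simp
    finally show ?thesis .
  qed
  have \<beta>d': "\<beta> * (t * d) \<le> \<epsilon> * ln 2 / 2"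
  proof -
    have "2 * (\<beta> * (t * d)) + \<beta> * d = \<epsilon> * ln 2" using \<beta>d by (simp add: algebra_simps)
    moreover have "0 < \<beta> * d" using \<beta> d by simp
    ultimately show ?thesis by linarith
  qed
  have d\<gamma>: "d < \<gamma>"
  proof -
    have "\<epsilon> / 2 < 2 * (1 - 3 * \<epsilon>)" using \<epsilon> by simp
    then have "\<epsilon> / 2 * ln 2 < 2 * (1 - 3 * \<epsilon>) * ln 2" using ln2 by (rule mult_strict_right_mono)
    then have "\<beta> * (t * d) < \<beta> * (t * \<gamma>)" using \<beta>d' unfolding \<beta>\<gamma> by linarith
    then show ?thesis using \<beta> t by simp
  qed
  define l where "l k = nat \<lfloor>\<beta> * real k\<rfloor>" for k :: nat
  define j where "j k = nat \<lfloor>\<epsilon> * real k\<rfloor>" for k :: nat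
  have l_le: "l k \<le> \<beta> * k" and l_ge: "\<beta> * k - 1 \<le> l k" for k
    using \<beta> unfolding l_def by (auto simp: of_nat_nat)
  have j_le: "j k \<le> \<epsilon> * k" and j_ge: "\<epsilon> * k - 1 \<le> j k" for k
    using \<epsilon> unfolding j_def by (auto simp: of_nat_nat)
  have l_lim: "filterlim l at_top sequentially"
    unfolding l_def using \<beta> by real_asymp
  have ev1: "\<forall>\<^sub>F k in sequentially. \<beta> * k * L \<le> exp ((\<epsilon> * k - 1) * ln 2)"
  proof -
    have "((\<lambda>k. \<beta> * real k * L / exp ((\<epsilon> * k - 1) * ln 2)) \<longlongrightarrow> 0) sequentially"
    proof (cases "L = 0")
      case False
      then have "0 < real L" by simp
      then show ?thesis using \<beta> \<epsilon> by real_asymp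
    qed simp
    from order_tendstoD(2)[OF this, of 1]
    show ?thesis by (auto elim!: eventually_mono simp: field_simps)
  qed
  have ev2: "\<forall>\<^sub>F k in sequentially. \<gamma> \<le> (3 / 2 * \<epsilon> * ln 2 / t) * real k"
  proof -
    have "0 < 3 / 2 * \<epsilon> * ln 2 / t" using \<epsilon> t ln2 by (intro divide_pos_pos mult_pos_pos) auto
    then have "filterlim (\<lambda>k. (3 / 2 * \<epsilon> * ln 2 / t) * real k) at_top sequentially" by real_asymp
    then show ?thesis unfolding filterlim_at_top by blast
  qed
  have evl: "\<forall>\<^sub>F k in sequentially. 1 \<le> l k"
    using l_lim unfolding filterlim_at_top by blast
  show ?thesis
    using eventually_compose_filterlim[OF match[OF d] l_lim] ev1 ev2 evl
  proof eventually_elim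
    case (elim k)
    define N where "N = (2 :: nat) ^ (k - j k)"
    have "\<epsilon> * k \<le> 1 * real k" using \<epsilon> by (intro mult_right_mono) auto
    then have jk: "j k \<le> k" using j_le[of k] by simp
    have pow: "real (2 ^ i) = exp (i * ln 2)" for i :: nat
      by (simp add: exp_of_nat_mult)
    have N1: "1 \<le> N" unfolding N_def by simp
    have N_ge: "exp ((1 - \<epsilon>) * (k * ln 2)) \<le> real N"
    proof -
      have "(1 - \<epsilon>) * real k \<le> real (k - j k)" using j_le[of k] jk by (simp add: of_nat_diff algebra_simps)
      then have "(1 - \<epsilon>) * k * ln 2 \<le> real (k - j k) * ln 2" using ln2 by (intro mult_right_mono) auto
      then show ?thesis unfolding N_def pow by (simp add: algebra_simps)
    qed
    have fit: "N * l k * L \<le> 2 ^ k"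
    proof -
      have "real (l k * L) \<le> \<beta> * k * L" using l_le[of k] by (simp add: mult_right_mono)
      also have "\<dots> \<le> exp ((\<epsilon> * k - 1) * ln 2)" using elim by simp
      also have "\<dots> \<le> real (2 ^ j k)" unfolding pow using j_ge[of k] by simp
      finally have "l k * L \<le> 2 ^ j k" by (simp only: of_nat_le_iff)
      then have "N * (l k * L) \<le> 2 ^ (k - j k) * 2 ^ j k" unfolding N_def by (rule mult_le_mono2)
      also have "\<dots> = 2 ^ k" using jk by (simp add: power_add[symmetric])
      finally show ?thesis by (simp add: mult.assoc)
    qed
    define s where "s = 2 * (1 - 4 * \<epsilon>) / t * (k * ln 2)"
    have s_le: "s \<le> l k * (\<gamma> - d)"
    proof -
      have bt: "\<beta> * \<gamma> = 2 * (1 - 3 * \<epsilon>) * ln 2 / t" using \<beta>\<gamma> t by (simp add: field_simps)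
      have bd: "\<beta> * d \<le> \<epsilon> * ln 2 / 2 / t" using \<beta>d' t by (simp add: field_simps)
      have "s = 2 * (1 - 3 * \<epsilon>) * ln 2 / t * k - \<epsilon> * ln 2 / 2 / t * k - (3 / 2 * \<epsilon> * ln 2 / t) * real k"
        unfolding s_def by (simp add: algebra_simps diff_divide_distrib add_divide_distrib)
      also have "\<dots> \<le> \<beta> * \<gamma> * k - \<beta> * d * k - \<gamma>"
        unfolding bt using elim mult_right_mono[OF bd, of "real k"] by linarith
      also have "\<dots> \<le> (\<beta> * k - 1) * (\<gamma> - d)" using d by (simp add: algebra_simps)
      also have "\<dots> \<le> l k * (\<gamma> - d)" using l_ge[of k] d\<gamma> by (intro mult_right_mono) auto
      finally show ?thesis .
    qed
    have "measure_pmf.prob (words (2 ^ k) (2 ^ k)) (- reaches (2 ^ k) UNIV s) \<le>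
        measure_pmf.prob (words (N * l k * L) (N * l k * L)) (- reaches (N * l k * L) UNIV s)"
      by (rule prob_not_reaches_antimono[OF fit])
    also have "\<dots> \<le> measure_pmf.prob (block_pairs N (l k) \<nu>)
        {(Us, Vs). \<forall>U\<in>set Us. \<forall>V\<in>set Vs. (\<Sum>z\<leftarrow>zip U V. G (fst z) (snd z)) < l k * (\<gamma> - d)}"
      unfolding \<nu>_def by (rule prob_not_reaches_blocks[OF \<kappa> _ s_le]) (use elim in \<open>auto simp: G_def\<close>)
    also have "\<dots> \<le> 2 * exp (l k * (t * (\<gamma> + d))) / real N ^ 2 + 4 * exp (l k * (t * \<gamma> / 2 + d * (1 + 2 * t))) / N"
      using elim N1 by blast
    also have "\<dots> \<le> 2 * exp (- (\<epsilon> * ln 2) * k) + 4 * exp (- (\<epsilon> * ln 2) * k)"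
    proof (rule add_mono)
      have "exp (l k * (t * (\<gamma> + d))) \<le> exp ((\<beta> * k) * (t * (\<gamma> + d)))"
        using l_le[of k] t \<gamma> d by (simp add: mult_right_mono)
      also have "(\<beta> * k) * (t * (\<gamma> + d)) = (\<beta> * (t * \<gamma>) + \<beta> * (t * d)) * k" by (simp add: algebra_simps)
      also have "exp \<dots> \<le> exp ((2 * (1 - 3 * \<epsilon>) * ln 2 + \<epsilon> * ln 2) * k)"
      proof -
        have "0 < \<epsilon> * ln 2" using \<epsilon> ln2 by simp
        then have "\<beta> * (t * d) \<le> \<epsilon> * ln 2" using \<beta>d' by linarith
        then have "\<beta> * (t * \<gamma>) + \<beta> * (t * d) \<le> 2 * (1 - 3 * \<epsilon>) * ln 2 + \<epsilon> * ln 2" unfolding \<beta>\<gamma> by simp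
        then show ?thesis unfolding exp_le_cancel_iff by (rule mult_right_mono) simp
      qed
      finally have e1: "exp (l k * (t * (\<gamma> + d))) \<le> exp ((2 * (1 - 3 * \<epsilon>) * ln 2 + \<epsilon> * ln 2) * k)" .
      have "exp ((1 - \<epsilon>) * (k * ln 2)) ^ 2 \<le> real N ^ 2" by (rule power_mono[OF N_ge]) simp
      then have e2: "exp (2 * ((1 - \<epsilon>) * (k * ln 2))) \<le> real N ^ 2" by (simp add: exp_double)
      have "exp (l k * (t * (\<gamma> + d))) / real N ^ 2 \<le>
          exp ((2 * (1 - 3 * \<epsilon>) * ln 2 + \<epsilon> * ln 2) * k) / exp (2 * ((1 - \<epsilon>) * (k * ln 2)))"
        by (rule frac_le) (use e1 e2 in auto)
      also have "\<dots> = exp (- (3 * \<epsilon> * ln 2) * k)"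
        unfolding exp_diff[symmetric] by (simp add: algebra_simps)
      also have "\<dots> \<le> exp (- (\<epsilon> * ln 2) * k)" using \<epsilon> ln2 by (simp add: mult_right_mono)
      finally show "2 * exp (l k * (t * (\<gamma> + d))) / real N ^ 2 \<le> 2 * exp (- (\<epsilon> * ln 2) * k)" by simp
      have "exp (l k * (t * \<gamma> / 2 + d * (1 + 2 * t))) \<le> exp ((\<beta> * k) * (t * \<gamma> / 2 + d * (1 + 2 * t)))"
        using l_le[of k] t \<gamma> d by (simp add: mult_right_mono)
      also have "(\<beta> * k) * (t * \<gamma> / 2 + d * (1 + 2 * t)) = (\<beta> * (t * \<gamma>) / 2 + \<beta> * (d * (1 + 2 * t))) * k"
        by (simp add: algebra_simps)
      also have "\<dots> = ((1 - 3 * \<epsilon>) * ln 2 + \<epsilon> * ln 2) * k" unfolding \<beta>\<gamma> \<beta>d by simp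
      finally have e3: "exp (l k * (t * \<gamma> / 2 + d * (1 + 2 * t))) \<le> exp (((1 - 3 * \<epsilon>) * ln 2 + \<epsilon> * ln 2) * k)" .
      have "exp (l k * (t * \<gamma> / 2 + d * (1 + 2 * t))) / N \<le>
          exp (((1 - 3 * \<epsilon>) * ln 2 + \<epsilon> * ln 2) * k) / exp ((1 - \<epsilon>) * (k * ln 2))"
        by (rule frac_le) (use e3 N_ge in auto)
      also have "\<dots> = exp (- (\<epsilon> * ln 2) * k)"
        unfolding exp_diff[symmetric] by (simp add: algebra_simps)
      finally show "4 * exp (l k * (t * \<gamma> / 2 + d * (1 + 2 * t))) / N \<le> 4 * exp (- (\<epsilon> * ln 2) * k)" by simp
    qed
    finally show ?case unfolding s_def by simp
  qed
qed

section \<open>High scores have few or many matches only rarely\<close>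

text \<open>
  The factor \<open>n\<^sup>2\<close> counts the positions of the first match. The positions of the last match are not
  counted but summed over in \<open>h\<^sub>\<kappa>\<close>.
\<close>

lemma prob_reaches_length:
  assumes "0 < t" "1 \<le> \<kappa>"
  shows "measure_pmf.prob (words n n) (reaches n {\<kappa>} s) \<le> real n ^ 2 * exp (- t * s) * hk \<kappa> t"
proof -
  define I where "I = ({..<n} \<times> {..<n}) \<times> ({\<kappa>..n} \<times> {\<kappa>..n})"
  define A where "A = (\<lambda>((a, b), (m, m')). if a + m \<le> n \<and> b + m' \<le> n
     then {(xs, ys). s \<le> Gwords \<kappa> (take m (drop a xs)) (take m' (drop b ys))} else {})"
  have finI: "finite I" unfolding I_def by simp
  have "measure_pmf.prob (words n n) (reaches n {\<kappa>} s) \<le> measure_pmf.prob (words n n) (\<Union>i\<in>I. A i)"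
  proof (rule prob_mono_support)
    fix w assume w: "w \<in> set_pmf (words n n)" "w \<in> reaches n {\<kappa>} s"
    obtain xs ys where w': "w = (xs, ys)" by force
    have l: "length xs = n" "length ys = n" using w(1) length_words unfolding w' by auto
    obtain z where z: "z \<in> alignments" "fits (length xs) (length ys) z" "length z = \<kappa>"
      "s \<le> raw_score K g (letter xs) (letter ys) z"
      using w(2) unfolding reaches_def w' l by auto
    obtain a b m m' where *: "a + m \<le> n" "b + m' \<le> n" "\<kappa> \<le> m" "\<kappa> \<le> m'"
      "raw_score K g (letter xs) (letter ys) z \<le> Gwords \<kappa> (take m (drop a xs)) (take m' (drop b ys))"
      using alignment_segment[OF z(1,2)] unfolding l z(3) by metis
    have "((a, b), (m, m')) \<in> I" using * assms(2) unfolding I_def by auto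
    moreover have "w \<in> A ((a, b), (m, m'))" unfolding A_def w' using * z(4) by auto
    ultimately show "w \<in> (\<Union>i\<in>I. A i)" by blast
  qed
  also have "\<dots> \<le> (\<Sum>i\<in>I. measure_pmf.prob (words n n) (A i))"
    by (rule measure_pmf.finite_measure_subadditive_finite[OF finI]) auto
  also have "\<dots> \<le> (\<Sum>i\<in>I. exp (- t * s) * (case i of (_, (m, m')) \<Rightarrow> mgf \<kappa> m m' t))"
  proof (rule sum_mono)
    fix i assume "i \<in> I"
    obtain a b m m' where i: "i = ((a, b), (m, m'))" by (metis prod.exhaust)
    show "measure_pmf.prob (words n n) (A i) \<le> exp (- t * s) * (case i of (_, (m, m')) \<Rightarrow> mgf \<kappa> m m' t)"
    proof (cases "a + m \<le> n \<and> b + m' \<le> n")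
      case True
      let ?seg = "\<lambda>(xs, ys). (take m (drop a xs), take m' (drop b ys))"
      have W: "words m m' = map_pmf ?seg (words n n)"
        unfolding words_def map_pair using map_segment_replicate_pmf True by metis
      have "A i = ?seg -` {(xs, ys). s \<le> Gwords \<kappa> xs ys}" unfolding A_def i using True by auto
      then have "measure_pmf.prob (words n n) (A i) = measure_pmf.prob (words m m') {(xs, ys). s \<le> Gwords \<kappa> xs ys}"
        unfolding W by simp
      also have "\<dots> \<le> mgf \<kappa> m m' t / exp (t * s)"
        unfolding mgf_def by (rule markov_pmf) (use assms in auto)
      finally show ?thesis unfolding i by (simp add: exp_minus field_simps)
    next
      case False
      then have "A i = {}" by (auto simp: A_def i)
      then show ?thesis unfolding i by (simp add: mgf_nonneg)
    qed
  qed
  also have "\<dots> = real n ^ 2 * exp (- t * s) * (\<Sum>(m, m')\<in>{\<kappa>..n} \<times> {\<kappa>..n}. mgf \<kappa> m m' t)"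
    unfolding I_def sum_distrib_left[symmetric]
    by (subst sum.cartesian_product[symmetric]) (simp add: power2_eq_square case_prod_unfold)
  also have "\<dots> \<le> real n ^ 2 * exp (- t * s) * hk \<kappa> t"
    by (intro mult_left_mono mgf_sum_le_hk assms) auto
  finally show ?thesis .
qed

text \<open>
  The slack \<open>r\<close> in the exponent turns the sum over the number of matches into a geometric series.
\<close>

lemma prob_reaches_lengths:
  assumes t: "0 < t" and r: "0 < r" and C: "0 < C" "\<And>\<kappa>. 1 \<le> \<kappa> \<Longrightarrow> hk \<kappa> t \<le> C * exp (\<kappa> * b)"
    and J: "\<And>\<kappa>. \<kappa> \<in> J \<Longrightarrow> \<kappa> * (b + r) \<le> w"
  shows "measure_pmf.prob (words n n) (reaches n J s) \<le> real n ^ 2 * exp (- t * s) * exp w * (C / (1 - exp (- r)))"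
proof -
  define I where "I = J \<inter> {1..n}"
  have finI: "finite I" unfolding I_def by simp
  have "reaches n J s \<subseteq> (\<Union>\<kappa>\<in>I. reaches n {\<kappa>} s)"
  proof
    fix p assume p: "p \<in> reaches n J s"
    obtain xs ys where p': "p = (xs, ys)" by force
    obtain z where z: "z \<in> alignments" "fits n n z" "length z \<in> J" "s \<le> raw_score K g (letter xs) (letter ys) z"
      using p unfolding reaches_def p' by auto
    have "1 \<le> length z" using z(1) unfolding alignments_def by (auto simp: Suc_le_eq)
    then have "length z \<in> I" using fits_length[OF z(1,2)] z(3) unfolding I_def by auto
    then show "p \<in> (\<Union>\<kappa>\<in>I. reaches n {\<kappa>} s)" using z unfolding reaches_def p' by auto
  qed
  then have "measure_pmf.prob (words n n) (reaches n J s) \<le> measure_pmf.prob (words n n) (\<Union>\<kappa>\<in>I. reaches n {\<kappa>} s)"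
    by (intro measure_pmf.finite_measure_mono) auto
  also have "\<dots> \<le> (\<Sum>\<kappa>\<in>I. measure_pmf.prob (words n n) (reaches n {\<kappa>} s))"
    by (rule measure_pmf.finite_measure_subadditive_finite[OF finI]) auto
  also have "\<dots> \<le> (\<Sum>\<kappa>\<in>I. real n ^ 2 * exp (- t * s) * exp w * C * exp (- r) ^ \<kappa>)"
  proof (rule sum_mono)
    fix \<kappa> assume \<kappa>: "\<kappa> \<in> I"
    have "hk \<kappa> t \<le> C * exp (\<kappa> * b)" by (rule C(2)) (use \<kappa> in \<open>auto simp: I_def\<close>)
    also have "\<dots> = C * (exp (\<kappa> * (b + r)) * exp (- r) ^ \<kappa>)"
      by (simp add: exp_of_nat_mult[symmetric] exp_add[symmetric] algebra_simps)
    also have "\<dots> \<le> C * (exp w * exp (- r) ^ \<kappa>)"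
      using C(1) J[of \<kappa>] \<kappa> by (intro mult_left_mono mult_right_mono) (auto simp: I_def)
    finally have "real n ^ 2 * exp (- t * s) * hk \<kappa> t \<le> real n ^ 2 * exp (- t * s) * (C * (exp w * exp (- r) ^ \<kappa>))"
      by (rule mult_left_mono) auto
    also have "\<dots> = real n ^ 2 * exp (- t * s) * exp w * C * exp (- r) ^ \<kappa>" by (simp only: mult_ac)
    finally show "measure_pmf.prob (words n n) (reaches n {\<kappa>} s) \<le> real n ^ 2 * exp (- t * s) * exp w * C * exp (- r) ^ \<kappa>"
      using order.trans[OF prob_reaches_length[OF t]] \<kappa> unfolding I_def by fastforce
  qed
  also have "\<dots> = real n ^ 2 * exp (- t * s) * exp w * C * (\<Sum>\<kappa>\<in>I. exp (- r) ^ \<kappa>)"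
    by (rule sum_distrib_left[symmetric])
  also have "\<dots> \<le> real n ^ 2 * exp (- t * s) * exp w * C * (1 / (1 - exp (- r)))"
  proof (rule mult_left_mono)
    have q: "norm (exp (- r)) < 1" using r by simp
    have "(\<Sum>\<kappa>\<in>I. exp (- r) ^ \<kappa>) \<le> (\<Sum>\<kappa>. exp (- r) ^ \<kappa>)"
      by (rule sum_le_suminf[OF summable_geometric[OF q] finI]) auto
    then show "(\<Sum>\<kappa>\<in>I. exp (- r) ^ \<kappa>) \<le> 1 / (1 - exp (- r))" unfolding suminf_geometric[OF q] .
  qed (use C in auto)
  finally show ?thesis by simp
qed

text \<open>
  Bounding the number of high-scoring alignments with \<open>\<kappa>\<close> matches at a parameter \<open>t\<close> slightly below
  \<open>\<theta>\<close> rules out large \<open>\<kappa>\<close>, a parameter slightly above rules out small \<open>\<kappa>\<close>. To first order the two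
  exponents change sign at the same \<open>\<kappa> = 2 ln n / (\<theta> D)\<close>.
\<close>

lemma upper_tail:
  assumes \<theta>: "0 < \<theta>" and root: "Psi \<theta> = 0" and D: "0 < D" "(Psi has_real_derivative D) (at \<theta>)"
    and e: "0 < e"
  obtains \<delta> c C where "0 < \<delta>" "\<delta> < 1" "0 < c"
    "\<And>k. measure_pmf.prob (words (2 ^ k) (2 ^ k))
       (reaches (2 ^ k) {\<kappa>. (2 / (\<theta> * D) + e) * (k * ln 2) \<le> \<kappa> \<or> \<kappa> \<le> (2 / (\<theta> * D) - e) * (k * ln 2)}
         ((1 - \<delta>) * (2 / \<theta>) * (k * ln 2))) \<le> C * exp (- c * k)"
proof -
  define a where "a = 2 / (\<theta> * D)"
  have a: "0 < a" and aD: "2 / \<theta> = a * D" unfolding a_def using \<theta> D by auto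
  \<comment> \<open>The slope tolerance: three times \<open>\<rho>\<close> is spent, once each on the difference quotient of \<open>\<psi>\<close>, on the limit defining \<open>\<psi>\<close>, and on the geometric series.\<close>
  define \<rho> where "\<rho> = e * D / (6 * (a + e))"
  have \<rho>: "0 < \<rho>" unfolding \<rho>_def using a e D by simp
  have \<rho>ae: "3 * \<rho> * (a + e) = e * D / 2" unfolding \<rho>_def using a e by (simp add: field_simps)
  have "3 * \<rho> * e < 3 * \<rho> * (a + e)" using \<rho> a by simp
  then have "3 * \<rho> * e < D * e" unfolding \<rho>ae using D e by (simp add: mult.commute)
  then have \<rho>D: "3 * \<rho> < D" using e by simp
  have "(\<lambda>h. (Psi (\<theta> + h) - Psi \<theta>) / h) \<midarrow>0\<rightarrow> D" using D(2) unfolding DERIV_def .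
  from LIM_D[OF this \<rho>] obtain s where s: "0 < s"
    and near: "\<And>h. h \<noteq> 0 \<Longrightarrow> \<bar>h\<bar> < s \<Longrightarrow> \<bar>Psi (\<theta> + h) / h - D\<bar> < \<rho>"
    unfolding root by auto
  define \<eta> where "\<eta> = min s \<theta> / 2"
  have \<eta>: "0 < \<eta>" "\<eta> < s" "\<eta> < \<theta>" unfolding \<eta>_def using s \<theta> by auto
  have up: "Psi (\<theta> + \<eta>) \<le> (D + \<rho>) * \<eta>"
    using near[of \<eta>] \<eta> by (simp add: abs_less_iff field_simps)
  have down: "Psi (\<theta> - \<eta>) \<le> - (D - \<rho>) * \<eta>"
    using near[of "- \<eta>"] \<eta> by (simp add: abs_less_iff field_simps)
  define \<delta> where "\<delta> = min (1 / 2) (\<eta> * e * D / 16)"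
  have \<delta>: "0 < \<delta>" "\<delta> < 1" "\<delta> \<le> \<eta> * e * D / 16" unfolding \<delta>_def using \<eta> e D by auto
  define c where "c = \<eta> * e * D / 4"
  have c: "0 < c" unfolding c_def using \<eta> e D by simp
  have \<rho>\<eta>: "0 < \<rho> * \<eta>" using \<rho> \<eta> by simp
  have t1: "0 < \<theta> - \<eta>" and t2: "0 < \<theta> + \<eta>" using \<eta> \<theta> by auto
  obtain C1 where C1: "0 < C1" "\<And>\<kappa>. 1 \<le> \<kappa> \<Longrightarrow> hk \<kappa> (\<theta> - \<eta>) \<le> C1 * exp (\<kappa> * (Psi (\<theta> - \<eta>) + \<rho> * \<eta>))"
    using hk_le_exp_Psi[OF t1 \<rho>\<eta>] by blast
  obtain C2 where C2: "0 < C2" "\<And>\<kappa>. 1 \<le> \<kappa> \<Longrightarrow> hk \<kappa> (\<theta> + \<eta>) \<le> C2 * exp (\<kappa> * (Psi (\<theta> + \<eta>) + \<rho> * \<eta>))"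
    using hk_le_exp_Psi[OF t2 \<rho>\<eta>] by blast
  define B1 where "B1 = C1 / (1 - exp (- (\<rho> * \<eta>)))"
  define B2 where "B2 = C2 / (1 - exp (- (\<rho> * \<eta>)))"
  have B: "0 \<le> B1" "0 \<le> B2" unfolding B1_def B2_def using C1(1) C2(1) \<rho>\<eta> by auto
  have bound: "measure_pmf.prob (words (2 ^ k) (2 ^ k))
       (reaches (2 ^ k) {\<kappa>. (a + e) * (k * ln 2) \<le> \<kappa> \<or> \<kappa> \<le> (a - e) * (k * ln 2)}
         ((1 - \<delta>) * (2 / \<theta>) * (k * ln 2))) \<le> (B1 + B2) * exp (- (c * ln 2) * k)" for k
  proof -
    define v where "v = k * (ln 2 :: real)"
    have v: "0 \<le> v" unfolding v_def by simp
    define S where "S = (1 - \<delta>) * (2 / \<theta>) * v"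
    let ?J1 = "{\<kappa>. (a + e) * v \<le> real \<kappa>}"
    let ?J2 = "{\<kappa>. real \<kappa> \<le> (a - e) * v}"
    let ?P = "measure_pmf.prob (words (2 ^ k) (2 ^ k))"
    have pow: "real (2 ^ k) ^ 2 = exp (2 * v)"
      unfolding v_def by (simp add: exp_of_nat_mult exp_double)
    have "?P (reaches (2 ^ k) ?J1 S) \<le> exp (2 * v) * exp (- (\<theta> - \<eta>) * S) * exp (- \<eta> * (D - 3 * \<rho>) * ((a + e) * v)) * B1"
      unfolding B1_def pow[symmetric]
    proof (rule prob_reaches_lengths[OF t1 \<rho>\<eta> C1])
      fix \<kappa> assume "\<kappa> \<in> ?J1"
      then have \<kappa>: "(a + e) * v \<le> real \<kappa>" by simp
      have "\<kappa> * (Psi (\<theta> - \<eta>) + \<rho> * \<eta> + \<rho> * \<eta>) \<le> \<kappa> * (- \<eta> * (D - 3 * \<rho>))"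
        using down by (intro mult_left_mono) (auto simp: algebra_simps)
      also have "\<dots> \<le> ((a + e) * v) * (- \<eta> * (D - 3 * \<rho>))"
        using \<kappa> \<eta> \<rho>D by (intro mult_right_mono_neg) (auto simp: mult_nonneg_nonneg)
      finally show "\<kappa> * (Psi (\<theta> - \<eta>) + \<rho> * \<eta> + \<rho> * \<eta>) \<le> - \<eta> * (D - 3 * \<rho>) * ((a + e) * v)"
        by (simp only: mult.commute)
    qed
    also have "\<dots> \<le> exp (- c * v) * B1"
    proof (rule mult_right_mono[OF _ B(1)])
      have "2 * v + - (\<theta> - \<eta>) * ((1 - \<delta>) * q * v) + - \<eta> * (D - 3 * \<rho>) * ((a + e) * v) =
          (2 - (1 - \<delta>) * ((\<theta> - \<eta>) * q) - \<eta> * D * (a + e) + \<eta> * (3 * \<rho> * (a + e))) * v" for q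
        by (simp add: algebra_simps)
      then have "2 * v + - (\<theta> - \<eta>) * S + - \<eta> * (D - 3 * \<rho>) * ((a + e) * v) =
          (2 - (1 - \<delta>) * ((\<theta> - \<eta>) * (2 / \<theta>)) - \<eta> * D * (a + e) + \<eta> * (3 * \<rho> * (a + e))) * v"
        unfolding S_def .
      also have "(\<theta> - \<eta>) * (2 / \<theta>) = 2 - \<eta> * (a * D)"
        unfolding aD[symmetric] using \<theta> by (simp add: field_simps)
      also have "2 - (1 - \<delta>) * (2 - \<eta> * (a * D)) - \<eta> * D * (a + e) + \<eta> * (3 * \<rho> * (a + e)) =
          2 * \<delta> - \<delta> * (\<eta> * a * D) - \<eta> * e * D / 2"
        unfolding \<rho>ae by (simp add: algebra_simps)
      also have "\<dots> * v \<le> - c * v"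
      proof (rule mult_right_mono[OF _ v])
        have "0 \<le> \<delta> * (\<eta> * a * D)" using \<delta> \<eta> a D by simp
        then show "2 * \<delta> - \<delta> * (\<eta> * a * D) - \<eta> * e * D / 2 \<le> - c"
          using \<delta>(3) \<delta>(1) c unfolding c_def by linarith
      qed
      finally show "exp (2 * v) * exp (- (\<theta> - \<eta>) * S) * exp (- \<eta> * (D - 3 * \<rho>) * ((a + e) * v)) \<le> exp (- c * v)"
        unfolding exp_add[symmetric] by simp
    qed
    finally have P1: "?P (reaches (2 ^ k) ?J1 S) \<le> exp (- c * v) * B1" .
    have "?P (reaches (2 ^ k) ?J2 S) \<le> exp (2 * v) * exp (- (\<theta> + \<eta>) * S) * exp (\<eta> * (D + 3 * \<rho>) * ((a - e) * v)) * B2"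
      unfolding B2_def pow[symmetric]
    proof (rule prob_reaches_lengths[OF t2 \<rho>\<eta> C2])
      fix \<kappa> assume "\<kappa> \<in> ?J2"
      then have \<kappa>: "real \<kappa> \<le> (a - e) * v" by simp
      have "\<kappa> * (Psi (\<theta> + \<eta>) + \<rho> * \<eta> + \<rho> * \<eta>) \<le> \<kappa> * (\<eta> * (D + 3 * \<rho>))"
        using up by (intro mult_left_mono) (auto simp: algebra_simps)
      also have "\<dots> \<le> ((a - e) * v) * (\<eta> * (D + 3 * \<rho>))"
        using \<kappa> \<eta> \<rho> D by (intro mult_right_mono) auto
      finally show "\<kappa> * (Psi (\<theta> + \<eta>) + \<rho> * \<eta> + \<rho> * \<eta>) \<le> \<eta> * (D + 3 * \<rho>) * ((a - e) * v)"
        by (simp only: mult.commute)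
    qed
    also have "\<dots> \<le> exp (- c * v) * B2"
    proof (rule mult_right_mono[OF _ B(2)])
      have "2 * v + - (\<theta> + \<eta>) * ((1 - \<delta>) * q * v) + \<eta> * (D + 3 * \<rho>) * ((a - e) * v) =
          (2 - (1 - \<delta>) * ((\<theta> + \<eta>) * q) + \<eta> * D * (a - e) + \<eta> * (3 * \<rho> * (a + e)) - 6 * \<eta> * \<rho> * e) * v" for q
        by (simp add: algebra_simps)
      then have "2 * v + - (\<theta> + \<eta>) * S + \<eta> * (D + 3 * \<rho>) * ((a - e) * v) =
          (2 - (1 - \<delta>) * ((\<theta> + \<eta>) * (2 / \<theta>)) + \<eta> * D * (a - e) + \<eta> * (3 * \<rho> * (a + e)) - 6 * \<eta> * \<rho> * e) * v"
        unfolding S_def .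
      also have "(\<theta> + \<eta>) * (2 / \<theta>) = 2 + \<eta> * (2 / \<theta>)" using \<theta> by (simp add: field_simps)
      also have "2 - (1 - \<delta>) * (2 + \<eta> * (2 / \<theta>)) + \<eta> * D * (a - e) + \<eta> * (3 * \<rho> * (a + e)) - 6 * \<eta> * \<rho> * e =
          2 * \<delta> + \<delta> * (\<eta> * (2 / \<theta>)) - \<eta> * e * D / 2 - 6 * \<eta> * \<rho> * e"
        unfolding \<rho>ae aD by (simp add: algebra_simps)
      also have "\<dots> * v \<le> - c * v"
      proof (rule mult_right_mono[OF _ v])
        have "\<eta> * (2 / \<theta>) \<le> 2" using \<eta> \<theta> by (simp add: field_simps)
        then have "\<delta> * (\<eta> * (2 / \<theta>)) \<le> \<delta> * 2" using \<delta> by (intro mult_left_mono) auto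
        moreover have "0 \<le> 6 * \<eta> * \<rho> * e" using \<eta> \<rho> e by simp
        ultimately show "2 * \<delta> + \<delta> * (\<eta> * (2 / \<theta>)) - \<eta> * e * D / 2 - 6 * \<eta> * \<rho> * e \<le> - c"
          using \<delta>(3) unfolding c_def by linarith
      qed
      finally show "exp (2 * v) * exp (- (\<theta> + \<eta>) * S) * exp (\<eta> * (D + 3 * \<rho>) * ((a - e) * v)) \<le> exp (- c * v)"
        unfolding exp_add[symmetric] by simp
    qed
    finally have P2: "?P (reaches (2 ^ k) ?J2 S) \<le> exp (- c * v) * B2" .
    have "reaches (2 ^ k) {\<kappa>. (a + e) * v \<le> real \<kappa> \<or> real \<kappa> \<le> (a - e) * v} S = reaches (2 ^ k) ?J1 S \<union> reaches (2 ^ k) ?J2 S"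
      unfolding reaches_def by auto
    then have "?P (reaches (2 ^ k) {\<kappa>. (a + e) * v \<le> real \<kappa> \<or> real \<kappa> \<le> (a - e) * v} S) \<le>
        ?P (reaches (2 ^ k) ?J1 S) + ?P (reaches (2 ^ k) ?J2 S)"
      by (simp add: measure_subadditive)
    also have "\<dots> \<le> (B1 + B2) * exp (- c * v)" using P1 P2 by (simp add: algebra_simps)
    finally show ?thesis unfolding S_def v_def by (simp add: mult_ac)
  qed
  have "0 < c * ln 2" using c by simp
  from that[OF \<delta>(1,2) this bound[unfolded a_def]] show ?thesis .
qed

end

section \<open>Words read off the letter sequences\<close>

lemma pmf_replicate_Suc: "pmf (replicate_pmf (Suc n) p) (x # xs) = pmf p x * pmf (replicate_pmf n p) xs"
proof -
  have "inj (\<lambda>(x, xs). x # xs)" by (auto simp: inj_on_def)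
  then show ?thesis
    unfolding replicate_pmf_Suc_map
    using pmf_map_inj'[of "\<lambda>(x, xs). x # xs" "pair_pmf p (replicate_pmf n p)" "(x, xs)"] by (simp add: pmf_pair)
qed

lemma pmf_replicate:
  assumes "length xs = n"
  shows "pmf (replicate_pmf n p) xs = (\<Prod>i\<in>{1..n}. pmf p (letter xs i))"
proof -
  have "pmf (replicate_pmf n p) xs = (\<Prod>i<n. pmf p (xs ! i))"
    using assms
  proof (induction n arbitrary: xs)
    case (Suc n)
    then obtain y ys where xs: "xs = y # ys" "length ys = n" by (cases xs) auto
    show ?case
      unfolding xs(1) pmf_replicate_Suc Suc.IH[OF xs(2)] prod.lessThan_Suc_shift by simp
  qed simp
  also have "\<dots> = (\<Prod>i\<in>{1..n}. pmf p (letter xs i))"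
    by (simp add: prod.atLeast1_atMost_eq letter_def)
  finally show ?thesis .
qed

lemma pmf_replicate_0: "length xs \<noteq> n \<Longrightarrow> pmf (replicate_pmf n p) xs = 0"
  by (auto simp: pmf_eq_0_set_pmf dest: length_replicate_pmf)

definition prefix_word :: "(nat \<Rightarrow> 'a) \<Rightarrow> nat \<Rightarrow> 'a list" where
  "prefix_word x n = map x [1..<Suc n]"

lemma length_prefix_word [simp]: "length (prefix_word x n) = n"
  unfolding prefix_word_def by (simp del: upt_Suc)

lemma letter_prefix_word: "1 \<le> i \<Longrightarrow> i \<le> n \<Longrightarrow> letter (prefix_word x n) i = x i"
  unfolding letter_def prefix_word_def by (simp del: upt_Suc)

lemma prefix_word_eq_iff: "prefix_word x n = xs \<longleftrightarrow> length xs = n \<and> (\<forall>i\<in>{1..n}. x i = letter xs i)"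
proof (intro iffI conjI)
  assume *: "length xs = n \<and> (\<forall>i\<in>{1..n}. x i = letter xs i)"
  show "prefix_word x n = xs"
  proof (rule nth_equalityI)
    fix i assume "i < length (prefix_word x n)"
    then have "i < n" by simp
    then show "prefix_word x n ! i = xs ! i"
      using * letter_prefix_word[of "Suc i" n x] unfolding letter_def by auto
  qed (use * in simp)
qed (auto simp: letter_prefix_word)

locale random_letters = prob_space M + scoring_model \<mu> K g
  for M :: "'w measure" and \<mu> :: "'a::finite pmf" and K g +
  fixes X Y :: "nat \<Rightarrow> 'w \<Rightarrow> 'a"
  assumes indep: "indep_vars (\<lambda>_. count_space UNIV) (case_sum X Y) ({1..} <+> {1..})"
    and X_law: "1 \<le> i \<Longrightarrow> distr M (count_space UNIV) (X i) = measure_pmf \<mu>"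
    and Y_law: "1 \<le> i \<Longrightarrow> distr M (count_space UNIV) (Y i) = measure_pmf \<mu>"
begin

definition prefix_words :: "nat \<Rightarrow> nat \<Rightarrow> 'w \<Rightarrow> 'a list \<times> 'a list" where
  "prefix_words m n \<omega> = (prefix_word (\<lambda>i. X i \<omega>) m, prefix_word (\<lambda>j. Y j \<omega>) n)"

lemma letter_measurable:
  assumes "1 \<le> i"
  shows "X i \<in> measurable M (count_space UNIV)" "Y i \<in> measurable M (count_space UNIV)"
proof -
  have *: "case_sum X Y j \<in> measurable M (count_space UNIV)" if "j \<in> {1..} <+> {1..}" for j
    using indep that unfolding indep_vars_def by auto
  show "X i \<in> measurable M (count_space UNIV)" "Y i \<in> measurable M (count_space UNIV)"
    using *[of "Inl i"] *[of "Inr i"] assms by auto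
qed

lemma letter_prob:
  assumes "1 \<le> i"
  shows "prob (X i -` {a} \<inter> space M) = pmf \<mu> a" "prob (Y i -` {a} \<inter> space M) = pmf \<mu> a"
proof -
  have "measure (distr M (count_space UNIV) (X i)) {a} = prob (X i -` {a} \<inter> space M)"
    by (rule measure_distr[OF letter_measurable(1)[OF assms]]) simp
  then show "prob (X i -` {a} \<inter> space M) = pmf \<mu> a" unfolding X_law[OF assms] by (simp add: pmf.rep_eq)
  have "measure (distr M (count_space UNIV) (Y i)) {a} = prob (Y i -` {a} \<inter> space M)"
    by (rule measure_distr[OF letter_measurable(2)[OF assms]]) simp
  then show "prob (Y i -` {a} \<inter> space M) = pmf \<mu> a" unfolding Y_law[OF assms] by (simp add: pmf.rep_eq)
qed

definition target :: "'a list \<Rightarrow> 'a list \<Rightarrow> nat + nat \<Rightarrow> 'a" where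
  "target xs ys = case_sum (letter xs) (letter ys)"

lemma prefix_words_vimage:
  assumes "length xs = m" "length ys = n" "1 \<le> m"
  shows "prefix_words m n -` {(xs, ys)} \<inter> space M =
    (\<Inter>j\<in>{1..m} <+> {1..n}. case_sum X Y j -` {target xs ys j} \<inter> space M)"
proof -
  have Plus: "(\<forall>j\<in>A <+> B. P j) \<longleftrightarrow> (\<forall>i\<in>A. P (Inl i)) \<and> (\<forall>i\<in>B. P (Inr i))" for A B and P :: "nat + nat \<Rightarrow> bool"
    by (auto simp: Plus_def)
  show ?thesis
    using assms unfolding prefix_words_def target_def by (auto simp: prefix_word_eq_iff Plus)
qed

lemma prefix_words_vimage_sets: "1 \<le> m \<Longrightarrow> prefix_words m n -` {p} \<inter> space M \<in> sets M"
proof -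
  assume m: "1 \<le> m"
  obtain xs ys where p: "p = (xs, ys)" by force
  show ?thesis
  proof (cases "length xs = m \<and> length ys = n")
    case True
    have "case_sum X Y j -` {a} \<inter> space M \<in> sets M" if "j \<in> {1..m} <+> {1..n}" for j a
    proof -
      have "case_sum X Y j \<in> measurable M (count_space UNIV)"
        using that letter_measurable by auto
      then show ?thesis by (rule measurable_sets) simp
    qed
    then have "(\<Inter>j\<in>{1..m} <+> {1..n}. case_sum X Y j -` {target xs ys j} \<inter> space M) \<in> sets M"
      using m by (intro sets.finite_INT) auto
    then show ?thesis unfolding p using prefix_words_vimage[of xs m ys n] True m by metis
  next
    case False
    then have "prefix_words m n -` {p} \<inter> space M = {}" unfolding p prefix_words_def by (auto simp: prefix_word_eq_iff)
    then show ?thesis by simp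
  qed
qed

lemma prefix_words_measurable:
  "1 \<le> m \<Longrightarrow> prefix_words m n \<in> measurable M (count_space UNIV)"
  unfolding measurable_count_space_eq2_countable using prefix_words_vimage_sets by auto

lemma prefix_words_law:
  assumes m: "1 \<le> m"
  shows "distr M (count_space UNIV) (prefix_words m n) = measure_pmf (words m n)"
proof (rule measure_eqI_countable[of _ UNIV])
  fix p :: "'a list \<times> 'a list"
  obtain xs ys where p: "p = (xs, ys)" by force
  have "prob (prefix_words m n -` {p} \<inter> space M) = pmf (words m n) p"
  proof (cases "length xs = m \<and> length ys = n")
    case True
    let ?J = "{1..m} <+> {1..n}"
    have "prob (prefix_words m n -` {p} \<inter> space M) = prob (\<Inter>j\<in>?J. case_sum X Y j -` {target xs ys j} \<inter> space M)"
      unfolding p using prefix_words_vimage[of xs m ys n] True m by simp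
    also have "\<dots> = (\<Prod>j\<in>?J. prob (case_sum X Y j -` {target xs ys j} \<inter> space M))"
      by (rule indep_varsD[OF indep]) (use m in auto)
    also have "\<dots> = (\<Prod>j\<in>{1..m}. prob (X j -` {letter xs j} \<inter> space M)) * (\<Prod>j\<in>{1..n}. prob (Y j -` {letter ys j} \<inter> space M))"
      by (simp add: prod.Plus target_def)
    also have "\<dots> = (\<Prod>j\<in>{1..m}. pmf \<mu> (letter xs j)) * (\<Prod>j\<in>{1..n}. pmf \<mu> (letter ys j))"
      by (simp add: letter_prob)
    also have "\<dots> = pmf (words m n) p"
      unfolding p words_def pmf_pair using True by (simp add: pmf_replicate)
    finally show ?thesis .
  next
    case False
    then have "prefix_words m n -` {p} \<inter> space M = {}" unfolding p prefix_words_def by (auto simp: prefix_word_eq_iff)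
    moreover have "pmf (words m n) p = 0"
      unfolding p words_def pmf_pair using False pmf_replicate_0[of xs m] pmf_replicate_0[of ys n] by auto
    ultimately show ?thesis by simp
  qed
  then show "emeasure (distr M (count_space UNIV) (prefix_words m n)) {p} = emeasure (measure_pmf (words m n)) {p}"
    using emeasure_distr[OF prefix_words_measurable[OF m], of "{p}" n]
    by (simp add: emeasure_eq_measure emeasure_pmf_single)
qed auto

lemma prob_prefix_words:
  "1 \<le> m \<Longrightarrow> prob (prefix_words m n -` A \<inter> space M) = measure_pmf.prob (words m n) A"
  using measure_distr[OF prefix_words_measurable, of m A n] prefix_words_law[of m n] by simp

lemma h_kappa_eq_hk:
  assumes "1 \<le> \<kappa>"
  shows "h_kappa M X Y K g \<kappa> t = hk \<kappa> t"
  unfolding h_kappa_def hk_def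
proof (rule infsum_cong)
  fix p assume p: "p \<in> {\<kappa>..} \<times> {\<kappa>..}"
  obtain m n where mn: "p = (m, n)" by force
  have le: "\<kappa> \<le> m" "\<kappa> \<le> n" "1 \<le> m" using p assms mn by auto
  let ?F = "\<lambda>(xs, ys). exp (t * Gwords \<kappa> xs ys)"
  have "real_of_ereal (anchored_score K g \<kappa> (\<lambda>i. X i \<omega>) (\<lambda>i. Y i \<omega>) m n) =
      Gwords \<kappa> (prefix_word (\<lambda>i. X i \<omega>) m) (prefix_word (\<lambda>i. Y i \<omega>) n)" for \<omega>
  proof -
    have "Gmax K g \<kappa> (\<lambda>i. X i \<omega>) (\<lambda>i. Y i \<omega>) m n = Gmax K g \<kappa> (letter (prefix_word (\<lambda>i. X i \<omega>) m)) (letter (prefix_word (\<lambda>i. Y i \<omega>) n)) m n"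
      by (rule Gmax_cong) (auto simp: letter_prefix_word)
    moreover have "real_of_ereal (anchored_score K g \<kappa> (\<lambda>i. X i \<omega>) (\<lambda>i. Y i \<omega>) m n) = Gmax K g \<kappa> (\<lambda>i. X i \<omega>) (\<lambda>i. Y i \<omega>) m n"
      by (rule real_of_anchored_score) (use g_0 assms le in auto)
    ultimately show ?thesis unfolding Gwords_def by simp
  qed
  then have "(LINT \<omega>|M. exp (t * real_of_ereal (anchored_score K g \<kappa> (\<lambda>i. X i \<omega>) (\<lambda>i. Y i \<omega>) m n))) =
      (LINT \<omega>|M. ?F (prefix_words m n \<omega>))" unfolding prefix_words_def by simp
  also have "\<dots> = expect (words m n) ?F"
    unfolding prefix_words_law[OF le(3), symmetric]
    by (rule integral_distr[symmetric, OF prefix_words_measurable[OF le(3)]]) simp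
  finally show "(case p of (m, n) \<Rightarrow> LINT \<omega>|M. exp (t * real_of_ereal (anchored_score K g \<kappa> (\<lambda>i. X i \<omega>) (\<lambda>i. Y i \<omega>) m n))) =
      (case p of (m, n) \<Rightarrow> mgf \<kappa> m n t)" unfolding mn mgf_def by simp
qed

lemma psi_eq_Psi: "psi M X Y K g = Psi"
proof
  fix t
  have "(\<lambda>\<kappa>. psi_kappa M X Y K g \<kappa> t / real \<kappa>) = (\<lambda>\<kappa>. ln (hk \<kappa> t) / real \<kappa>)"
  proof
    fix \<kappa>
    show "psi_kappa M X Y K g \<kappa> t / real \<kappa> = ln (hk \<kappa> t) / real \<kappa>"
      using h_kappa_eq_hk[of \<kappa> t] unfolding psi_kappa_def by (cases "\<kappa> = 0") auto
  qed
  then show "psi M X Y K g t = Psi t" unfolding psi_def Psi_def by simp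
qed

text \<open>
  Borel--Cantelli along powers of \<open>2\<close>, where a probability bound \<open>n\<^sup>-\<^sup>c\<close> becomes a geometric
  sequence.
\<close>

lemma AE_eventually_not_prefix_words:
  assumes "summable b" "\<forall>\<^sub>F k in sequentially. measure_pmf.prob (words (2 ^ k) (2 ^ k)) (A k) \<le> b k"
  shows "AE \<omega> in M. \<forall>\<^sub>F k in sequentially. prefix_words (2 ^ k) (2 ^ k) \<omega> \<notin> A k"
proof -
  define E where "E k = prefix_words (2 ^ k) (2 ^ k) -` A k \<inter> space M" for k
  have pk: "1 \<le> (2 :: nat) ^ k" for k by simp
  have E: "E k \<in> sets M" for k
    unfolding E_def by (rule measurable_sets[OF prefix_words_measurable[OF pk]]) simp
  have "AE \<omega> in M. \<forall>\<^sub>F k in sequentially. \<omega> \<in> space M - E k"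
  proof (rule borel_cantelli_AE1[OF E])
    show "emeasure M (E k) < \<infinity>" for k by (simp add: emeasure_eq_measure)
    show "summable (\<lambda>k. measure M (E k))"
    proof (rule summable_comparison_test_ev[OF _ assms(1)])
      show "\<forall>\<^sub>F k in sequentially. norm (measure M (E k)) \<le> b k"
        using assms(2) by eventually_elim (simp add: E_def prob_prefix_words[OF pk])
    qed
  qed
  then show ?thesis
  proof eventually_elim
    case (elim \<omega>)
    then show ?case by eventually_elim (auto simp: E_def)
  qed
qed

lemma prefix_words_reaches_iff:
  "prefix_words n n \<omega> \<in> reaches n J s \<longleftrightarrow>
    (\<exists>z\<in>alignments. fits n n z \<and> length z \<in> J \<and> s \<le> raw_score K g (\<lambda>i. X i \<omega>) (\<lambda>i. Y i \<omega>) z)"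
proof -
  have "raw_score K g (letter (prefix_word (\<lambda>i. X i \<omega>) n)) (letter (prefix_word (\<lambda>i. Y i \<omega>) n)) z =
      raw_score K g (\<lambda>i. X i \<omega>) (\<lambda>i. Y i \<omega>) z" if z: "z \<in> alignments" "fits n n z" for z
    by (rule raw_score_cong_fits[OF z]) (simp_all add: letter_prefix_word)
  then show ?thesis unfolding prefix_words_def reaches_def by auto
qed

end

section \<open>Optimal alignments\<close>

lemma linear_order_finite_least:
  assumes "linear_order_on A r" "finite S" "S \<noteq> {}" "S \<subseteq> A"
  obtains z where "z \<in> S" "\<And>w. w \<in> S \<Longrightarrow> (z, w) \<in> r"
proof -
  have r: "refl_on A r" "trans r" "total_on A r"
    using assms(1) unfolding linear_order_on_def partial_order_on_def preorder_on_def by auto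
  have "\<exists>z\<in>S. \<forall>w\<in>S. (z, w) \<in> r"
    using assms(2-4)
  proof (induction S rule: finite_ne_induct)
    case (singleton x)
    then show ?case using r(1) by (auto dest: refl_onD)
  next
    case (insert x S)
    then obtain z where z: "z \<in> S" "\<forall>w\<in>S. (z, w) \<in> r" by auto
    have xx: "(x, x) \<in> r" using insert.prems r(1) by (auto dest: refl_onD)
    show ?case
    proof (cases "(x, z) \<in> r")
      case True
      then have "\<forall>w\<in>insert x S. (x, w) \<in> r" using z(2) xx r(2) by (auto dest: transD)
      then show ?thesis by blast
    next
      case False
      then have "x \<noteq> z" using xx by auto
      then have "(z, x) \<in> r" using False r(3) insert.prems z(1) unfolding total_on_def by auto
      then show ?thesis using z by auto
    qed
  qed
  then show ?thesis using that by blast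
qed

lemma optimal_alignments_eq:
  assumes "1 \<le> n"
  shows "optimal_alignments K g x y n = {z \<in> alignments. fits n n z \<and>
    (\<forall>w\<in>alignments. fits n n w \<longrightarrow> raw_score K g x y w \<le> raw_score K g x y z)}"
    and "optimal_alignments K g x y n \<noteq> {}"
proof -
  define F where "F = {z \<in> alignments. fits n n z}"
  have finF: "finite F" unfolding F_def by (rule finite_fitting)
  have "[(1, 1)] \<in> F" unfolding F_def alignments_def fits_def using assms by auto
  then have neF: "F \<noteq> {}" by auto
  define R where "R = Max (raw_score K g x y ` F)"
  have Rin: "R \<in> raw_score K g x y ` F" unfolding R_def by (rule Max_in) (use finF neF in auto)
  have Rge: "raw_score K g x y z \<le> R" if "z \<in> F" for z
    unfolding R_def by (rule Max_ge) (use finF that in auto)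
  have sc: "align_score K g z x y n n = ereal (raw_score K g x y z)" if "z \<in> F" for z
    using that align_score_eq_raw_score[of z n n K g x y] unfolding F_def alignments_def by auto
  have sci: "align_score K g z x y n n = - \<infinity>" if "z \<in> alignments - F" for z
    using that unfolding F_def fits_def align_score_def by auto
  have "local_score K g x y n n = ereal R"
  proof (rule antisym)
    show "local_score K g x y n n \<le> ereal R"
      unfolding local_score_def
    proof (rule SUP_least)
      fix z assume "z \<in> alignments"
      then show "align_score K g z x y n n \<le> ereal R" using sc[of z] sci[of z] Rge[of z] by (cases "z \<in> F") auto
    qed
    obtain z where z: "z \<in> F" "R = raw_score K g x y z" using Rin by auto
    show "ereal R \<le> local_score K g x y n n"
      unfolding local_score_def z(2) sc[OF z(1), symmetric] by (rule SUP_upper) (use z in \<open>auto simp: F_def\<close>)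
  qed
  moreover have "align_score K g z x y n n = ereal R \<longleftrightarrow> z \<in> F \<and> raw_score K g x y z = R" if "z \<in> alignments" for z
    using sc[of z] sci[of z] that by (cases "z \<in> F") auto
  ultimately have opt: "optimal_alignments K g x y n = {z \<in> F. raw_score K g x y z = R}"
    unfolding optimal_alignments_def by (auto simp: F_def)
  then show "optimal_alignments K g x y n \<noteq> {}" using Rin by auto
  show "optimal_alignments K g x y n = {z \<in> alignments. fits n n z \<and>
    (\<forall>w\<in>alignments. fits n n w \<longrightarrow> raw_score K g x y w \<le> raw_score K g x y z)}"
  proof -
    have "raw_score K g x y z = R \<longleftrightarrow> (\<forall>w\<in>F. raw_score K g x y w \<le> raw_score K g x y z)" if "z \<in> F" for z
      using Rin Rge that by (auto intro: antisym)
    then show ?thesis unfolding opt by (auto simp: F_def)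
  qed
qed

lemma optimal_alignment_mem:
  assumes "linear_order_on alignments r" "1 \<le> n"
  shows "optimal_alignment r K g x y n \<in> optimal_alignments K g x y n"
proof -
  let ?O = "optimal_alignments K g x y n"
  have O: "?O \<subseteq> alignments" unfolding optimal_alignments_def by auto
  have "finite ?O" by (rule finite_subset[OF _ finite_fitting[of n n]]) (auto simp: optimal_alignments_eq(1)[OF assms(2)])
  then obtain z where z: "z \<in> ?O" "\<And>w. w \<in> ?O \<Longrightarrow> (z, w) \<in> r"
    using linear_order_finite_least[OF assms(1) _ optimal_alignments_eq(2)[OF assms(2)] O] by blast
  have "antisym r" using assms(1) unfolding linear_order_on_def partial_order_on_def by auto
  then have "optimal_alignment r K g x y n = z"
    unfolding optimal_alignment_def using z by (intro the_equality) (auto dest: antisymD)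
  then show ?thesis using z(1) by simp
qed

section \<open>The number of matches\<close>

context random_letters
begin

text \<open>
  The score threshold is the one for the next power of \<open>2\<close>: it has to be met by optimal alignments
  for all \<open>n\<close> between \<open>2\<^sup>k\<close> and \<open>2\<^bsup>k + 1\<^esup>\<close>.
\<close>

lemma AE_local_score_large:
  assumes \<theta>: "0 < \<theta>" and root: "Psi \<theta> = 0" and D: "0 < D" "(Psi has_real_derivative D) (at \<theta>)"
    and \<delta>: "0 < \<delta>" "\<delta> < 1"
  shows "AE \<omega> in M. \<forall>\<^sub>F k in sequentially.
     prefix_words (2 ^ k) (2 ^ k) \<omega> \<in> reaches (2 ^ k) UNIV ((1 - \<delta>) * (2 / \<theta>) * (real (Suc k) * ln 2))"
proof -
  obtain h where h: "0 < h" "\<And>u. 0 < u \<Longrightarrow> u < h \<Longrightarrow> Psi \<theta> < Psi (\<theta> + u)"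
    using DERIV_pos_inc_right[OF D(2,1)] by blast
  define u where "u = min h (\<theta> * \<delta> / 2) / 2"
  have "0 < \<theta> * \<delta>" using \<theta> \<delta> by simp
  then have u: "0 < u" "u < h" "u \<le> \<theta> * \<delta> / 2" unfolding u_def using h(1) by linarith+
  define t where "t = \<theta> + u"
  have t: "0 < t" "0 < Psi t" using u h(2)[of u] \<theta> root unfolding t_def by auto
  define \<epsilon> where "\<epsilon> = \<delta> / 16"
  have \<epsilon>: "0 < \<epsilon>" "\<epsilon> \<le> 1 / 8" unfolding \<epsilon>_def using \<delta> by auto
  \<comment> \<open>The parameter is close enough to the root for the gain from \<open>\<delta>\<close> to outweigh it.\<close>
  have gap: "(1 - \<delta>) * (2 / \<theta>) < 2 * (1 - 4 * \<epsilon>) / t"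
  proof -
    have "(1 - \<delta>) * t \<le> (1 - \<delta>) * (\<theta> * (1 + \<delta> / 2))"
      using u(3) \<delta> unfolding t_def by (intro mult_left_mono) (auto simp: algebra_simps)
    also have "\<dots> = \<theta> * ((1 - \<delta>) * (1 + \<delta> / 2))" by (simp only: mult.left_commute)
    also have "\<dots> < \<theta> * (1 - \<delta> / 4)"
    proof (rule mult_strict_left_mono[OF _ \<theta>])
      have "0 < \<delta> * \<delta>" "0 < \<delta>" using \<delta> by simp_all
      then show "(1 - \<delta>) * (1 + \<delta> / 2) < 1 - \<delta> / 4" by (simp add: algebra_simps, linarith)
    qed
    finally have "(1 - \<delta>) * t < \<theta> * (1 - 4 * \<epsilon>)" unfolding \<epsilon>_def by simp
    then have "(1 - \<delta>) * t * (2 / (\<theta> * t)) < \<theta> * (1 - 4 * \<epsilon>) * (2 / (\<theta> * t))"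
      by (rule mult_strict_right_mono) (use \<theta> t(1) in simp)
    moreover have "(1 - \<delta>) * t * (2 / (\<theta> * t)) = (1 - \<delta>) * (2 / \<theta>)" using t(1) by simp
    moreover have "\<theta> * (1 - 4 * \<epsilon>) * (2 / (\<theta> * t)) = 2 * (1 - 4 * \<epsilon>) / t" using \<theta> by simp
    ultimately show ?thesis by simp
  qed
  define p where "p = (1 - \<delta>) * (2 / \<theta>)"
  define q where "q = 2 * (1 - 4 * \<epsilon>) / t"
  have ev: "\<forall>\<^sub>F k in sequentially. p * (real (Suc k) * ln 2) \<le> q * (real k * ln 2)"
  proof -
    have "0 < q - p" using gap unfolding p_def q_def by simp
    then have "filterlim (\<lambda>k. (q - p) * real k) at_top sequentially" by real_asymp
    then have "\<forall>\<^sub>F k in sequentially. p \<le> (q - p) * real k" unfolding filterlim_at_top by blast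
    then show ?thesis
    proof eventually_elim
      case (elim k)
      then have "p * real (Suc k) \<le> q * real k" by (simp add: algebra_simps)
      then have "p * real (Suc k) * ln 2 \<le> q * real k * ln 2" by (rule mult_right_mono) simp
      then show ?case by (simp add: mult.assoc)
    qed
  qed
  have "summable (\<lambda>k. 6 * exp (- (\<epsilon> * ln 2)) ^ k)"
    using \<epsilon> by (intro summable_mult summable_geometric) simp
  moreover have "(\<lambda>k. 6 * exp (- (\<epsilon> * ln 2)) ^ k) = (\<lambda>k. 6 * exp (- (\<epsilon> * ln 2) * real k))"
    by (simp add: exp_of_nat_mult[symmetric] mult.commute)
  ultimately have "summable (\<lambda>k. 6 * exp (- (\<epsilon> * ln 2) * real k))" by simp
  from AE_eventually_not_prefix_words[OF this lower_tail[OF t \<epsilon>]]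
  show ?thesis
  proof eventually_elim
    case (elim \<omega>)
    then show ?case using ev
    proof eventually_elim
      case (elim k)
      then obtain z where z: "z \<in> alignments" "fits (2 ^ k) (2 ^ k) z"
        "q * (k * ln 2) \<le> raw_score K g (\<lambda>i. X i \<omega>) (\<lambda>i. Y i \<omega>) z"
        unfolding Compl_iff not_not prefix_words_reaches_iff q_def by blast
      then have "p * (real (Suc k) * ln 2) \<le> raw_score K g (\<lambda>i. X i \<omega>) (\<lambda>i. Y i \<omega>) z" using elim(2) by linarith
      then show ?case unfolding prefix_words_reaches_iff p_def using z by blast
    qed
  qed
qed

lemma AE_no_atypical_length:
  assumes \<theta>: "0 < \<theta>" and root: "Psi \<theta> = 0" and D: "0 < D" "(Psi has_real_derivative D) (at \<theta>)"
    and e: "0 < e"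
  obtains \<delta> where "0 < \<delta>" "\<delta> < 1" "AE \<omega> in M. \<forall>\<^sub>F k in sequentially. prefix_words (2 ^ k) (2 ^ k) \<omega> \<notin>
     reaches (2 ^ k) {\<kappa>. (2 / (\<theta> * D) + e) * (k * ln 2) \<le> \<kappa> \<or> \<kappa> \<le> (2 / (\<theta> * D) - e) * (k * ln 2)}
       ((1 - \<delta>) * (2 / \<theta>) * (k * ln 2))"
proof -
  obtain \<delta> c C where *: "0 < \<delta>" "\<delta> < 1" "0 < c"
    "\<And>k. measure_pmf.prob (words (2 ^ k) (2 ^ k))
       (reaches (2 ^ k) {\<kappa>. (2 / (\<theta> * D) + e) * (k * ln 2) \<le> \<kappa> \<or> \<kappa> \<le> (2 / (\<theta> * D) - e) * (k * ln 2)}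
         ((1 - \<delta>) * (2 / \<theta>) * (k * ln 2))) \<le> C * exp (- c * k)"
    by (rule upper_tail[OF assms], rule that)
  have "summable (\<lambda>k. C * exp (- c) ^ k)"
    using *(3) by (intro summable_mult summable_geometric) simp
  moreover have "(\<lambda>k. C * exp (- c) ^ k) = (\<lambda>k. C * exp (- c * real k))"
    by (simp add: exp_of_nat_mult[symmetric] mult.commute)
  ultimately have "summable (\<lambda>k. C * exp (- c * real k))" by simp
  from AE_eventually_not_prefix_words[OF this always_eventually[OF allI[OF *(4)]]]
  show ?thesis using that *(1,2) by blast
qed

text \<open>
  Between consecutive powers of \<open>2\<close> the optimal alignment scores at least as much as the best
  alignment for the smaller power, and it is a candidate alignment for the larger one.
\<close>

lemma AE_optimal_length_close:
  assumes \<theta>: "0 < \<theta>" and root: "Psi \<theta> = 0" and D: "0 < D" "(Psi has_real_derivative D) (at \<theta>)"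
    and r: "linear_order_on alignments r" and e: "0 < e"
  shows "AE \<omega> in M. \<forall>\<^sub>F n in sequentially.
    \<bar>real (length (optimal_alignment r K g (\<lambda>i. X i \<omega>) (\<lambda>i. Y i \<omega>) n)) / ln (real n) - 2 / (\<theta> * D)\<bar> \<le> 2 * e"
proof -
  define a where "a = 2 / (\<theta> * D)"
  have a: "0 < a" unfolding a_def using \<theta> D by simp
  obtain \<delta> where \<delta>: "0 < \<delta>" "\<delta> < 1" and atyp: "AE \<omega> in M. \<forall>\<^sub>F k in sequentially. prefix_words (2 ^ k) (2 ^ k) \<omega> \<notin>
     reaches (2 ^ k) {\<kappa>. (a + e) * (k * ln 2) \<le> \<kappa> \<or> \<kappa> \<le> (a - e) * (k * ln 2)}
       ((1 - \<delta>) * (2 / \<theta>) * (k * ln 2))"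
    by (rule AE_no_atypical_length[OF \<theta> root D e, folded a_def], rule that)
  obtain k0 :: nat where k0: "(a + e) / e \<le> k0" using real_arch_simple by blast
  show ?thesis
    using AE_local_score_large[OF \<theta> root D \<delta>] atyp
  proof eventually_elim
    case (elim \<omega>)
    let ?x = "\<lambda>i. X i \<omega>" and ?y = "\<lambda>i. Y i \<omega>"
    obtain k1 where k1: "\<And>k. k1 \<le> k \<Longrightarrow> prefix_words (2 ^ k) (2 ^ k) \<omega> \<in> reaches (2 ^ k) UNIV ((1 - \<delta>) * (2 / \<theta>) * (real (Suc k) * ln 2))"
      using elim(1) unfolding eventually_sequentially by blast
    obtain k2 where k2: "\<And>k. k2 \<le> k \<Longrightarrow> prefix_words (2 ^ k) (2 ^ k) \<omega> \<notin>
       reaches (2 ^ k) {\<kappa>. (a + e) * (k * ln 2) \<le> \<kappa> \<or> \<kappa> \<le> (a - e) * (k * ln 2)} ((1 - \<delta>) * (2 / \<theta>) * (k * ln 2))"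
      using elim(2) unfolding eventually_sequentially by blast
    define k3 where "k3 = Suc (max k0 (max k1 k2))"
    have close: "\<bar>real (length (optimal_alignment r K g ?x ?y n)) / ln (real n) - a\<bar> \<le> 2 * e" if n: "2 ^ k3 \<le> n" for n
    proof -
      have n1: "1 \<le> n" using n by (metis le_trans one_le_numeral one_le_power)
      obtain k where k: "2 ^ k \<le> n" "n < 2 ^ (k + 1)"
        using ex_power_ivl1[of 2 n] n1 by auto
      have "(2 :: nat) ^ k3 < 2 ^ (k + 1)" using n k(2) by linarith
      then have "k3 < k + 1" by (rule power_less_imp_less_exp[rotated]) simp
      then have kk: "k0 \<le> k" "k1 \<le> k" "k2 \<le> Suc k" "1 \<le> k" unfolding k3_def by auto
      define z where "z = optimal_alignment r K g ?x ?y n"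
      have z: "z \<in> alignments" "fits n n z"
        "\<And>w. w \<in> alignments \<Longrightarrow> fits n n w \<Longrightarrow> raw_score K g ?x ?y w \<le> raw_score K g ?x ?y z"
      proof -
        have "z \<in> optimal_alignments K g ?x ?y n"
          unfolding z_def by (rule optimal_alignment_mem[OF r n1])
        note mem = this[unfolded optimal_alignments_eq(1)[OF n1] mem_Collect_eq]
        from mem show "z \<in> alignments" "fits n n z" by blast+
        show "raw_score K g ?x ?y w \<le> raw_score K g ?x ?y z" if "w \<in> alignments" "fits n n w" for w
          using mem that by blast
      qed
      obtain w where w: "w \<in> alignments" "fits (2 ^ k) (2 ^ k) w"
        "(1 - \<delta>) * (2 / \<theta>) * (real (Suc k) * ln 2) \<le> raw_score K g ?x ?y w"
        using k1[OF kk(2)] unfolding prefix_words_reaches_iff by blast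
      have "fits n n w" using w(2) k(1) unfolding fits_def by auto
      then have "(1 - \<delta>) * (2 / \<theta>) * (real (Suc k) * ln 2) \<le> raw_score K g ?x ?y z" using w z(3)[of w] by linarith
      moreover have "fits (2 ^ Suc k) (2 ^ Suc k) z" using z(2) k(2) unfolding fits_def by auto
      ultimately have len: "(a - e) * (Suc k * ln 2) < length z" "length z < (a + e) * (Suc k * ln 2)"
        using k2[OF kk(3)] z(1) unfolding prefix_words_reaches_iff by (auto simp: not_le)
      have ln_lower: "k * ln 2 \<le> ln (real n)"
      proof -
        have "real (2 ^ k) \<le> real n" using k(1) by (simp only: of_nat_le_iff)
        then have "ln (real (2 ^ k)) \<le> ln (real n)" by (rule ln_mono) simp
        then show ?thesis by (simp add: ln_realpow)
      qed
      have ln_upper: "ln (real n) \<le> Suc k * ln 2"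
      proof -
        have "n \<le> 2 ^ Suc k" using k(2) by simp
        then have "real n \<le> real (2 ^ Suc k)" by (simp only: of_nat_le_iff)
        then have "ln (real n) \<le> ln (real (2 ^ Suc k))" by (rule ln_mono) (use n1 in simp)
        also have "\<dots> = Suc k * ln 2" by (simp only: of_nat_power of_nat_numeral ln_realpow zero_less_numeral)
        finally show ?thesis .
      qed
      have ln_pos: "0 < ln (real n)" 
      proof -
        have "0 < k * (ln 2 :: real)" using kk(4) by simp
        then show ?thesis using ln_lower by linarith
      qed
      have up: "length z \<le> (a + 2 * e) * ln (real n)"
      proof -
        have "a + e \<le> e * k0" using k0 e by (simp add: field_simps)
        also have "\<dots> \<le> e * k" using kk(1) e by simp
        finally have "(a + e) * Suc k \<le> (a + 2 * e) * k" by (simp add: algebra_simps)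
        then have "(a + e) * Suc k * ln 2 \<le> (a + 2 * e) * k * ln 2" by (rule mult_right_mono) simp
        also have "\<dots> \<le> (a + 2 * e) * ln (real n)"
          unfolding mult.assoc using ln_lower a e by (intro mult_left_mono) auto
        finally show ?thesis using len(2) by (simp add: mult.assoc)
      qed
      have low: "(a - e) * ln (real n) \<le> length z"
      proof (cases "0 \<le> a - e")
        case True
        then have "(a - e) * ln (real n) \<le> (a - e) * (Suc k * ln 2)" using ln_upper by (rule mult_left_mono[rotated])
        then show ?thesis using len(1) by linarith
      next
        case False
        then have "(a - e) * ln (real n) \<le> 0" using ln_pos by (simp add: mult_nonpos_nonneg)
        then show ?thesis by linarith
      qed
      have "length z / ln (real n) \<le> a + 2 * e" "a - e \<le> length z / ln (real n)"
        using up low ln_pos by (simp_all add: field_simps)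
      then show ?thesis using e unfolding z_def by linarith
    qed
    then show ?case unfolding a_def eventually_sequentially by blast
  qed
qed

lemma AE_optimal_length_limit:
  assumes "0 < \<theta>" "Psi \<theta> = 0" "0 < D" "(Psi has_real_derivative D) (at \<theta>)" "linear_order_on alignments r"
  shows "AE \<omega> in M.
    (\<lambda>n. real (length (optimal_alignment r K g (\<lambda>i. X i \<omega>) (\<lambda>i. Y i \<omega>) n)) / ln (real n)) \<longlonglongrightarrow> 2 / (\<theta> * D)"
proof -
  let ?L = "\<lambda>\<omega> n. real (length (optimal_alignment r K g (\<lambda>i. X i \<omega>) (\<lambda>i. Y i \<omega>) n)) / ln (real n)"
  have "AE \<omega> in M. \<forall>m :: nat. \<forall>\<^sub>F n in sequentially. \<bar>?L \<omega> n - 2 / (\<theta> * D)\<bar> \<le> 2 * (1 / (real m + 1))"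
    unfolding AE_all_countable by (intro allI AE_optimal_length_close assms) simp
  then show ?thesis
  proof eventually_elim
    case (elim \<omega>)
    show ?case
    proof (rule tendstoI)
      fix e :: real assume "0 < e"
      then obtain m :: nat where m: "2 / e < m" using reals_Archimedean2 by blast
      then have lt: "2 * (1 / (real m + 1)) < e" using \<open>0 < e\<close> by (simp add: field_simps)
      from elim have "\<forall>\<^sub>F n in sequentially. \<bar>?L \<omega> n - 2 / (\<theta> * D)\<bar> \<le> 2 * (1 / (real m + 1))" by blast
      then show "\<forall>\<^sub>F n in sequentially. dist (?L \<omega> n) (2 / (\<theta> * D)) < e"
        unfolding dist_real_def by (rule eventually_mono) (rule le_less_trans[OF _ lt])
    qed
  qed
qed

end

theorem theorem3:
  fixes M :: "'w measure"
    and X Y :: "nat \<Rightarrow> 'w \<Rightarrow> 'a::finite"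
    and \<mu> :: "'a pmf"
    and K :: "'a \<Rightarrow> 'a \<Rightarrow> real"
    and g :: "nat \<Rightarrow> real"
    and r :: "alignment rel"
    and \<theta> D :: real
  assumes "prob_space M"
    and "prob_space.indep_vars M (\<lambda>_. count_space UNIV) (case_sum X Y) ({1..} <+> {1..})"
    and "\<And>i. 1 \<le> i \<Longrightarrow> distr M (count_space UNIV) (X i) = measure_pmf \<mu>"
    and "\<And>i. 1 \<le> i \<Longrightarrow> distr M (count_space UNIV) (Y i) = measure_pmf \<mu>"
    and "\<And>a. 0 < pmf \<mu> a"
    and "\<And>a b. K a b = K b a"
    and "(LINT \<omega>|M. K (X 1 \<omega>) (Y 1 \<omega>)) < 0"
    and "0 < Max (range (\<lambda>(a, b). K a b))"
    and "admissible_gap_penalty g"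
    and "filterlim (\<lambda>k. g k / ln (real k)) at_top sequentially"
    and "linear_order_on alignments r"
    and "0 < \<theta>"
    and "psi M X Y K g \<theta> = 0"
    and "\<And>t. 0 < t \<Longrightarrow> psi M X Y K g t = 0 \<Longrightarrow> t = \<theta>"
    and "(psi M X Y K g has_real_derivative D) (at \<theta>)"
  shows "AE \<omega> in M.
           (\<lambda>n. real (length (optimal_alignment r K g (\<lambda>i. X i \<omega>) (\<lambda>i. Y i \<omega>) n)) / ln (real n))
             \<longlonglongrightarrow> 2 / (\<theta> * D)"
proof -
  interpret prob_space M by (rule assms(1))
  interpret random_letters M \<mu> K g X Y
    by unfold_locales (rule assms(2) assms(6) assms(9) assms(10) | erule assms(3) assms(4))+
  note root = assms(13-15)[unfolded psi_eq_Psi]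
  have "0 < D" by (rule Psi_root_derivative_pos[OF assms(12) root])
  then show ?thesis by (rule AE_optimal_length_limit[OF assms(12) root(1) _ root(3) assms(11)])
qed

end
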